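(* Let $\beta\in(0,3)$ and let $(q,\lambda)$ be a smooth localization pair on $\Omega=(0,1)$ (as defined in the context). Then there exists a constant $C>0$, independent of $h$, $\delta$ and $u_0$, such that the following holds for every $\delta\in(0,\delta_* )$ and every $h=1/N$, $N\ge1$ an integer. Let $f\in L^2(\Omega)$ be such that the solution $u_0\in H_0^1(\Omega)$ of the local problem $-u_0''=f$ in $\Omega$, $u_0(0)=u_0(1)=0$, belongs to $H^4(\Omega)\cap H_0^1(\Omega)$, and let $u_{\delta,h}\in V_h$ be the solution of $\mathcal B_\delta(u_{\delta,h},v_h)=(f,v_h)$ for all $v_h\in V_h$. Then $$\|u_{\delta,h}-u_0\|_{\mathfrak W^{\beta,2}[\delta;q](\Omega)}\le C(h+\delta^2)\|u_0\|_{H^4(\Omega)}$$ and $$\|u_{\delta,h}-u_0\|_{L^2(\Omega)}\le C(h+\delta^2)\|u_0\|_{H^4(\Omega)}.$$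
   Context: Let $\Omega=(0,1)$, $d(x)=\operatorname{dist}(x,\partial\Omega)$, $\beta\in(0,3)$, and $(\cdot,\cdot)$ the $L^2(\Omega)$ inner product. Localization pair: functions $q:[0,\infty)\to[0,\infty)$ and $\lambda:\overline\Omega\to[0,\infty)$, together with constants $C_q\ge1$, $\kappa_0\ge1$, $\kappa_1,\kappa_2>0$, such that: (1) $q\in C^3([0,\infty))$, $q(0)=q'(0)=0$, $q''(0)>0$; $0<q(r)\le r$ for $r>0$; $0\le q'(r)\le1$ and $0\le q''(r)\le1$ for $r\ge0$; $q''\in C_b^1([0,\infty))$ (bounded with bounded continuous derivative); $q(2r)\le C_q q(r)$ for $r>0$. (2) $\lambda\in C^0(\overline\Omega)\cap C^2(\Omega)$; $\kappa_0^{-1}d(x)\le\lambda(x)\le\kappa_0 d(x)$ on $\overline\Omega$; $|\lambda(x)-\lambda(y)|\le\kappa_1|x-y|$ for $x,y\in\Omega$; $|\lambda^{(j)}(x)|\le\kappa_j d(x)^{1-j}$ for $x\in\Omega$, $j=0,1,2$; $\lambda'(0^+)=1$, $\lambda'(1^-)=-1$. Smooth localization pair: in addition $\lambda\in C^3(\Omega)$ and $|\lambda'''(x)|\le\kappa_3 d(x)^{-2}$ on $\Omega$ for some constant $\kappa_3>0$. Range of $\delta$: $\delta_*:=\min\{\delta_0,\bar\delta_0\}$, where $\delta_0=\bigl(3\max\{1,\kappa_1,C_q\kappa_0^{\log_2 C_q}\}\bigr)^{-1}$ and $\bar\delta_0$ is the smallest positive root of $\frac{\delta(1+\kappa_1\delta)}{(1-\kappa_1\delta)^2}=\frac13$.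 Put $\eta(x)=q(\lambda(x))$, $\eta_\delta(x)=\delta\eta(x)$, $C_\beta=\frac{3-\beta}{2}$, $w_\delta(x)=C_\beta\,\eta_\delta(x)^{-(3-\beta)}$. Bilinear form and norm: $$\mathcal B_\delta(u,v)=\int_0^1\int_0^1 w_\delta(x)\mathbf 1_{\{|y-x|<\eta_\delta(x)\}}\frac{(u(x)-u(y))(v(x)-v(y))}{|x-y|^\beta}\,dy\,dx,$$ $$\|u\|_{\mathfrak W^{\beta,2}[\delta;q](\Omega)}=\bigl(\|u\|_{L^2(\Omega)}^2+\mathcal B_\delta(u,u)\bigr)^{1/2}.$$ Finite element space: for an integer $N\ge1$, $h=1/N$, $x_i=ih$, $V_h$ is the space of $v_h\in C^0([0,1])$ that are affine on each $(x_{i-1},x_i]$, $i=1,\dots,N$, with $v_h(0)=v_h(1)=0$. The discrete problem has a unique solution. *)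

theory Defs
  imports "HOL-Analysis.Analysis"
begin

abbreviation Om :: "real set" where
  "Om \<equiv> {0<..<1}"

abbreviation leb :: "real measure" where
  "leb \<equiv> lebesgue_on Om"

definition bdist :: "real \<Rightarrow> real" where
  "bdist x = infdist x (frontier Om)"

section \<open>Classical derivatives\<close>

text \<open>Derivatives are taken within \<open>S\<close>, hence are one-sided at boundary points belonging to \<open>S\<close>
  (as for \<open>q\<close> at the origin) and ordinary derivatives at interior points.\<close>

primrec nderiv :: "real set \<Rightarrow> nat \<Rightarrow> (real \<Rightarrow> real) \<Rightarrow> real \<Rightarrow> real" where
  "nderiv S 0 f = f"
| "nderiv S (Suc n) f = (\<lambda>x. vector_derivative (nderiv S n f) (at x within S))"

definition Ck_on :: "nat \<Rightarrow> real set \<Rightarrow> (real \<Rightarrow> real) \<Rightarrow> bool" where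
  "Ck_on k S f \<longleftrightarrow>
     (\<forall>j<k. \<forall>x\<in>S. (nderiv S j f has_real_derivative nderiv S (Suc j) f x) (at x within S)) \<and>
     (\<forall>j\<le>k. continuous_on S (nderiv S j f))"

section \<open>Localization pairs\<close>

text \<open>In the condition on the second derivative of \<open>q\<close>, continuity of its derivative is part of
  \<open>Ck_on 3\<close>, so only the two bounds are listed.\<close>

definition localization_q :: "(real \<Rightarrow> real) \<Rightarrow> real \<Rightarrow> bool" where
  "localization_q q Cq \<longleftrightarrow>
     1 \<le> Cq \<and>
     (\<forall>r\<ge>0. 0 \<le> q r) \<and>
     Ck_on 3 {0..} q \<and>
     q 0 = 0 \<and> nderiv {0..} 1 q 0 = 0 \<and> 0 < nderiv {0..} 2 q 0 \<and>
     (\<forall>r>0. 0 < q r \<and> q r \<le> r) \<and>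
     (\<forall>r\<ge>0. 0 \<le> nderiv {0..} 1 q r \<and> nderiv {0..} 1 q r \<le> 1) \<and>
     (\<forall>r\<ge>0. 0 \<le> nderiv {0..} 2 q r \<and> nderiv {0..} 2 q r \<le> 1) \<and>
     bounded (nderiv {0..} 2 q ` {0..}) \<and> bounded (nderiv {0..} 3 q ` {0..}) \<and>
     (\<forall>r>0. q (2 * r) \<le> Cq * q r)"

text \<open>The boundary conditions on the first derivative of \<open>lam\<close> are one-sided limits of that
  derivative.\<close>

definition localization_lam :: "(real \<Rightarrow> real) \<Rightarrow> (nat \<Rightarrow> real) \<Rightarrow> bool" where
  "localization_lam lam \<kappa> \<longleftrightarrow>
     1 \<le> \<kappa> 0 \<and> 0 < \<kappa> 1 \<and> 0 < \<kappa> 2 \<and>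
     (\<forall>x\<in>closure Om. 0 \<le> lam x) \<and>
     continuous_on (closure Om) lam \<and> Ck_on 2 Om lam \<and>
     (\<forall>x\<in>closure Om. inverse (\<kappa> 0) * bdist x \<le> lam x \<and> lam x \<le> \<kappa> 0 * bdist x) \<and>
     (\<forall>x\<in>Om. \<forall>y\<in>Om. \<bar>lam x - lam y\<bar> \<le> \<kappa> 1 * \<bar>x - y\<bar>) \<and>
     (\<forall>j\<le>2. \<forall>x\<in>Om. \<bar>nderiv Om j lam x\<bar> \<le> \<kappa> j * bdist x powi (1 - int j)) \<and>
     (nderiv Om 1 lam \<longlongrightarrow> 1) (at_right 0) \<and>
     (nderiv Om 1 lam \<longlongrightarrow> -1) (at_left 1)"

definition localization_pair ::
  "(real \<Rightarrow> real) \<Rightarrow> (real \<Rightarrow> real) \<Rightarrow> real \<Rightarrow> (nat \<Rightarrow> real) \<Rightarrow> bool" where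
  "localization_pair q lam Cq \<kappa> \<longleftrightarrow> localization_q q Cq \<and> localization_lam lam \<kappa>"

definition smooth_localization_pair ::
  "(real \<Rightarrow> real) \<Rightarrow> (real \<Rightarrow> real) \<Rightarrow> real \<Rightarrow> (nat \<Rightarrow> real) \<Rightarrow> bool" where
  "smooth_localization_pair q lam Cq \<kappa> \<longleftrightarrow>
     localization_pair q lam Cq \<kappa> \<and> Ck_on 3 Om lam \<and>
     (\<exists>\<kappa>3>0. \<forall>x\<in>Om. \<bar>nderiv Om 3 lam x\<bar> \<le> \<kappa>3 * bdist x powi (-2))"

definition delta0 :: "real \<Rightarrow> (nat \<Rightarrow> real) \<Rightarrow> real" where
  "delta0 Cq \<kappa> = inverse (3 * Max {1, \<kappa> 1, Cq * \<kappa> 0 powr log 2 Cq})"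

text \<open>The quotient tends to infinity as \<open>\<delta>\<close> increases to \<open>1 / \<kappa> 1\<close>, so positive roots exist; they
  are roots of a nonzero polynomial of degree at most two, so there is a least one. The pole
  \<open>\<delta> = 1 / \<kappa> 1\<close> is not a root, since there the quotient is \<open>0\<close> by convention.\<close>

definition delta0_bar :: "(nat \<Rightarrow> real) \<Rightarrow> real" where
  "delta0_bar \<kappa> = (LEAST \<delta>. 0 < \<delta> \<and> \<delta> * (1 + \<kappa> 1 * \<delta>) / (1 - \<kappa> 1 * \<delta>)\<^sup>2 = 1 / 3)"

definition delta_star :: "real \<Rightarrow> (nat \<Rightarrow> real) \<Rightarrow> real" where
  "delta_star Cq \<kappa> = min (delta0 Cq \<kappa>) (delta0_bar \<kappa>)"

section \<open>Lebesgue and Sobolev spaces on the unit interval\<close>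

text \<open>Elements of these spaces are represented by functions on the real line, of which only the
  almost-everywhere class on \<open>Om\<close> matters.\<close>

definition L2 :: "(real \<Rightarrow> real) set" where
  "L2 = {u \<in> borel_measurable leb. integrable leb (\<lambda>x. (u x)\<^sup>2)}"

definition L2_inner :: "(real \<Rightarrow> real) \<Rightarrow> (real \<Rightarrow> real) \<Rightarrow> real" where
  "L2_inner u v = (\<integral>x. u x * v x \<partial>leb)"

definition L2_norm :: "(real \<Rightarrow> real) \<Rightarrow> real" where
  "L2_norm u = sqrt (L2_inner u u)"

definition test_functions :: "(real \<Rightarrow> real) set" where
  "test_functions = {\<phi>. (\<forall>k. Ck_on k UNIV \<phi>) \<and> closure {x. \<phi> x \<noteq> 0} \<subseteq> Om}"

definition is_weak_deriv :: "nat \<Rightarrow> (real \<Rightarrow> real) \<Rightarrow> (real \<Rightarrow> real) \<Rightarrow> bool" where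
  "is_weak_deriv k u g \<longleftrightarrow>
     (\<forall>\<phi>\<in>test_functions. L2_inner u (nderiv UNIV k \<phi>) = (-1) ^ k * L2_inner g \<phi>)"

definition Hk :: "nat \<Rightarrow> (real \<Rightarrow> real) set" where
  "Hk k = {u \<in> L2. \<forall>j\<le>k. \<exists>g\<in>L2. is_weak_deriv j u g}"

text \<open>Weak derivatives are unique almost everywhere on \<open>Om\<close>, so the Sobolev norm does not depend on
  the choice made here.\<close>

definition weak_deriv :: "nat \<Rightarrow> (real \<Rightarrow> real) \<Rightarrow> real \<Rightarrow> real" where
  "weak_deriv k u = (SOME g. g \<in> L2 \<and> is_weak_deriv k u g)"

definition Hk_norm :: "nat \<Rightarrow> (real \<Rightarrow> real) \<Rightarrow> real" where
  "Hk_norm k u = sqrt (\<Sum>j\<le>k. (L2_norm (weak_deriv j u))\<^sup>2)"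

definition H10 :: "(real \<Rightarrow> real) set" where
  "H10 = {u \<in> Hk 1. \<forall>\<epsilon>>0. \<exists>\<phi>\<in>test_functions. Hk_norm 1 (\<lambda>x. u x - \<phi> x) < \<epsilon>}"

text \<open>The equation holds in the sense of distributions; the homogeneous boundary conditions are
  those encoded in \<open>H10\<close>.\<close>

definition local_solution :: "(real \<Rightarrow> real) \<Rightarrow> (real \<Rightarrow> real) \<Rightarrow> bool" where
  "local_solution f u \<longleftrightarrow> u \<in> H10 \<and> is_weak_deriv 2 u (\<lambda>x. - f x)"

section \<open>The nonlocal form and its discretization\<close>

definition eta_delta :: "(real \<Rightarrow> real) \<Rightarrow> (real \<Rightarrow> real) \<Rightarrow> real \<Rightarrow> real \<Rightarrow> real" where
  "eta_delta q lam \<delta> x = \<delta> * q (lam x)"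

definition C_beta :: "real \<Rightarrow> real" where
  "C_beta \<beta> = (3 - \<beta>) / 2"

definition w_delta :: "real \<Rightarrow> (real \<Rightarrow> real) \<Rightarrow> (real \<Rightarrow> real) \<Rightarrow> real \<Rightarrow> real \<Rightarrow> real" where
  "w_delta \<beta> q lam \<delta> x = C_beta \<beta> * eta_delta q lam \<delta> x powr (- (3 - \<beta>))"

text \<open>Bochner integrals of non-integrable functions are \<open>0\<close>. This convention plays no role when
  \<open>u\<close> and \<open>v\<close> are Lipschitz on \<open>Om\<close> up to null sets, in particular for finite element functions and
  elements of \<open>Hk 4\<close>: the integral over \<open>y\<close> is then absolutely convergent, and is bounded in \<open>x\<close>
  because the weight is a multiple of the power \<open>\<beta> - 3\<close> of the radius of the window.\<close>

definition B_delta :: "real \<Rightarrow> (real \<Rightarrow> real) \<Rightarrow> (real \<Rightarrow> real) \<Rightarrow> real \<Rightarrow>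
    (real \<Rightarrow> real) \<Rightarrow> (real \<Rightarrow> real) \<Rightarrow> real" where
  "B_delta \<beta> q lam \<delta> u v =
     (\<integral>x. (\<integral>y. w_delta \<beta> q lam \<delta> x * indicator {z. \<bar>z - x\<bar> < eta_delta q lam \<delta> x} y *
              ((u x - u y) * (v x - v y) / \<bar>x - y\<bar> powr \<beta>) \<partial>leb) \<partial>leb)"

definition W_norm :: "real \<Rightarrow> (real \<Rightarrow> real) \<Rightarrow> (real \<Rightarrow> real) \<Rightarrow> real \<Rightarrow> (real \<Rightarrow> real) \<Rightarrow> real" where
  "W_norm \<beta> q lam \<delta> u = sqrt ((L2_norm u)\<^sup>2 + B_delta \<beta> q lam \<delta> u u)"

text \<open>The finite element space for the mesh width \<open>h = 1 / N\<close>.\<close>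

definition V_h :: "nat \<Rightarrow> (real \<Rightarrow> real) set" where
  "V_h N = {v. continuous_on {0..1} v \<and>
     (\<forall>i\<in>{1..N}. \<exists>a b. \<forall>x\<in>{(real i - 1) / real N<..real i / real N}. v x = a + b * x) \<and>
     v 0 = 0 \<and> v 1 = 0}"

definition discrete_solution :: "real \<Rightarrow> (real \<Rightarrow> real) \<Rightarrow> (real \<Rightarrow> real) \<Rightarrow> real \<Rightarrow> nat \<Rightarrow>
    (real \<Rightarrow> real) \<Rightarrow> (real \<Rightarrow> real) \<Rightarrow> bool" where
  "discrete_solution \<beta> q lam \<delta> N f u \<longleftrightarrow>
     u \<in> V_h N \<and> (\<forall>v\<in>V_h N. B_delta \<beta> q lam \<delta> u v = L2_inner f v)"

end

theory Submission
  imports Defs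
begin

text \<open>Writing \<open>y = x + e x * t\<close>, where \<open>e\<close> is the window radius, turns the form into the inner product
  of the difference quotients \<open>(u (x + e x * t) - u x) / (e x * t)\<close> with respect to the product of Lebesgue
  measure and a fixed probability measure in \<open>t\<close>. Hence it is bounded by the square of the Lipschitz
  constant, which controls the interpolation error. Averaging \<open>v (x + e x * t)\<close> in \<open>t\<close> against a smooth
  kernel gives a function whose derivative is controlled by the form and which vanishes at the boundary
  together with \<open>v\<close>; this yields a Poincare inequality uniform in the horizon.

  For consistency, the Taylor expansion of the difference quotient of \<open>u\<close> to second order leaves a
  remainder of order \<open>e\<^sup>2\<close>, and symmetrizing in \<open>t\<close> turns the main part into second differences at
  \<open>0\<close> of integrals of the type \<open>\<integral>x. G x * v (x + \<tau> * e x)\<close>. Their second derivatives in \<open>\<tau>\<close> contain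
  \<open>v''\<close>, which is removed by two integrations by parts; the products of the derivatives of \<open>e\<close> that
  arise are all of order \<open>\<delta>\<^sup>2\<close>. So the consistency error involves \<open>v\<close> itself and not its derivative, and
  Bernstein polynomials, which keep Lipschitz constants and boundary values, reduce everything to smooth
  \<open>v\<close>. A Strang type argument then gives the error estimate.\<close>

section \<open>Integration on the unit interval\<close>

text \<open>The obstacle is the boundary. The third derivative of \<open>lam\<close> may grow like
  d^(-2), where d is the boundary distance, so three derivatives of the radius e = \<delta> q(lam)
  need not be bounded. What helps is q'(0) = 0 together with q'' \<le> 1: then q'(lam) \<le> lam
  \<le> \<kappa>0 d, hence e'' = O(\<delta>) and e''' = O(\<delta>/d), and because e = O(\<delta> d)
  the product e e''' is O(\<delta>^2). The integrations by parts are arranged so that e''' occurs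
  only in this product; e and e' vanish at both ends, which removes all boundary terms.

  A second limit is the regularity of the solution: u''' is only a primitive of a square integrable
  function, so the last integration by parts against it goes through Fubini instead of the product
  rule. Derivatives of the test function must disappear because the nonlocal energy offers no bound
  for them, whereas an L2 norm of the test function is absorbed by the Poincare inequality.

  Constants of the localization pair are collected in one number E, and D = \<delta> E bounds the
  radius and its derivatives. Surplus powers of D are traded for powers of E.\<close>

interpretation leb: finite_measure leb
  by (rule finite_measure_lebesgue_on) (simp add: bounded_set_imp_lmeasurable)

lemma space_leb [simp]: "space leb = Om"
  by simp

lemma measure_leb [simp]: "measure leb Om = 1"
  by (simp add: measure_restrict_space)

lemma integral_leb_const [simp]: "(\<integral>x. c \<partial>leb) = (c::real)"
  by (metis lebesgue_integral_const mult.left_neutral real_scaleR_def measure_leb space_leb)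

lemma borel_measurable_leb_continuous:
  assumes "continuous_on Om (f::real \<Rightarrow> real)"
  shows "f \<in> borel_measurable leb"
  using assms by (simp add: continuous_imp_measurable_on_sets_lebesgue)

lemma integrable_leb_bounded:
  assumes "(f::real \<Rightarrow> real) \<in> borel_measurable leb" "\<And>x. x \<in> Om \<Longrightarrow> \<bar>f x\<bar> \<le> B"
  shows "integrable leb f"
  using assms by (intro leb.integrable_const_bound[where B = B] AE_I2) auto

lemma integrable_leb_continuous:
  assumes "continuous_on Om (f::real \<Rightarrow> real)" "\<And>x. x \<in> Om \<Longrightarrow> \<bar>f x\<bar> \<le> B"
  shows "integrable leb f"
  using assms borel_measurable_leb_continuous integrable_leb_bounded by blast

lemma integrable_leb_continuous_Icc:
  assumes "continuous_on {0..1} (f::real \<Rightarrow> real)"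
  shows "integrable leb f"
proof -
  obtain B where "\<And>x. x \<in> {0..1} \<Longrightarrow> \<bar>f x\<bar> \<le> B"
    using compact_imp_bounded[OF compact_continuous_image[OF assms compact_Icc]]
    unfolding bounded_iff by force
  then show ?thesis
    by (intro integrable_leb_continuous[where B = B]) (auto intro: continuous_on_subset[OF assms])
qed

lemma integral_leb_eq_HK:
  assumes "integrable leb (f::real \<Rightarrow> real)"
  shows "(\<integral>x. f x \<partial>leb) = integral {0..1} f"
  using lebesgue_integral_eq_integral[OF assms] integral_open_interval_real[of 0 1 f] by simp

text \<open>The derivative is asked for only in the open interval, through the Henstock-Kurzweil
  form of the fundamental theorem. This later admits primitives whose derivative has no limit at 0
  or 1, as long as it is integrable.\<close>

lemma integral_leb_deriv:
  fixes F f :: "real \<Rightarrow> real"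
  assumes cont: "continuous_on {a..b} F"
    and der: "\<And>x. x \<in> {a<..<b} \<Longrightarrow> (F has_real_derivative f x) (at x)"
    and ab: "0 \<le> a" "a \<le> b" "b \<le> 1"
    and int: "integrable leb f"
  shows "(\<integral>x. indicator {a<..<b} x * f x \<partial>leb) = F b - F a"
proof -
  have "integrable lebesgue (\<lambda>x. indicator Om x *\<^sub>R f x)"
    using int by (simp add: integrable_restrict_space)
  then have "integrable lebesgue (\<lambda>x. indicator {a<..<b} x *\<^sub>R (indicator Om x *\<^sub>R f x))"
    by (rule integrable_mult_indicator[rotated]) simp
  moreover have "(\<lambda>x. indicator {a<..<b} x *\<^sub>R (indicator Om x *\<^sub>R f x)) = (\<lambda>x. indicator {a<..<b} x *\<^sub>R f x)"
    using ab by (auto simp: indicator_def)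
  ultimately have i: "integrable lebesgue (\<lambda>x. indicator {a<..<b} x *\<^sub>R f x)"
    by simp
  then have i2: "integrable (lebesgue_on {a<..<b}) f"
    by (simp add: integrable_restrict_space)
  have "(\<integral>x. indicator {a<..<b} x * f x \<partial>leb) = (\<integral>x. indicator Om x *\<^sub>R (indicator {a<..<b} x * f x) \<partial>lebesgue)"
    by (simp add: integral_restrict_space)
  also have "\<dots> = (\<integral>x. indicator {a<..<b} x *\<^sub>R f x \<partial>lebesgue)"
    using ab by (intro Bochner_Integration.integral_cong) (auto simp: indicator_def)
  also have "\<dots> = integral\<^sup>L (lebesgue_on {a<..<b}) f"
    by (simp add: integral_restrict_space)
  also have "\<dots> = integral {a<..<b} f"
    using i2 by (intro lebesgue_integral_eq_integral) auto
  also have "\<dots> = integral {a..b} f"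
    by (simp add: integral_open_interval_real)
  also have "\<dots> = F b - F a"
    by (intro integral_unique fundamental_theorem_of_calculus_interior cont ab)
       (use der in \<open>auto simp: has_real_derivative_iff_has_vector_derivative\<close>)
  finally show ?thesis .
qed

lemma integral_leb_deriv_Om:
  fixes F f :: "real \<Rightarrow> real"
  assumes "continuous_on {0..1} F"
    and "\<And>x. x \<in> Om \<Longrightarrow> (F has_real_derivative f x) (at x)"
    and "integrable leb f"
  shows "(\<integral>x. f x \<partial>leb) = F 1 - F 0"
proof -
  have "(\<integral>x. f x \<partial>leb) = (\<integral>x. indicator Om x * f x \<partial>leb)"
    by (intro Bochner_Integration.integral_cong) auto
  then show ?thesis using integral_leb_deriv[OF assms(1,2) _ _ _ assms(3)] by simp
qed

section \<open>Cauchy-Schwarz inequality over an arbitrary measure\<close>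

lemma integrable_mult_of_squares:
  fixes f g :: "'a \<Rightarrow> real"
  assumes m: "f \<in> borel_measurable M" "g \<in> borel_measurable M"
    and f2: "integrable M (\<lambda>x. (f x)\<^sup>2)" and g2: "integrable M (\<lambda>x. (g x)\<^sup>2)"
  shows "integrable M (\<lambda>x. f x * g x)"
proof (rule Bochner_Integration.integrable_bound)
  show "integrable M (\<lambda>x. (f x)\<^sup>2 + (g x)\<^sup>2)" using f2 g2 by simp
  show "(\<lambda>x. f x * g x) \<in> borel_measurable M" using m by simp
  show "AE x in M. norm (f x * g x) \<le> norm ((f x)\<^sup>2 + (g x)\<^sup>2)"
  proof (rule AE_I2)
    fix x
    have "0 \<le> (\<bar>f x\<bar> - \<bar>g x\<bar>)\<^sup>2" by simp
    then have "2 * (\<bar>f x\<bar> * \<bar>g x\<bar>) \<le> (f x)\<^sup>2 + (g x)\<^sup>2"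
      by (simp add: power2_diff)
    moreover have "0 \<le> \<bar>f x\<bar> * \<bar>g x\<bar>" by simp
    ultimately have "\<bar>f x\<bar> * \<bar>g x\<bar> \<le> (f x)\<^sup>2 + (g x)\<^sup>2" by linarith
    then show "norm (f x * g x) \<le> norm ((f x)\<^sup>2 + (g x)\<^sup>2)" by (simp add: abs_mult)
  qed
qed

lemma integral_Cauchy_Schwarz:
  fixes f g :: "'a \<Rightarrow> real"
  assumes m: "f \<in> borel_measurable M" "g \<in> borel_measurable M"
    and f2: "integrable M (\<lambda>x. (f x)\<^sup>2)" and g2: "integrable M (\<lambda>x. (g x)\<^sup>2)"
  shows "(\<integral>x. f x * g x \<partial>M)\<^sup>2 \<le> (\<integral>x. (f x)\<^sup>2 \<partial>M) * (\<integral>x. (g x)\<^sup>2 \<partial>M)"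
proof -
  let ?A = "\<integral>x. (f x)\<^sup>2 \<partial>M" and ?B = "\<integral>x. (g x)\<^sup>2 \<partial>M" and ?P = "\<integral>x. f x * g x \<partial>M"
  have fg: "integrable M (\<lambda>x. f x * g x)" by (rule integrable_mult_of_squares[OF assms])
  have A0: "0 \<le> ?A" "0 \<le> ?B" by simp_all
  have q: "0 \<le> s\<^sup>2 * ?A - 2 * s * r * ?P + r\<^sup>2 * ?B" for s r
  proof -
    have "0 \<le> (\<integral>x. (s * f x - r * g x)\<^sup>2 \<partial>M)" by simp
    also have "\<dots> = (\<integral>x. s\<^sup>2 * (f x)\<^sup>2 - 2 * s * r * (f x * g x) + r\<^sup>2 * (g x)\<^sup>2 \<partial>M)"
      by (intro Bochner_Integration.integral_cong) (auto simp: power2_diff power_mult_distrib algebra_simps)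
    also have "\<dots> = s\<^sup>2 * ?A - 2 * s * r * ?P + r\<^sup>2 * ?B"
      using f2 g2 fg by simp
    finally show ?thesis .
  qed
  show ?thesis
  proof (cases "?B = 0")
    case True
    have "?P = 0"
    proof (rule ccontr)
      assume "?P \<noteq> 0"
      \<comment> \<open>With \<open>?B = 0\<close> the quadratic form is affine in r, and this r
        gives it the value -1.\<close>
      then show False using q[of 1 "(?A + 1) / (2 * ?P)"] True by (simp add: field_simps)
    qed
    then show ?thesis using True by simp
  next
    case False
    then have B: "?B > 0" using A0 by (simp only: order_less_le) simp
    \<comment> \<open>The pair s = \<open>?B\<close>, r = \<open>?P\<close> is proportional to a
      minimizer of the quadratic form.\<close>
    have "0 \<le> ?B * (?A * ?B - ?P\<^sup>2)"
      using q[of "?B" "?P"] by (simp add: power2_eq_square algebra_simps)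
    then show ?thesis using B by (simp add: zero_le_mult_iff)
  qed
qed

lemma abs_integral_Cauchy_Schwarz:
  fixes f g :: "'a \<Rightarrow> real"
  assumes "f \<in> borel_measurable M" "g \<in> borel_measurable M"
    and "integrable M (\<lambda>x. (f x)\<^sup>2)" and "integrable M (\<lambda>x. (g x)\<^sup>2)"
  shows "\<bar>\<integral>x. f x * g x \<partial>M\<bar> \<le> sqrt (\<integral>x. (f x)\<^sup>2 \<partial>M) * sqrt (\<integral>x. (g x)\<^sup>2 \<partial>M)"
  using integral_Cauchy_Schwarz[OF assms] by (metis real_sqrt_abs real_sqrt_le_iff real_sqrt_mult)

section \<open>Test functions and the fundamental lemma\<close>

text \<open>The smooth germ exp(-1/x) with a polynomial factor in 1/x. The factor is there to make
  the family closed under differentiation; the polynomial 1 gives the standard germ.\<close>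

definition flat :: "real poly \<Rightarrow> real \<Rightarrow> real" where
  "flat p x = (if 0 < x then poly p (1 / x) * exp (- (1 / x)) else 0)"

lemma poly_times_exp_neg_tendsto_0:
  fixes p :: "real poly"
  shows "((\<lambda>x. poly p x * exp (- x)) \<longlongrightarrow> 0) at_top"
proof -
  have "((\<lambda>x. \<Sum>i\<le>degree p. coeff p i * (x ^ i / exp x)) \<longlongrightarrow> (\<Sum>i\<le>degree p. coeff p i * 0)) at_top"
    by (intro tendsto_intros tendsto_power_div_exp_0)
  moreover have "(\<lambda>x. \<Sum>i\<le>degree p. coeff p i * (x ^ i / exp x)) = (\<lambda>x. poly p x * exp (- x))"
    by (auto simp: poly_altdef sum_distrib_right exp_minus divide_inverse mult.assoc intro!: sum.cong)
  ultimately show ?thesis by simp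
qed

text \<open>For x > 0 put s = 1/x, so that ds/dx = -s^2 and p(s) exp(-s) has derivative s^2 (p -
  p')(s) exp(-s). At 0 the exponential beats every polynomial in s.\<close>

lemma DERIV_flat: "(flat p has_real_derivative flat (monom 1 2 * (p - pderiv p)) x) (at x)"
proof -
  consider "0 < x" | "x < 0" | "x = 0" by linarith
  then show ?thesis
  proof cases
    case 1
    have "((\<lambda>x. poly p (1 / x) * exp (- (1 / x))) has_real_derivative flat (monom 1 2 * (p - pderiv p)) x) (at x)"
      using 1 by (auto intro!: derivative_eq_intros simp: flat_def poly_monom power2_eq_square field_simps)
    moreover have ev: "\<forall>\<^sub>F y in nhds x. flat p y = poly p (1 / y) * exp (- (1 / y))"
      using 1 eventually_nhds_in_open[of "{0<..}" x] by (auto elim!: eventually_mono simp: flat_def)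
    ultimately show ?thesis using DERIV_cong_ev[OF refl ev refl] by simp
  next
    case 2
    have "((\<lambda>x. 0) has_real_derivative flat (monom 1 2 * (p - pderiv p)) x) (at x)"
      using 2 by (auto simp: flat_def)
    moreover have ev: "\<forall>\<^sub>F y in nhds x. flat p y = 0"
      using 2 eventually_nhds_in_open[of "{..<0}" x] by (auto elim!: eventually_mono simp: flat_def)
    ultimately show ?thesis using DERIV_cong_ev[OF refl ev refl] by simp
  next
    case 3
    have l: "((\<lambda>h. flat p h / h) \<longlongrightarrow> 0) (at_left 0)"
      by (rule tendsto_eventually) (auto simp: flat_def eventually_at_filter)
    \<comment> \<open>With h = 1/s the right difference quotient reads s p(s) exp(-s), and
      \<open>pCons 0 p\<close> is the polynomial s p(s).\<close>
    have "((\<lambda>h. poly (pCons 0 p) h * exp (- h)) \<longlongrightarrow> 0) at_top"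
      by (rule poly_times_exp_neg_tendsto_0)
    then have "((\<lambda>h. flat p (inverse h) / inverse h) \<longlongrightarrow> 0) at_top"
      by (rule Lim_transform_eventually)
         (auto intro!: eventually_mono[OF eventually_gt_at_top[of 0]] simp: flat_def field_simps)
    then have r: "((\<lambda>h. flat p h / h) \<longlongrightarrow> 0) (at_right 0)"
      by (simp add: filterlim_at_right_to_top)
    show ?thesis
      using filterlim_split_at[OF l r] 3 by (simp add: DERIV_def flat_def)
  qed
qed

text \<open>A concrete stock of compactly supported smooth functions. Sums and multiples are
  included because the product rule leaves the generators; with them the set is closed under
  differentiation, which yields smoothness of every order at once. A generator with
  \<open>b \<le> a\<close> is zero.\<close>

inductive_set bumps :: "(real \<Rightarrow> real) set" where
  base: "0 < a \<Longrightarrow> b < 1 \<Longrightarrow> 0 < n \<Longrightarrow> (\<lambda>x. flat p (n * (x - a)) * flat r (n * (b - x))) \<in> bumps"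
| add: "f \<in> bumps \<Longrightarrow> g \<in> bumps \<Longrightarrow> (\<lambda>x. f x + g x) \<in> bumps"
| scale: "f \<in> bumps \<Longrightarrow> (\<lambda>x. c * f x) \<in> bumps"

lemma bumps_support:
  assumes "f \<in> bumps"
  shows "\<exists>a b. 0 < a \<and> a < b \<and> b < 1 \<and> (\<forall>x. f x \<noteq> 0 \<longrightarrow> a \<le> x \<and> x \<le> b)"
  using assms
proof induction
  case (base a b n p r)
  show ?case
  proof (intro exI conjI allI impI)
    \<comment> \<open>The values 1/3 and 2/3 keep the enclosing interval nondegenerate when the
      generator is zero.\<close>
    show "0 < min a (1/3)" "min a (1/3) < max b (2/3)" "max b (2/3) < 1" using base by auto
    fix x assume "flat p (n * (x - a)) * flat r (n * (b - x)) \<noteq> 0"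
    then have "0 < n * (x - a)" "0 < n * (b - x)" by (auto simp: flat_def split: if_splits)
    then show "min a (1/3) \<le> x" "x \<le> max b (2/3)" using base by (auto simp: zero_less_mult_iff)
  qed
next
  case (add f g)
  then obtain a b a' b' where "0 < a" "a < b" "b < 1" "\<forall>x. f x \<noteq> 0 \<longrightarrow> a \<le> x \<and> x \<le> b"
    "0 < a'" "a' < b'" "b' < 1" "\<forall>x. g x \<noteq> 0 \<longrightarrow> a' \<le> x \<and> x \<le> b'" by blast
  then show ?case
    by (intro exI[of _ "min a a'"] exI[of _ "max b b'"] conjI allI impI)
       (simp_all add: min_def max_def, (smt (verit))+)
next
  case (scale f c)
  then show ?case by auto
qed

lemma bumps_deriv:
  assumes "f \<in> bumps"
  shows "\<exists>f'\<in>bumps. \<forall>x. (f has_real_derivative f' x) (at x)"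
  using assms
proof induction
  case (base a b n p r)
  let ?d = "\<lambda>p. monom 1 2 * (p - pderiv p)"
  let ?f' = "\<lambda>x. n * (flat (?d p) (n * (x - a)) * flat r (n * (b - x))) +
                (- n) * (flat p (n * (x - a)) * flat (?d r) (n * (b - x)))"
  have "?f' \<in> bumps" using base by (intro bumps.intros)
  moreover have "((\<lambda>x. flat p (n * (x - a)) * flat r (n * (b - x))) has_real_derivative ?f' x) (at x)" for x
    by (rule derivative_eq_intros DERIV_chain'[OF _ DERIV_flat] | simp add: algebra_simps)+
  ultimately show ?case by (intro bexI[where x = ?f'] allI)
next
  case (add f g)
  then obtain f' g' where "f' \<in> bumps" "g' \<in> bumps"
    "\<And>x. (f has_real_derivative f' x) (at x)" "\<And>x. (g has_real_derivative g' x) (at x)" by blast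
  then show ?case by (intro bexI[of _ "\<lambda>x. f' x + g' x"]) (auto intro: bumps.add DERIV_add)
next
  case (scale f c)
  then obtain f' where "f' \<in> bumps" "\<And>x. (f has_real_derivative f' x) (at x)" by blast
  then show ?case by (intro bexI[of _ "\<lambda>x. c * f' x"]) (auto intro: bumps.scale DERIV_cmult)
qed

section \<open>Iterated derivatives and compactly supported antiderivatives\<close>

lemma nderiv_Suc_eq:
  assumes "\<And>x. (nderiv UNIV k f has_real_derivative g x) (at x)"
  shows "nderiv UNIV (Suc k) f = g"
  using assms by (auto simp: has_real_derivative_iff_has_vector_derivative intro!: vector_derivative_at)

text \<open>Derivatives never leave \<open>C\<close>, so each of them is differentiable again. It is
  applied to \<open>bumps\<close> and to \<open>bumps\<close> enlarged by one
  antiderivative.\<close>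

lemma Ck_on_derivation_closed:
  assumes step: "\<And>g. g \<in> C \<Longrightarrow> \<exists>g'\<in>C. \<forall>x. (g has_real_derivative g' x) (at x)" and f: "f \<in> C"
  shows "nderiv UNIV k f \<in> C" and "Ck_on k UNIV f"
proof -
  have in_C: "nderiv UNIV k f \<in> C" for k
  proof (induction k)
    case (Suc k)
    then obtain g where "g \<in> C" "\<And>x. (nderiv UNIV k f has_real_derivative g x) (at x)" using step by blast
    then show ?case using nderiv_Suc_eq by metis
  qed (simp add: f)
  show "nderiv UNIV k f \<in> C" by (rule in_C)
  have der: "(nderiv UNIV k f has_real_derivative nderiv UNIV (Suc k) f x) (at x)" for k x
    using step[OF in_C[of k]] nderiv_Suc_eq by metis
  then show "Ck_on k UNIV f"
    unfolding Ck_on_def by (auto intro!: DERIV_isCont continuous_at_imp_continuous_on simp del: nderiv.simps)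
qed

lemma test_functionI:
  assumes "\<And>k. Ck_on k UNIV f" "0 < a" "b < 1" "\<And>x. f x \<noteq> 0 \<Longrightarrow> a \<le> x \<and> x \<le> b"
  shows "f \<in> test_functions"
proof -
  have "closure {x. f x \<noteq> 0} \<subseteq> {a..b}"
    by (rule closure_minimal) (use assms in auto)
  also have "\<dots> \<subseteq> Om" using assms by auto
  finally show ?thesis using assms by (simp add: test_functions_def)
qed

lemma bumps_test: "f \<in> bumps \<Longrightarrow> f \<in> test_functions"
  using bumps_support[of f] test_functionI Ck_on_derivation_closed(2)[OF bumps_deriv] by metis

lemma bumps_continuous: "f \<in> bumps \<Longrightarrow> continuous_on A f"
  using bumps_deriv by (metis DERIV_isCont continuous_at_imp_continuous_on)

lemma bumps_integrable: "f \<in> bumps \<Longrightarrow> integrable leb f"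
  by (intro integrable_leb_continuous_Icc bumps_continuous)

text \<open>The antiderivative that vanishes at 0 is constant on each side of the support; on the
  right the constant is the total integral, which is zero. So it is a test function, although it
  need not lie in \<open>bumps\<close>.\<close>

lemma bump_antiderivative:
  assumes f: "f \<in> bumps" and f0: "(\<integral>x. f x \<partial>leb) = 0"
  obtains \<phi> where "\<phi> \<in> test_functions" "\<And>x. (\<phi> has_real_derivative f x) (at x)"
proof -
  have "isCont f x" for x using bumps_deriv[OF f] DERIV_isCont by blast
  then obtain F0 where F0: "\<And>x. (F0 has_vector_derivative f x) (at x)"
    using einterval_antiderivative[of "-\<infinity>" "\<infinity>" f] by auto
  define F where "F x = F0 x - F0 0" for x
  have F: "(F has_real_derivative f x) (at x)" for x
    unfolding F_def using F0[of x]
    by (auto intro!: derivative_eq_intros simp: has_real_derivative_iff_has_vector_derivative)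
  then have cont: "continuous_on A F" for A
    by (meson DERIV_isCont continuous_at_imp_continuous_on)
  obtain a b where ab: "0 < a" "a < b" "b < 1" "\<And>x. f x \<noteq> 0 \<Longrightarrow> a \<le> x \<and> x \<le> b"
    using bumps_support[OF f] by blast
  have F00: "F 0 = 0" by (simp add: F_def)
  have F1: "F 1 = 0"
    using integral_leb_deriv_Om[OF cont F bumps_integrable[OF f]] f0 F00 by simp
  have left: "F x = 0" if "x < a" for x
  proof -
    have "F x = F 0"
    proof (rule has_field_derivative_zero_constant[of "{..<a}" F, THEN exE])
      show "convex {..<a}" by simp
    next
      fix y assume "y \<in> {..<a}"
      then have "f y = 0" using ab(4)[of y] by force
      then show "(F has_field_derivative 0) (at y within {..<a})"
        using F[of y] by (simp add: has_field_derivative_at_within)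
    next
      fix c assume "\<forall>y\<in>{..<a}. F y = c"
      then show "F x = F 0" using that ab by auto
    qed
    then show ?thesis using F00 by simp
  qed
  have right: "F x = 0" if "b < x" for x
  proof -
    have "F x = F 1"
    proof (rule has_field_derivative_zero_constant[of "{b<..}" F, THEN exE])
      show "convex {b<..}" by simp
    next
      fix y assume "y \<in> {b<..}"
      then have "f y = 0" using ab(4)[of y] by force
      then show "(F has_field_derivative 0) (at y within {b<..})"
        using F[of y] by (simp add: has_field_derivative_at_within)
    next
      fix c assume "\<forall>y\<in>{b<..}. F y = c"
      then show "F x = F 1" using that ab by auto
    qed
    then show ?thesis using F1 by simp
  qed
  have "F \<in> test_functions"
  proof (rule test_functionI[of F a b])
    show "Ck_on k UNIV F" for k
      by (rule Ck_on_derivation_closed(2)[of "insert F bumps"]) (use F f bumps_deriv in \<open>auto 0 4\<close>)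
    show "F x \<noteq> 0 \<Longrightarrow> a \<le> x \<and> x \<le> b" for x using left right by (meson not_le)
  qed (use ab in auto)
  with F show ?thesis using that by blast
qed

text \<open>Since exp(-1/y) tends to 1 as y grows, stretching the arguments by n + 1 turns the germs
  into steps. The edges \<open>a' n\<close> and \<open>b' n\<close> tend to 0 and
  \<open>min b 1\<close> and keep the supports compact in \<open>Om\<close>. For
  \<open>x = b\<close> the right factor is 0, in accordance with the strict half-line.\<close>

lemma bumps_approx_lessThan:
  obtains \<psi> :: "nat \<Rightarrow> real \<Rightarrow> real" where "\<And>n. \<psi> n \<in> bumps" "\<And>n x. \<bar>\<psi> n x\<bar> \<le> 1"
    "\<And>x. x \<in> Om \<Longrightarrow> (\<lambda>n. \<psi> n x) \<longlonglongrightarrow> indicator {..<b} x"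
proof -
  define a' where "a' n = 1 / (real n + 3)" for n
  define b' where "b' n = min b (1 - 1 / (real n + 3))" for n
  define \<psi> where "\<psi> n x = flat 1 ((real n + 1) * (x - a' n)) * flat 1 ((real n + 1) * (b' n - x))" for n x
  have "\<psi> n \<in> bumps" for n
    unfolding \<psi>_def by (rule bumps.base) (auto simp: a'_def b'_def min_less_iff_disj)
  moreover have fb: "0 \<le> flat 1 y \<and> flat 1 y \<le> 1" for y
    by (auto simp: flat_def)
  then have "\<bar>\<psi> n x\<bar> \<le> 1" for n x
    unfolding \<psi>_def by (simp add: abs_mult mult_le_one)
  moreover have "(\<lambda>n. \<psi> n x) \<longlonglongrightarrow> indicator {..<b} x" if x: "x \<in> Om" for x
  proof (cases "x < b")
    case False
    then have "\<psi> n x = 0" for n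
      by (auto simp: \<psi>_def b'_def flat_def zero_less_mult_iff)
    then show ?thesis using False by simp
  next
    case True
    have "(\<lambda>n. 1 / real (n + 3)) \<longlonglongrightarrow> 0"
      by (rule LIMSEQ_ignore_initial_segment[OF lim_1_over_n])
    then have a0: "a' \<longlonglongrightarrow> 0" unfolding a'_def by simp
    have "(\<lambda>n. 1 - a' n) \<longlonglongrightarrow> 1 - 0" by (intro tendsto_intros a0)
    then have "(\<lambda>n. 1 - 1 / (real n + 3)) \<longlonglongrightarrow> 1" by (simp add: a'_def)
    then have b0: "b' \<longlonglongrightarrow> min b 1" unfolding b'_def by (intro tendsto_min tendsto_const)
    have key: "(\<lambda>n. flat 1 ((real n + 1) * y n)) \<longlonglongrightarrow> 1" if y: "y \<longlonglongrightarrow> l" "0 < l" for y l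
    proof -
      have "filterlim (\<lambda>n. y n * (real n + 1)) at_top sequentially"
        by (intro filterlim_tendsto_pos_mult_at_top[OF y] filterlim_at_top_mono[OF filterlim_real_sequentially]) simp
      then have t: "filterlim (\<lambda>n. (real n + 1) * y n) at_top sequentially" by (simp add: mult.commute)
      have "(\<lambda>n. 1 / ((real n + 1) * y n)) \<longlonglongrightarrow> 0"
        using tendsto_divide_0[OF tendsto_const filterlim_at_top_imp_at_infinity[OF t]] by blast
      then have "(\<lambda>n. exp (- (1 / ((real n + 1) * y n)))) \<longlonglongrightarrow> exp (- 0)"
        by (intro tendsto_intros)
      then have "(\<lambda>n. exp (- (1 / ((real n + 1) * y n)))) \<longlonglongrightarrow> 1" by simp
      then show ?thesis
        by (rule Lim_transform_eventually)
           (use filterlim_at_top_dense[THEN iffD1, OF t, rule_format, of 0] in \<open>auto elim!: eventually_mono simp: flat_def\<close>)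
    qed
    have "(\<lambda>n. \<psi> n x) \<longlonglongrightarrow> 1 * 1" unfolding \<psi>_def
      by (intro tendsto_mult key[where l = "x - 0"] key[where l = "min b 1 - x"] tendsto_intros a0 b0)
         (use x True in auto)
    then show ?thesis using True by simp
  qed
  ultimately show ?thesis using that by blast
qed

lemma integral_lessThan_eq_0:
  assumes w: "integrable leb w" and orth: "\<And>\<psi>. \<psi> \<in> bumps \<Longrightarrow> (\<integral>x. w x * \<psi> x \<partial>leb) = 0"
  shows "(\<integral>x. indicator {..<b::real} x * w x \<partial>leb) = (0::real)"
proof -
  obtain \<psi> where \<psi>: "\<And>n. \<psi> n \<in> bumps" "\<And>n x. \<bar>\<psi> n x\<bar> \<le> 1"
    "\<And>x. x \<in> Om \<Longrightarrow> (\<lambda>n. \<psi> n x) \<longlonglongrightarrow> indicator {..<b} x" using bumps_approx_lessThan[of b] by metis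
  have [measurable]: "w \<in> borel_measurable leb" "\<psi> n \<in> borel_measurable leb" for n
    using w bumps_integrable[OF \<psi>(1)] by auto
  have "(\<lambda>n. \<integral>x. w x * \<psi> n x \<partial>leb) \<longlonglongrightarrow> (\<integral>x. w x * indicator {..<b} x \<partial>leb)"
  proof (rule integral_dominated_convergence)
    show "integrable leb (\<lambda>x. \<bar>w x\<bar>)" using w by simp
    show "(\<lambda>x. w x * indicator {..<b} x) \<in> borel_measurable leb"
      by (intro borel_measurable_times borel_measurable_indicator') 
         (auto simp: sets_restrict_space image_iff intro!: bexI[of _ "{..<b}"])
    show "AE x in leb. (\<lambda>i. w x * \<psi> i x) \<longlonglongrightarrow> w x * indicator {..<b} x"
      by (rule AE_I2) (auto intro!: tendsto_intros \<psi>)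
    show "AE x in leb. norm (w x * \<psi> i x) \<le> \<bar>w x\<bar>" for i
      by (rule AE_I2) (simp add: abs_mult mult_left_le \<psi>)
  qed measurable
  then have "(\<lambda>n. 0) \<longlonglongrightarrow> (\<integral>x. w x * indicator {..<b} x \<partial>leb)" using orth[OF \<psi>(1)] by simp
  then show ?thesis by (simp add: LIMSEQ_const_iff mult.commute)
qed

text \<open>Fundamental lemma of the calculus of variations. Integrals of \<open>w\<close> over
  half-lines vanish, and half-lines are an intersection-stable generator of the Borel sets; hence
  integrals over all Borel sets vanish, in particular over the sets where \<open>w\<close> is
  positive or negative.\<close>

lemma AE_eq_0_if_orthogonal_bumps:
  assumes w: "integrable leb w" and orth: "\<And>\<psi>. \<psi> \<in> bumps \<Longrightarrow> (\<integral>x. w x * \<psi> x \<partial>leb) = 0"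
  shows "AE x in leb. w x = (0::real)"
proof -
  have bm: "A \<inter> Om \<in> sets leb" if "A \<in> sets borel" for A :: "real set"
    using that by (auto simp: sets_restrict_space image_iff intro!: bexI[of _ A])
  have int: "integrable leb (\<lambda>x. indicator A x * w x)" if A: "A \<in> sets borel" for A :: "real set"
  proof -
    have "integrable leb (\<lambda>x. indicator (A \<inter> Om) x *\<^sub>R w x)"
      by (rule integrable_mult_indicator[OF bm[OF A] w])
    then show ?thesis by (rule Bochner_Integration.integrable_cong[THEN iffD1, rotated 2]) (auto simp: indicator_def)
  qed
  have tot: "(\<integral>x. w x \<partial>leb) = 0"
  proof -
    have "(\<integral>x. w x \<partial>leb) = (\<integral>x. indicator {..<1} x * w x \<partial>leb)"
      by (intro Bochner_Integration.integral_cong) (auto simp: indicator_def)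
    then show ?thesis using integral_lessThan_eq_0[OF assms] by simp
  qed
  have borel_gen: "sets borel = sigma_sets UNIV (range (lessThan :: real \<Rightarrow> real set))"
    by (subst borel_Iio) simp
  have all: "(\<integral>x. indicator A x * w x \<partial>leb) = 0" if "A \<in> sets borel" for A :: "real set"
  proof -
    have "Int_stable (range (lessThan :: real \<Rightarrow> real set))"
      unfolding Int_stable_def
    proof safe
      fix a b :: real
      have "{..<a} \<inter> {..<b} = {..<min a b}" by auto
      then show "{..<a} \<inter> {..<b} \<in> range lessThan" by blast
    qed
    moreover have "range lessThan \<subseteq> Pow (UNIV :: real set)" by simp
    moreover have "A \<in> sigma_sets UNIV (range lessThan)" using that borel_gen by simp
    ultimately show ?thesis
    proof (induction rule: sigma_sets_induct_disjoint)
      case (basic A)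
      then show ?case using integral_lessThan_eq_0[OF assms] by auto
    next
      case empty
      then show ?case by simp
    next
      case (compl A)
      then have A: "A \<in> sets borel" using borel_gen by simp
      have "(\<integral>x. indicator (UNIV - A) x * w x \<partial>leb) = (\<integral>x. w x - indicator A x * w x \<partial>leb)"
        by (intro Bochner_Integration.integral_cong) (auto simp: indicator_def)
      also have "\<dots> = 0" using w int[OF A] compl tot by simp
      finally show ?case .
    next
      case (union A)
      then have A: "A i \<in> sets borel" for i using borel_gen by auto
      have "(\<integral>x. indicator (\<Union>i. A i) x * w x \<partial>leb) = (LINT x:(\<Union>i. A i \<inter> Om)|leb. w x)"
        unfolding set_lebesgue_integral_def
        by (intro Bochner_Integration.integral_cong) (auto simp: indicator_def)
      also have "\<dots> = (\<Sum>i. LINT x:(A i \<inter> Om)|leb. w x)"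
      proof (rule lebesgue_integral_countable_add)
        show "A i \<inter> Om \<in> sets leb" for i using bm A by blast
        then have "(\<Union>i. A i \<inter> Om) \<in> sets leb" by blast
        then show "set_integrable leb (\<Union>i. A i \<inter> Om) w"
          unfolding set_integrable_def using w by (rule integrable_mult_indicator)
        show "i \<noteq> j \<Longrightarrow> (A i \<inter> Om) \<inter> (A j \<inter> Om) = {}" for i j
          using union(1) by (auto simp: disjoint_family_on_def)
      qed
      also have "(\<lambda>i. LINT x:(A i \<inter> Om)|leb. w x) = (\<lambda>i. \<integral>x. indicator (A i) x * w x \<partial>leb)"
        unfolding set_lebesgue_integral_def
        by (intro ext Bochner_Integration.integral_cong) (auto simp: indicator_def)
      also have "(\<Sum>i. \<integral>x. indicator (A i) x * w x \<partial>leb) = 0" using union by simp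
      finally show ?case .
    qed
  qed
  \<comment> \<open>The set where \<open>w\<close> is positive is only Lebesgue measurable, while
    the induction covers Borel sets; a Borel version \<open>w'\<close> supplies the set.\<close>
  have "integrable lebesgue (\<lambda>x. indicator Om x * w x)"
    using w by (simp add: integrable_restrict_space)
  then have "(\<lambda>x. indicator Om x * w x) \<in> borel_measurable (completion lborel)" by simp
  from completion_ex_borel_measurable_real[OF this]
  obtain w' where w'[measurable]: "w' \<in> borel_measurable lborel" and eq: "AE x in lborel. indicator Om x * w x = w' x"
    by blast
  have "AE x in lebesgue. indicator Om x * w x = w' x"
    using eq by (rule AE_completion)
  then have ae: "AE x in leb. w x = w' x"
    by (auto simp: AE_restrict_space_iff indicator_def elim!: eventually_mono)
  have half: "AE x in leb. \<not> 0 < c * w x" for c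
  proof -
    let ?S = "{x. 0 < c * w' x}"
    have S: "?S \<in> sets borel" by measurable
    have "(\<integral>x. indicator ?S x * (c * w x) \<partial>leb) = c * (\<integral>x. indicator ?S x * w x \<partial>leb)"
      by (simp add: mult.left_commute)
    then have "(\<integral>x. indicator ?S x * (c * w x) \<partial>leb) = 0" using all[OF S] by simp
    moreover have "integrable leb (\<lambda>x. indicator ?S x * (c * w x))"
      using int[OF S] by (simp add: mult.left_commute)
    moreover have "AE x in leb. 0 \<le> indicator ?S x * (c * w x)"
      using ae by eventually_elim (auto simp: indicator_def)
    ultimately have "AE x in leb. indicator ?S x * (c * w x) = 0"
      using integral_nonneg_eq_0_iff_AE by blast
    then show ?thesis using ae by eventually_elim (auto simp: indicator_def)
  qed
  show ?thesis using half[of 1] half[of "-1"] by eventually_elim auto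
qed

text \<open>Lemma of du Bois-Reymond. A bump minus a suitable multiple of a fixed bump with nonzero
  integral has integral zero, hence is the derivative of a test function. So \<open>w\<close> minus
  a constant is orthogonal to all bumps.\<close>

lemma AE_const_if_orthogonal_derivatives:
  assumes w: "integrable leb w"
    and orth: "\<And>\<phi> \<psi>. \<phi> \<in> test_functions \<Longrightarrow> \<psi> \<in> bumps \<Longrightarrow> (\<And>x. (\<phi> has_real_derivative \<psi> x) (at x)) \<Longrightarrow>
      (\<integral>x. w x * \<psi> x \<partial>leb) = 0"
  shows "\<exists>c::real. AE x in leb. w x = c"
proof -
  have wint: "integrable leb (\<lambda>x. w x * \<psi> x)" if "\<psi> \<in> bumps" for \<psi>
  proof -
    have "bounded (\<psi> ` {0..1})"
      by (intro compact_imp_bounded compact_continuous_image bumps_continuous that compact_Icc)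
    then obtain B where B: "\<And>x. x \<in> {0..1} \<Longrightarrow> \<bar>\<psi> x\<bar> \<le> B"
      unfolding bounded_iff by force
    show ?thesis
    proof (rule Bochner_Integration.integrable_bound)
      show "integrable leb (\<lambda>x. \<bar>w x\<bar> * B)" using w by simp
      show "(\<lambda>x. w x * \<psi> x) \<in> borel_measurable leb" using w bumps_integrable[OF that] by simp
      show "AE x in leb. norm (w x * \<psi> x) \<le> norm (\<bar>w x\<bar> * B)"
        using B by (intro AE_I2) (auto simp: abs_mult intro!: mult_left_mono order_trans[OF B abs_ge_self])
    qed
  qed
  \<comment> \<open>If all bumps had integral zero, the fundamental lemma would make the constant 1
    vanish almost everywhere.\<close>
  have "\<exists>\<theta>\<in>bumps. (\<integral>x. \<theta> x \<partial>leb) \<noteq> 0"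
  proof (rule ccontr)
    assume "\<not> ?thesis"
    then have "AE x in leb. (1::real) = 0"
      by (intro AE_eq_0_if_orthogonal_bumps) auto
    then have "emeasure leb (space leb) = 0" by (simp add: AE_iff_measurable[OF _ refl] ae_filter_eq_bot_iff trivial_limit_def[symmetric])
    then show False by (simp add: emeasure_restrict_space)
  qed
  then obtain \<theta> where \<theta>: "\<theta> \<in> bumps" "(\<integral>x. \<theta> x \<partial>leb) \<noteq> 0" by blast
  let ?I = "\<integral>x. \<theta> x \<partial>leb"
  define c where "c = (\<integral>x. w x * \<theta> x \<partial>leb) / ?I"
  have "AE x in leb. w x - c = 0"
  proof (rule AE_eq_0_if_orthogonal_bumps)
    show "integrable leb (\<lambda>x. w x - c)" using w by simp
    fix \<psi> assume \<psi>: "\<psi> \<in> bumps"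
    let ?J = "\<integral>x. \<psi> x \<partial>leb"
    define \<zeta> where "\<zeta> x = \<psi> x + (- (?J / ?I)) * \<theta> x" for x
    have \<zeta>: "\<zeta> \<in> bumps" unfolding \<zeta>_def by (intro bumps.intros \<psi> \<theta>)
    have "(\<integral>x. \<zeta> x \<partial>leb) = ?J + (- (?J / ?I)) * ?I" unfolding \<zeta>_def
      using bumps_integrable[OF \<psi>] bumps_integrable[OF \<theta>(1)] by simp
    then have "(\<integral>x. \<zeta> x \<partial>leb) = 0" using \<theta>(2) by simp
    then have "(\<integral>x. w x * \<zeta> x \<partial>leb) = 0"
      using bump_antiderivative[OF \<zeta>] orth \<zeta> by metis
    moreover have "(\<integral>x. w x * \<zeta> x \<partial>leb) = (\<integral>x. w x * \<psi> x + (- (?J / ?I)) * (w x * \<theta> x) \<partial>leb)"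
      unfolding \<zeta>_def by (intro Bochner_Integration.integral_cong) (auto simp: algebra_simps)
    ultimately have "(\<integral>x. w x * \<psi> x \<partial>leb) = ?J / ?I * (\<integral>x. w x * \<theta> x \<partial>leb)"
      using wint[OF \<psi>] wint[OF \<theta>(1)] by simp
    then have *: "(\<integral>x. w x * \<psi> x \<partial>leb) = c * ?J" by (simp add: c_def)
    have "(\<integral>x. (w x - c) * \<psi> x \<partial>leb) = (\<integral>x. w x * \<psi> x - c * \<psi> x \<partial>leb)"
      by (simp add: left_diff_distrib)
    then show "(\<integral>x. (w x - c) * \<psi> x \<partial>leb) = 0"
      using * wint[OF \<psi>] bumps_integrable[OF \<psi>] by simp
  qed
  then show ?thesis by (intro exI[of _ c]) auto
qed

section \<open>Primitives of integrable functions\<close>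

lemma measurable_ident_leb [measurable]: "(\<lambda>x. x) \<in> borel_measurable leb"
  by (intro borel_measurable_leb_continuous continuous_intros)

lemma integrable_mult_bounded:
  fixes f g :: "'a \<Rightarrow> real"
  assumes f: "integrable M f" and g: "g \<in> borel_measurable M" and B: "\<And>x. x \<in> space M \<Longrightarrow> \<bar>g x\<bar> \<le> B"
  shows "integrable M (\<lambda>x. f x * g x)"
proof (rule Bochner_Integration.integrable_bound)
  show "integrable M (\<lambda>x. \<bar>f x\<bar> * B)" using f by simp
  show "(\<lambda>x. f x * g x) \<in> borel_measurable M" using f g by simp
  show "AE x in M. norm (f x * g x) \<le> norm (\<bar>f x\<bar> * B)"
    using B by (intro AE_I2) (auto simp: abs_mult intro!: mult_left_mono order_trans[OF B abs_ge_self])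
qed

lemma continuous_Icc_bounded:
  assumes "continuous_on {a..b} (f :: real \<Rightarrow> real)"
  obtains B where "\<And>x. x \<in> {a..b} \<Longrightarrow> \<bar>f x\<bar> \<le> B"
  using compact_imp_bounded[OF compact_continuous_image[OF assms compact_Icc]]
  unfolding bounded_iff by force

lemma AE_leb_exists:
  assumes "AE x in leb. P x" "0 \<le> a" "a < b" "b \<le> 1"
  shows "\<exists>x. a < x \<and> x < b \<and> P x"
proof (rule ccontr)
  assume "\<not> ?thesis"
  then have sub: "\<And>x. P x \<Longrightarrow> x \<notin> {a<..<b}" by auto
  have S: "{a<..<b} \<in> sets leb" using assms by (auto simp: sets_restrict_space image_iff intro!: bexI[of _ "{a<..<b}"])
  have "AE x in leb. x \<notin> {a<..<b}" using assms(1) by eventually_elim (rule sub)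
  then have "emeasure leb {a<..<b} = 0"
    using AE_iff_measurable[OF S, of "\<lambda>x. x \<notin> {a<..<b}"] assms by force
  moreover have "emeasure leb {a<..<b} = ennreal (b - a)"
    using assms by (subst emeasure_restrict_space) auto
  ultimately show False using assms by simp
qed

text \<open>The coincidence set is closed, and dense because it meets every subinterval of positive
  length. In this way identities between classes reach the end points as well.\<close>

lemma continuous_AE_eq:
  assumes f: "continuous_on {0..1} (f :: real \<Rightarrow> real)" and g: "continuous_on {0..1} g"
    and ae: "AE x in leb. f x = g x" and x: "x \<in> {0..1}"
  shows "f x = g x"
proof -
  let ?S = "{x \<in> {0..1}. f x = g x}"
  have "closed ?S"
    using continuous_closed_preimage_constant[of "{0..1}" "\<lambda>x. f x - g x" 0] f g
    by (simp add: continuous_on_diff eq_diff_eq)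
  moreover have "x \<in> closure ?S"
  proof (rule closure_approachable[THEN iffD2], intro allI impI)
    fix e :: real assume e: "0 < e"
    have "\<exists>z. max 0 (x - e) < z \<and> z < min 1 (x + e) \<and> f z = g z"
      by (rule AE_leb_exists[OF ae]) (use x e in auto)
    then obtain z where "max 0 (x - e) < z" "z < min 1 (x + e)" "f z = g z" by blast
    then show "\<exists>y\<in>?S. dist y x < e" by (intro bexI[of _ z]) (auto simp: dist_real_def)
  qed
  ultimately show ?thesis by (simp add: closure_closed)
qed

definition prim :: "(real \<Rightarrow> real) \<Rightarrow> real \<Rightarrow> real" where
  "prim g x = (\<integral>y. indicator {0<..<x} y * g y \<partial>leb)"

lemma integrable_leb_indicator:
  assumes "integrable leb (g :: real \<Rightarrow> real)" "A \<in> sets borel"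
  shows "integrable leb (\<lambda>y. indicator A y * g y)"
proof -
  have [measurable]: "A \<in> sets borel" by fact
  have "integrable leb (\<lambda>y. g y * indicator A y)"
    by (rule integrable_mult_bounded[OF assms(1), where B = 1]) (auto simp: indicator_def intro!: measurable_compose[OF measurable_ident_leb])
  then show ?thesis by (simp add: mult.commute)
qed

lemma prim_0 [simp]: "prim g 0 = 0"
  by (simp add: prim_def)

lemma prim_cong_AE:
  assumes "AE x in leb. f x = g x" "integrable leb f" "integrable leb g"
  shows "prim f x = prim g x"
  unfolding prim_def using assms
  by (intro integral_cong_AE borel_measurable_integrable integrable_leb_indicator) auto

lemma prim_diff_le:
  assumes g: "integrable leb g"
  shows "\<bar>prim g x - prim g y\<bar> \<le> (\<integral>x. \<bar>g x\<bar> \<partial>leb)"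
proof -
  have i: "integrable leb (\<lambda>z. indicator {0<..<x} z * g z)" for x using g by (rule integrable_leb_indicator) simp
  have "prim g x - prim g y = (\<integral>z. indicator {0<..<x} z * g z - indicator {0<..<y} z * g z \<partial>leb)"
    unfolding prim_def using i by simp
  also have "\<bar>\<dots>\<bar> \<le> (\<integral>z. \<bar>indicator {0<..<x} z * g z - indicator {0<..<y} z * g z\<bar> \<partial>leb)"
    by (rule integral_abs_bound)
  also have "\<dots> \<le> (\<integral>z. \<bar>g z\<bar> \<partial>leb)"
    using g i by (intro integral_mono) (auto simp: indicator_def)
  finally show ?thesis .
qed

lemma prim_eq_HK:
  assumes g: "integrable leb g" and x: "x \<in> {0..1}"
  shows "prim g x = integral {0..x} g"
proof -
  have "prim g x = integral {0..1} (\<lambda>y. indicator {0<..<x} y * g y)"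
    unfolding prim_def using integrable_leb_indicator[OF g, of "{0<..<x}"] by (intro integral_leb_eq_HK) simp
  also have "\<dots> = integral {0..1} (\<lambda>y. if y \<in> {0<..<x} then g y else 0)"
    by (intro Henstock_Kurzweil_Integration.integral_cong) (auto simp: indicator_def)
  also have "\<dots> = integral {0<..<x} g"
    using x by (simp only: integral_restrict_Int) (auto intro!: arg_cong2[where f = integral])
  finally show ?thesis by (simp add: integral_open_interval_real)
qed

lemma HK_integrable_leb:
  assumes g: "integrable leb (g :: real \<Rightarrow> real)"
  shows "g integrable_on {0..1}"
proof -
  have "g integrable_on Om" using g by (simp add: integrable_on_lebesgue_on)
  then show ?thesis by (simp add: integrable_on_open_interval_real)
qed

lemma prim_continuous:
  assumes g: "integrable leb g"
  shows "continuous_on {0..1} (prim g)"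
proof -
  have "continuous_on {0..1} (\<lambda>x. integral {0..x} g)"
    by (rule indefinite_integral_continuous_1[OF HK_integrable_leb[OF g]])
  then show ?thesis
    by (rule continuous_on_eq) (simp add: prim_eq_HK[OF g])
qed

lemma prim_deriv:
  assumes g: "continuous_on {0..1} g" and x: "x \<in> Om"
  shows "(prim g has_real_derivative g x) (at x)"
proof -
  have i: "integrable leb g" using g by (rule integrable_leb_continuous_Icc)
  have "((\<lambda>x. integral {0..x} g) has_real_derivative g x) (at x within {0..1})"
    using integral_has_real_derivative[OF g, of x] x by auto
  then have "((\<lambda>x. integral {0..x} g) has_real_derivative g x) (at x)"
    using x at_within_interior[of x "{0..1}"] by (simp add: interior_atLeastAtMost_real)
  moreover have "\<forall>\<^sub>F y in nhds x. prim g y = integral {0..y} g"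
    using x eventually_nhds_in_open[of Om x] by (auto elim!: eventually_mono simp: prim_eq_HK[OF i])
  ultimately show ?thesis by (simp add: DERIV_cong_ev)
qed

interpretation leb2: pair_sigma_finite leb leb ..

lemma prim_by_parts:
  assumes g: "integrable leb g" and W: "continuous_on {0..1} W"
    and W': "\<And>x. x \<in> Om \<Longrightarrow> (W has_real_derivative W' x) (at x)"
    and m: "W' \<in> borel_measurable leb" and B: "\<And>x. x \<in> Om \<Longrightarrow> \<bar>W' x\<bar> \<le> B"
  shows "(\<integral>x. prim g x * W' x \<partial>leb) = W 1 * (\<integral>x. g x \<partial>leb) - (\<integral>x. g x * W x \<partial>leb)"
proof -
  define f where "f x y = (if 0 < y \<and> y < x then g y * W' x else 0)" for x y
  have gm [measurable]: "g \<in> borel_measurable leb" and W'm [measurable]: "W' \<in> borel_measurable leb"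
    using g m by auto
  have B0: "0 \<le> B" using B[of "1/2"] by simp
  have fm [measurable]: "(\<lambda>(x, y). f x y) \<in> borel_measurable (leb \<Otimes>\<^sub>M leb)"
    unfolding f_def by measurable
  have fb: "\<bar>f x y\<bar> \<le> \<bar>g y\<bar> * B" if "x \<in> Om" for x y
    using B[OF that] B0 by (auto simp: f_def abs_mult intro!: mult_left_mono)
  have fi: "integrable leb (\<lambda>y. f x y)" if "x \<in> Om" for x
    by (rule Bochner_Integration.integrable_bound[of leb "\<lambda>y. \<bar>g y\<bar> * B"])
       (use g fb[OF that] B0 in \<open>auto simp: f_def abs_mult\<close>)
  have int: "integrable (leb \<Otimes>\<^sub>M leb) (\<lambda>(x, y). f x y)"
  proof (rule leb2.Fubini_integrable)
    show "integrable leb (\<lambda>x. \<integral>y. norm (case (x, y) of (x, y) \<Rightarrow> f x y) \<partial>leb)"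
    proof (rule integrable_leb_bounded)
      show "(\<lambda>x. \<integral>y. norm (case (x, y) of (x, y) \<Rightarrow> f x y) \<partial>leb) \<in> borel_measurable leb"
        by measurable
      fix x :: real assume x: "x \<in> Om"
      have "\<bar>\<integral>y. norm (case (x, y) of (x, y) \<Rightarrow> f x y) \<partial>leb\<bar> = (\<integral>y. \<bar>f x y\<bar> \<partial>leb)" by simp
      also have "\<dots> \<le> (\<integral>y. \<bar>g y\<bar> * B \<partial>leb)"
        using fi[OF x] g fb[OF x] by (intro integral_mono) auto
      finally show "\<bar>\<integral>y. norm (case (x, y) of (x, y) \<Rightarrow> f x y) \<partial>leb\<bar> \<le> (\<integral>y. \<bar>g y\<bar> * B \<partial>leb)" .
    qed
    show "AE x in leb. integrable leb (\<lambda>y. case (x, y) of (x, y) \<Rightarrow> f x y)"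
      using fi by (intro AE_I2) auto
  qed (rule fm)
  have W'i: "integrable leb W'" using m B by (rule integrable_leb_bounded)
  have "(\<integral>x. prim g x * W' x \<partial>leb) = (\<integral>x. (\<integral>y. f x y \<partial>leb) \<partial>leb)"
  proof (intro Bochner_Integration.integral_cong refl)
    fix x
    have "(\<integral>y. f x y \<partial>leb) = (\<integral>y. (indicator {0<..<x} y * g y) * W' x \<partial>leb)"
      by (intro Bochner_Integration.integral_cong) (auto simp: f_def)
    then show "prim g x * W' x = (\<integral>y. f x y \<partial>leb)" by (simp add: prim_def)
  qed
  also have "\<dots> = (\<integral>y. (\<integral>x. f x y \<partial>leb) \<partial>leb)"
    using leb2.Fubini_integral[OF int] by simp
  also have "\<dots> = (\<integral>y. W 1 * g y - g y * W y \<partial>leb)"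
  proof (intro Bochner_Integration.integral_cong refl)
    fix y assume "y \<in> space leb"
    then have y: "y \<in> Om" by simp
    have "(\<integral>x. f x y \<partial>leb) = (\<integral>x. g y * (indicator {y<..<1} x * W' x) \<partial>leb)"
      using y by (intro Bochner_Integration.integral_cong) (auto simp: f_def)
    also have "\<dots> = g y * (W 1 - W y)"
      using y by (simp, intro disjI2 integral_leb_deriv W'i continuous_on_subset[OF W] W') auto
    finally show "(\<integral>x. f x y \<partial>leb) = W 1 * g y - g y * W y" by (simp add: algebra_simps)
  qed
  also have "\<dots> = W 1 * (\<integral>x. g x \<partial>leb) - (\<integral>x. g x * W x \<partial>leb)"
  proof -
    obtain C where C: "\<And>x. x \<in> {0..1} \<Longrightarrow> \<bar>W x\<bar> \<le> C" using continuous_Icc_bounded[OF W] by blast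
    have "integrable leb (\<lambda>x. g x * W x)"
      by (rule integrable_mult_bounded[OF g, where B = C])
         (use C in \<open>auto intro!: borel_measurable_leb_continuous continuous_on_subset[OF W]\<close>)
    then show ?thesis using g by simp
  qed
  finally show ?thesis .
qed

section \<open>Square integrable functions and their norm\<close>

lemma L2_integrable: "u \<in> L2 \<Longrightarrow> integrable leb u"
  using integrable_mult_of_squares[of u leb "\<lambda>_. 1"] by (simp add: L2_def)

lemma L2_diff: "u \<in> L2 \<Longrightarrow> v \<in> L2 \<Longrightarrow> (\<lambda>x. u x - v x) \<in> L2"
  unfolding L2_def using integrable_mult_of_squares[of u leb v] by (auto simp: power2_diff mult.assoc)

lemma L2_bounded:
  assumes "u \<in> borel_measurable leb" "\<And>x. x \<in> Om \<Longrightarrow> \<bar>u x\<bar> \<le> B"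
  shows "u \<in> L2"
proof -
  have "integrable leb (\<lambda>x. (u x)\<^sup>2)"
  proof (rule integrable_leb_bounded[where B = "B\<^sup>2"])
    fix x :: real assume "x \<in> Om"
    then have "\<bar>u x\<bar>\<^sup>2 \<le> B\<^sup>2" using assms(2) by (intro power_mono) auto
    then show "\<bar>(u x)\<^sup>2\<bar> \<le> B\<^sup>2" by simp
  qed (use assms(1) in simp)
  then show ?thesis using assms(1) by (simp add: L2_def)
qed

lemma L2_continuous:
  assumes "continuous_on {0..1} u"
  shows "u \<in> L2"
proof -
  obtain B where "\<And>x. x \<in> {0..1} \<Longrightarrow> \<bar>u x\<bar> \<le> B"
    using continuous_Icc_bounded[OF assms] by blast
  then show ?thesis
    by (intro L2_bounded[where B = B] borel_measurable_leb_continuous continuous_on_subset[OF assms]) auto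
qed

lemma L2_norm_square: "(L2_norm u)\<^sup>2 = (\<integral>x. (u x)\<^sup>2 \<partial>leb)"
  by (simp add: L2_norm_def L2_inner_def power2_eq_square)

lemma L2_norm_nonneg [simp]: "0 \<le> L2_norm u"
  by (simp add: L2_norm_def L2_inner_def)

lemma L2_norm_eq: "L2_norm u = sqrt (\<integral>x. (u x)\<^sup>2 \<partial>leb)"
  by (simp add: L2_norm_def L2_inner_def power2_eq_square)

lemma L2_inner_le: "u \<in> L2 \<Longrightarrow> v \<in> L2 \<Longrightarrow> \<bar>\<integral>x. u x * v x \<partial>leb\<bar> \<le> L2_norm u * L2_norm v"
  unfolding L2_norm_eq L2_def by (intro abs_integral_Cauchy_Schwarz) auto

lemma L1_le_L2: "u \<in> L2 \<Longrightarrow> (\<integral>x. \<bar>u x\<bar> \<partial>leb) \<le> L2_norm u"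
proof -
  assume u: "u \<in> L2"
  then have "(\<lambda>x. \<bar>u x\<bar>) \<in> L2" "(\<lambda>x. 1) \<in> L2" by (auto simp: L2_def)
  from L2_inner_le[OF this] show ?thesis by (simp add: L2_norm_eq)
qed

section \<open>Derivatives of test functions, and weak derivatives as densities of
  primitives\<close>

lemma test_vanish: "\<phi> \<in> test_functions \<Longrightarrow> x \<notin> Om \<Longrightarrow> \<phi> x = 0"
  using closure_subset[of "{x. \<phi> x \<noteq> 0}"] unfolding test_functions_def by auto

lemma test_nderiv:
  assumes "\<phi> \<in> test_functions"
  shows "(nderiv UNIV k \<phi> has_real_derivative nderiv UNIV (Suc k) \<phi> x) (at x)"
  using assms unfolding test_functions_def Ck_on_def by blast

lemma test_continuous: "\<phi> \<in> test_functions \<Longrightarrow> continuous_on A (nderiv UNIV k \<phi>)"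
  using test_nderiv by (meson DERIV_isCont continuous_at_imp_continuous_on)

lemma nderiv_shift: "nderiv UNIV j (nderiv UNIV (Suc 0) \<phi>) = nderiv UNIV (Suc j) \<phi>"
  by (induction j) auto

lemma test_deriv_test:
  assumes \<phi>: "\<phi> \<in> test_functions"
  shows "nderiv UNIV (Suc 0) \<phi> \<in> test_functions"
proof -
  have "Ck_on k UNIV (nderiv UNIV (Suc 0) \<phi>)" for k
    unfolding Ck_on_def nderiv_shift using test_nderiv[OF \<phi>] test_continuous[OF \<phi>] by blast
  moreover have "closure {x. nderiv UNIV (Suc 0) \<phi> x \<noteq> 0} \<subseteq> Om"
  proof -
    have z: "nderiv UNIV (Suc 0) \<phi> x = 0" if x: "x \<notin> closure {x. \<phi> x \<noteq> 0}" for x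
    proof -
      have "\<forall>\<^sub>F y in nhds x. y \<in> - closure {x. \<phi> x \<noteq> 0}"
        using x by (intro eventually_nhds_in_open) auto
      then have ev: "\<forall>\<^sub>F y in nhds x. \<phi> y = 0"
        by (rule eventually_mono) (use closure_subset[of "{x. \<phi> x \<noteq> 0}"] in auto)
      have "(\<phi> has_real_derivative 0) (at x)"
        using DERIV_cong_ev[OF refl ev refl, of 0] by simp
      moreover have "(\<phi> has_real_derivative nderiv UNIV (Suc 0) \<phi> x) (at x)"
        using test_nderiv[OF \<phi>, of 0 x] by simp
      ultimately show ?thesis by (rule DERIV_unique[rotated])
    qed
    then have "closure {x. nderiv UNIV (Suc 0) \<phi> x \<noteq> 0} \<subseteq> closure {x. \<phi> x \<noteq> 0}"
      by (intro closure_minimal subsetI closed_closure) (use z in \<open>simp del: nderiv.simps, metis\<close>)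
    also have "\<dots> \<subseteq> Om" using \<phi> unfolding test_functions_def by simp
    finally show ?thesis .
  qed
  ultimately show ?thesis by (simp add: test_functions_def)
qed

text \<open>By \<open>prim_by_parts\<close> the function \<open>prim g\<close> has weak derivative
  \<open>g\<close>; so \<open>u - prim g\<close> annihilates the derivatives of test functions and
  is constant by du Bois-Reymond.\<close>

lemma weak_deriv_imp_prim:
  assumes u: "integrable leb u" and g: "integrable leb g"
    and weak: "\<And>\<phi>. \<phi> \<in> test_functions \<Longrightarrow> (\<integral>x. u x * nderiv UNIV (Suc 0) \<phi> x \<partial>leb) = - (\<integral>x. g x * \<phi> x \<partial>leb)"
  shows "\<exists>c. AE x in leb. u x = c + prim g x"
proof -
  have pi: "integrable leb (prim g)" by (intro integrable_leb_continuous_Icc prim_continuous g)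
  have "\<exists>c. AE x in leb. u x - prim g x = c"
  proof (rule AE_const_if_orthogonal_derivatives)
    show "integrable leb (\<lambda>x. u x - prim g x)" using u pi by simp
    fix \<phi> \<psi> assume \<phi>: "\<phi> \<in> test_functions" and \<psi>: "\<psi> \<in> bumps" and der: "\<And>x. (\<phi> has_real_derivative \<psi> x) (at x)"
    have nd: "nderiv UNIV (Suc 0) \<phi> = \<psi>" by (rule nderiv_Suc_eq) (simp add: der)
    obtain B where B: "\<And>x. x \<in> {0..1} \<Longrightarrow> \<bar>\<psi> x\<bar> \<le> B"
      using continuous_Icc_bounded[OF bumps_continuous[OF \<psi>]] by blast
    have \<psi>m: "\<psi> \<in> borel_measurable leb" using bumps_integrable[OF \<psi>] by simp
    have "(\<integral>x. prim g x * \<psi> x \<partial>leb) = \<phi> 1 * (\<integral>x. g x \<partial>leb) - (\<integral>x. g x * \<phi> x \<partial>leb)"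
      by (rule prim_by_parts[OF g test_continuous[OF \<phi>, of _ 0, simplified] der \<psi>m, where B = B]) (use B in auto)
    then have 1: "(\<integral>x. prim g x * \<psi> x \<partial>leb) = - (\<integral>x. g x * \<phi> x \<partial>leb)"
      using test_vanish[OF \<phi>, of 1] by simp
    have "(\<integral>x. (u x - prim g x) * \<psi> x \<partial>leb) = (\<integral>x. u x * \<psi> x - prim g x * \<psi> x \<partial>leb)"
      by (simp add: left_diff_distrib)
    also have "\<dots> = (\<integral>x. u x * \<psi> x \<partial>leb) - (\<integral>x. prim g x * \<psi> x \<partial>leb)"
      by (intro Bochner_Integration.integral_diff integrable_mult_bounded[where B = B, OF u \<psi>m] integrable_mult_bounded[where B = B, OF pi \<psi>m]) (use B in auto)
    also have "\<dots> = 0" using 1 weak[OF \<phi>] unfolding nd by simp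
    finally show "(\<integral>x. (u x - prim g x) * \<psi> x \<partial>leb) = 0" .
  qed
  then obtain c where c: "AE x in leb. u x - prim g x = c" by blast
  have "AE x in leb. u x = c + prim g x" using c by eventually_elim simp
  then show ?thesis by blast
qed

section \<open>Regularity of Sobolev functions\<close>

lemma Hk_weak_deriv:
  assumes "u \<in> Hk k" "j \<le> k"
  shows "weak_deriv j u \<in> L2" "is_weak_deriv j u (weak_deriv j u)"
proof -
  have "\<exists>g. g \<in> L2 \<and> is_weak_deriv j u g" using assms by (auto simp: Hk_def)
  then have "weak_deriv j u \<in> L2 \<and> is_weak_deriv j u (weak_deriv j u)"
    unfolding weak_deriv_def by (rule someI_ex)
  then show "weak_deriv j u \<in> L2" "is_weak_deriv j u (weak_deriv j u)" by auto
qed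

lemma Hk_norm_nonneg [simp]: "0 \<le> Hk_norm k u"
  by (simp add: Hk_norm_def sum_nonneg)

lemma L2_norm_weak_deriv_le:
  assumes "j \<le> k"
  shows "L2_norm (weak_deriv j u) \<le> Hk_norm k u"
proof -
  have "(L2_norm (weak_deriv j u))\<^sup>2 \<le> (\<Sum>j\<le>k. (L2_norm (weak_deriv j u))\<^sup>2)"
    using assms by (intro member_le_sum) auto
  then show ?thesis unfolding Hk_norm_def by (rule real_le_rsqrt)
qed

text \<open>The derivative of \<open>\<phi>\<close> is again a test function, and testing with it
  lowers the order by one. Thus \<open>Hk\<close>, which asks for the weak derivatives of each order
  separately, yields a chain of successive primitives.\<close>

lemma weak_deriv_Suc:
  assumes g: "is_weak_deriv j u g" and g': "is_weak_deriv (Suc j) u g'" and \<phi>: "\<phi> \<in> test_functions"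
  shows "(\<integral>x. g x * nderiv UNIV (Suc 0) \<phi> x \<partial>leb) = - (\<integral>x. g' x * \<phi> x \<partial>leb)"
proof -
  have "L2_inner u (nderiv UNIV (Suc j) \<phi>) = (- 1) ^ j * L2_inner g (nderiv UNIV (Suc 0) \<phi>)"
    using g test_deriv_test[OF \<phi>] unfolding is_weak_deriv_def by (metis nderiv_shift)
  moreover have "L2_inner u (nderiv UNIV (Suc j) \<phi>) = (- 1) ^ Suc j * L2_inner g' \<phi>"
    using g' \<phi> unfolding is_weak_deriv_def by blast
  ultimately have "(- 1) ^ j * L2_inner g (nderiv UNIV (Suc 0) \<phi>) = (- 1) ^ j * (- L2_inner g' \<phi>)"
    by simp
  then have "L2_inner g (nderiv UNIV (Suc 0) \<phi>) = - L2_inner g' \<phi>"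
    by (rule mult_left_cancel[THEN iffD1, rotated]) simp
  then show ?thesis by (simp add: L2_inner_def)
qed

lemma Hk_prim:
  assumes u: "u \<in> Hk k" and j: "Suc j \<le> k"
  shows "\<exists>c. AE x in leb. weak_deriv j u x = c + prim (weak_deriv (Suc j) u) x"
proof (rule weak_deriv_imp_prim)
  have j': "j \<le> k" using j by simp
  show "integrable leb (weak_deriv j u)" "integrable leb (weak_deriv (Suc j) u)"
    using Hk_weak_deriv(1)[OF u j'] Hk_weak_deriv(1)[OF u j] L2_integrable by auto
  show "(\<integral>x. weak_deriv j u x * nderiv UNIV (Suc 0) \<phi> x \<partial>leb) = - (\<integral>x. weak_deriv (Suc j) u x * \<phi> x \<partial>leb)"
    if "\<phi> \<in> test_functions" for \<phi>
    by (rule weak_deriv_Suc[OF Hk_weak_deriv(2)[OF u j'] Hk_weak_deriv(2)[OF u j] that])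
qed

lemma is_weak_deriv_0: "is_weak_deriv 0 u u"
  by (simp add: is_weak_deriv_def)

lemma weak_deriv_0_AE:
  assumes u: "u \<in> Hk k"
  shows "AE x in leb. u x = weak_deriv 0 u x"
proof -
  have "AE x in leb. u x - weak_deriv 0 u x = 0"
  proof (rule AE_eq_0_if_orthogonal_bumps)
    have uL: "u \<in> L2" and wL: "weak_deriv 0 u \<in> L2" using u Hk_weak_deriv[OF u, of 0] by (auto simp: Hk_def)
    then show "integrable leb (\<lambda>x. u x - weak_deriv 0 u x)" using L2_integrable by simp
    fix \<psi> assume \<psi>: "\<psi> \<in> bumps"
    have \<psi>L: "\<psi> \<in> L2" using L2_continuous bumps_continuous[OF \<psi>] by blast
    have "(\<integral>x. u x * \<psi> x \<partial>leb) = (\<integral>x. weak_deriv 0 u x * \<psi> x \<partial>leb)"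
      using Hk_weak_deriv(2)[OF u, of 0] bumps_test[OF \<psi>] by (simp add: is_weak_deriv_def L2_inner_def)
    moreover have "integrable leb (\<lambda>x. u x * \<psi> x)" "integrable leb (\<lambda>x. weak_deriv 0 u x * \<psi> x)"
      using uL wL \<psi>L by (auto simp: L2_def intro!: integrable_mult_of_squares)
    ultimately show "(\<integral>x. (u x - weak_deriv 0 u x) * \<psi> x \<partial>leb) = 0"
      by (simp add: left_diff_distrib)
  qed
  then show ?thesis by eventually_elim simp
qed

lemma weak_deriv_AE_unique:
  assumes "is_weak_deriv k u g" "is_weak_deriv k u g'" "g \<in> L2" "g' \<in> L2"
  shows "AE x in leb. g x = g' x"
proof -
  have "AE x in leb. g x - g' x = 0"
  proof (rule AE_eq_0_if_orthogonal_bumps)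
    show "integrable leb (\<lambda>x. g x - g' x)" using L2_integrable assms by simp
    fix \<psi> assume \<psi>: "\<psi> \<in> bumps"
    have \<psi>L: "\<psi> \<in> L2" using L2_continuous bumps_continuous[OF \<psi>] by blast
    have "(- 1) ^ k * L2_inner g \<psi> = (- 1) ^ k * L2_inner g' \<psi>"
      using assms bumps_test[OF \<psi>] unfolding is_weak_deriv_def by metis
    then have "L2_inner g \<psi> = L2_inner g' \<psi>" by simp
    moreover have "integrable leb (\<lambda>x. g x * \<psi> x)" "integrable leb (\<lambda>x. g' x * \<psi> x)"
      using assms \<psi>L by (auto simp: L2_def intro!: integrable_mult_of_squares)
    ultimately show "(\<integral>x. (g x - g' x) * \<psi> x \<partial>leb) = 0"
      by (simp add: left_diff_distrib L2_inner_def)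
  qed
  then show ?thesis by eventually_elim simp
qed

text \<open>Sobolev embedding in one dimension: \<open>\<bar>F x\<bar>\<close> exceeds
  \<open>\<bar>F y\<bar>\<close> by at most the L1 norm of \<open>g\<close>; average over y and pass
  to L2 norms. The bound is in terms of \<open>f\<close> so that it applies to a chosen weak
  derivative.\<close>

lemma prim_plus_const_le:
  assumes F: "\<And>x. x \<in> {0..1} \<Longrightarrow> F x = c + prim g x" and g: "g \<in> L2"
    and ae: "AE x in leb. f x = F x" and f: "f \<in> L2" and x: "x \<in> {0..1}"
  shows "\<bar>F x\<bar> \<le> L2_norm f + L2_norm g"
proof -
  have gi: "integrable leb g" using g by (rule L2_integrable)
  have cont: "continuous_on {0..1} F"
    using F prim_continuous[OF gi] by (subst continuous_on_cong[OF refl F]) (auto intro!: continuous_intros)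
  have Fi: "integrable leb F" using cont by (rule integrable_leb_continuous_Icc)
  have pt: "\<bar>F x\<bar> \<le> \<bar>F y\<bar> + (\<integral>x. \<bar>g x\<bar> \<partial>leb)" if "y \<in> Om" for y
    using prim_diff_le[OF gi, of x y] F[OF x] F[of y] that by auto
  have "\<bar>F x\<bar> = (\<integral>y. \<bar>F x\<bar> \<partial>leb)" by simp
  also have "\<dots> \<le> (\<integral>y. \<bar>F y\<bar> + (\<integral>x. \<bar>g x\<bar> \<partial>leb) \<partial>leb)"
    using Fi pt by (intro integral_mono) auto
  also have "\<dots> = (\<integral>y. \<bar>F y\<bar> \<partial>leb) + (\<integral>x. \<bar>g x\<bar> \<partial>leb)"
    using Fi by simp
  also have "(\<integral>y. \<bar>F y\<bar> \<partial>leb) = (\<integral>y. \<bar>f y\<bar> \<partial>leb)"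
    using Fi L2_integrable[OF f] ae by (intro integral_cong_AE) auto
  finally show ?thesis using L1_le_L2[OF f] L1_le_L2[OF g] by linarith
qed

text \<open>\<open>U2\<close>, \<open>U1\<close> and \<open>U\<close> are primitives of continuous
  representatives rather than of weak derivatives, so they are classically differentiable.
  \<open>U3\<close> is only a primitive of the square integrable \<open>g\<close>, and is exported
  in that form. The factor 2 adds the norms of a function and of its derivative.\<close>

lemma H4_representative:
  assumes u: "u \<in> Hk 4"
  obtains U U1 U2 U3 g c0 c where
    "continuous_on {0..1} U" "continuous_on {0..1} U1" "continuous_on {0..1} U2" "continuous_on {0..1} U3"
    "\<And>x. x \<in> Om \<Longrightarrow> (U has_real_derivative U1 x) (at x)"
    "\<And>x. x \<in> Om \<Longrightarrow> (U1 has_real_derivative U2 x) (at x)"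
    "\<And>x. x \<in> Om \<Longrightarrow> (U2 has_real_derivative U3 x) (at x)"
    "\<And>x. x \<in> {0..1} \<Longrightarrow> U x = c0 + prim U1 x"
    "g \<in> L2" "\<And>x. x \<in> {0..1} \<Longrightarrow> U3 x = c + prim g x"
    "AE x in leb. u x = U x" "AE x in leb. weak_deriv 2 u x = U2 x"
    "\<And>x. x \<in> {0..1} \<Longrightarrow> \<bar>U1 x\<bar> \<le> 2 * Hk_norm 4 u"
    "\<And>x. x \<in> {0..1} \<Longrightarrow> \<bar>U2 x\<bar> \<le> 2 * Hk_norm 4 u"
    "\<And>x. x \<in> {0..1} \<Longrightarrow> \<bar>U3 x\<bar> \<le> 2 * Hk_norm 4 u"
    "L2_norm g \<le> Hk_norm 4 u"
proof -
  let ?w = "\<lambda>j. weak_deriv j u"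
  have wL: "?w j \<in> L2" if "j \<le> 4" for j using Hk_weak_deriv[OF u that] by blast
  have "\<forall>j. \<exists>c. j < 4 \<longrightarrow> (AE x in leb. ?w j x = c + prim (?w (Suc j)) x)"
    using Hk_prim[OF u] by (auto simp: Suc_le_eq)
  from choice[OF this]
  obtain a where a: "\<And>j. j < 4 \<Longrightarrow> AE x in leb. ?w j x = a j + prim (?w (Suc j)) x"
    by blast
  define U3 where "U3 x = a 3 + prim (?w 4) x" for x
  define U2 where "U2 x = a 2 + prim U3 x" for x
  define U1 where "U1 x = a 1 + prim U2 x" for x
  define U where "U x = a 0 + prim U1 x" for x
  have i4: "integrable leb (?w 4)" using wL[of 4] L2_integrable by simp
  have c3: "continuous_on {0..1} U3" unfolding U3_def by (intro continuous_intros prim_continuous i4)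
  have i3: "integrable leb U3" using c3 by (rule integrable_leb_continuous_Icc)
  have c2: "continuous_on {0..1} U2" unfolding U2_def by (intro continuous_intros prim_continuous i3)
  have i2: "integrable leb U2" using c2 by (rule integrable_leb_continuous_Icc)
  have c1: "continuous_on {0..1} U1" unfolding U1_def by (intro continuous_intros prim_continuous i2)
  have i1: "integrable leb U1" using c1 by (rule integrable_leb_continuous_Icc)
  have c0: "continuous_on {0..1} U" unfolding U_def by (intro continuous_intros prim_continuous i1)
  have e3: "AE x in leb. ?w 3 x = U3 x" using a[of 3] by (simp add: U3_def)
  have "prim (?w 3) x = prim U3 x" for x
    using e3 wL[of 3] i3 L2_integrable by (intro prim_cong_AE) auto
  then have e2: "AE x in leb. ?w 2 x = U2 x" using a[of 2] by (simp add: U2_def)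
  have "prim (?w 2) x = prim U2 x" for x
    using e2 wL[of 2] i2 L2_integrable by (intro prim_cong_AE) auto
  then have e1: "AE x in leb. ?w 1 x = U1 x" using a[of 1] by (simp add: U1_def numeral_2_eq_2)
  have "prim (?w 1) x = prim U1 x" for x
    using e1 wL[of 1] i1 L2_integrable by (intro prim_cong_AE) auto
  then have e0: "AE x in leb. ?w 0 x = U x" using a[of 0] by (simp add: U_def)
  have eu: "AE x in leb. u x = U x"
    using weak_deriv_0_AE[OF u] e0 by eventually_elim simp
  have n: "L2_norm (?w j) \<le> Hk_norm 4 u" if "j \<le> 4" for j using L2_norm_weak_deriv_le[OF that] .
  have n3: "L2_norm U3 \<le> Hk_norm 4 u"
  proof -
    have "L2_norm U3 = L2_norm (?w 3)" unfolding L2_norm_eq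
      using e3 i3 wL[of 3] by (intro arg_cong[where f = sqrt] integral_cong_AE) (auto simp: L2_def)
    then show ?thesis using n[of 3] by simp
  qed
  have n2: "L2_norm U2 \<le> Hk_norm 4 u"
  proof -
    have "L2_norm U2 = L2_norm (?w 2)" unfolding L2_norm_eq
      using e2 i2 wL[of 2] by (intro arg_cong[where f = sqrt] integral_cong_AE) (auto simp: L2_def)
    then show ?thesis using n[of 2] by simp
  qed
  have b3: "\<bar>U3 x\<bar> \<le> 2 * Hk_norm 4 u" if "x \<in> {0..1}" for x
    using prim_plus_const_le[OF U3_def wL[of 4] e3 wL[of 3] that] n[of 3] n[of 4] by simp
  have b2: "\<bar>U2 x\<bar> \<le> 2 * Hk_norm 4 u" if "x \<in> {0..1}" for x
    using prim_plus_const_le[OF U2_def L2_continuous[OF c3] e2 wL[of 2] that] n3 n[of 2] by simp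
  have b1: "\<bar>U1 x\<bar> \<le> 2 * Hk_norm 4 u" if "x \<in> {0..1}" for x
    using prim_plus_const_le[OF U1_def L2_continuous[OF c2] e1 wL[of 1] that] n2 n[of 1] by simp
  show ?thesis
  proof (rule that[of U U1 U2 U3 "a 0" "?w 4" "a 3"])
    show "(U has_real_derivative U1 x) (at x)" if "x \<in> Om" for x
      unfolding U_def using prim_deriv[OF c1 that] by (auto intro!: derivative_eq_intros)
    show "(U1 has_real_derivative U2 x) (at x)" if "x \<in> Om" for x
      unfolding U1_def using prim_deriv[OF c2 that] by (auto intro!: derivative_eq_intros)
    show "(U2 has_real_derivative U3 x) (at x)" if "x \<in> Om" for x
      unfolding U2_def using prim_deriv[OF c3 that] by (auto intro!: derivative_eq_intros)
  qed (use c0 c1 c2 c3 eu e2 b1 b2 b3 n[of 4] wL[of 4] U_def U3_def in auto)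
qed

text \<open>Test functions vanish at the end points, so the value of \<open>U\<close> there is that
  of \<open>U - \<phi>\<close>, which the embedding bounds by the H1 distance of \<open>u\<close>
  and \<open>\<phi>\<close>. The norm selects weak derivatives by choice, hence
  \<open>u - \<phi>\<close> must first be shown to possess them.\<close>

lemma H10_boundary:
  assumes u: "u \<in> H10" and ae: "AE x in leb. u x = U x"
    and U: "\<And>x. x \<in> {0..1} \<Longrightarrow> U x = c + prim g x" and g: "integrable leb g" and x: "x \<in> {0, 1}"
  shows "U x = 0"
proof -
  have uH: "u \<in> Hk 1" using u by (simp add: H10_def)
  have "\<bar>U x\<bar> \<le> 2 * \<epsilon>" if \<epsilon>: "\<epsilon> > 0" for \<epsilon>
  proof -
    obtain \<phi> where \<phi>: "\<phi> \<in> test_functions" and small: "Hk_norm 1 (\<lambda>x. u x - \<phi> x) < \<epsilon>"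
      using u \<epsilon> by (auto simp: H10_def)
    let ?w = "\<lambda>x. u x - \<phi> x" and ?\<phi>' = "nderiv UNIV (Suc 0) \<phi>"
    have c\<phi>: "continuous_on A \<phi>" "continuous_on A ?\<phi>'" for A
      using test_continuous[OF \<phi>, of A 0] test_continuous[OF \<phi>, of A "Suc 0"] by simp_all
    have uL: "u \<in> L2" using uH by (simp add: Hk_def)
    have w1L: "weak_deriv 1 u \<in> L2" using Hk_weak_deriv(1)[OF uH, of 1] by simp
    have wL: "?w \<in> L2" by (intro L2_diff[OF uL] L2_continuous c\<phi>)
    have weak1: "is_weak_deriv 1 ?w (\<lambda>x. weak_deriv 1 u x - ?\<phi>' x)"
      unfolding is_weak_deriv_def
    proof
      fix \<psi> assume \<psi>: "\<psi> \<in> test_functions"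
      let ?\<psi>' = "nderiv UNIV (Suc 0) \<psi>"
      have c\<psi>: "continuous_on A \<psi>" "continuous_on A ?\<psi>'" for A
        using test_continuous[OF \<psi>, of A 0] test_continuous[OF \<psi>, of A "Suc 0"] by simp_all
      have int: "integrable leb (\<lambda>x. f x * h x)" if "f \<in> L2" "h \<in> L2" for f h
        using that by (auto simp: L2_def intro!: integrable_mult_of_squares)
      have 1: "(\<integral>x. u x * ?\<psi>' x \<partial>leb) = - (\<integral>x. weak_deriv 1 u x * \<psi> x \<partial>leb)"
        using weak_deriv_Suc[OF is_weak_deriv_0, of u "weak_deriv 1 u" \<psi>] Hk_weak_deriv[OF uH, of 1] \<psi> by simp
      have "(\<integral>x. \<phi> x * ?\<psi>' x + ?\<phi>' x * \<psi> x \<partial>leb) = \<phi> 1 * \<psi> 1 - \<phi> 0 * \<psi> 0"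
      proof (rule integral_leb_deriv_Om[where F = "\<lambda>x. \<phi> x * \<psi> x"])
        show "continuous_on {0..1} (\<lambda>x. \<phi> x * \<psi> x)" by (intro continuous_intros c\<phi> c\<psi>)
        show "((\<lambda>x. \<phi> x * \<psi> x) has_real_derivative \<phi> x * ?\<psi>' x + ?\<phi>' x * \<psi> x) (at x)" for x
          using DERIV_mult'[OF test_nderiv[OF \<phi>, of 0 x] test_nderiv[OF \<psi>, of 0 x]] by (simp add: ac_simps)
        show "integrable leb (\<lambda>x. \<phi> x * ?\<psi>' x + ?\<phi>' x * \<psi> x)"
          by (intro integrable_leb_continuous_Icc continuous_intros c\<phi> c\<psi>)
      qed
      also have "\<phi> 1 * \<psi> 1 - \<phi> 0 * \<psi> 0 = 0" using test_vanish[OF \<phi>] by simp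
      finally have 2: "(\<integral>x. \<phi> x * ?\<psi>' x \<partial>leb) = - (\<integral>x. ?\<phi>' x * \<psi> x \<partial>leb)"
        using int[OF L2_continuous L2_continuous] c\<phi> c\<psi> by (simp del: nderiv.simps add: add_eq_0_iff2)
      have "L2_inner ?w (nderiv UNIV 1 \<psi>) = (\<integral>x. u x * ?\<psi>' x - \<phi> x * ?\<psi>' x \<partial>leb)"
        by (simp add: L2_inner_def left_diff_distrib)
      also have "\<dots> = (\<integral>x. u x * ?\<psi>' x \<partial>leb) - (\<integral>x. \<phi> x * ?\<psi>' x \<partial>leb)"
        by (intro Bochner_Integration.integral_diff int uL L2_continuous c\<phi> c\<psi>)
      also have "\<dots> = - ((\<integral>x. weak_deriv 1 u x * \<psi> x \<partial>leb) - (\<integral>x. ?\<phi>' x * \<psi> x \<partial>leb))"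
        using 1 2 by (simp del: nderiv.simps)
      also have "(\<integral>x. weak_deriv 1 u x * \<psi> x \<partial>leb) - (\<integral>x. ?\<phi>' x * \<psi> x \<partial>leb) =
          (\<integral>x. weak_deriv 1 u x * \<psi> x - ?\<phi>' x * \<psi> x \<partial>leb)"
        by (intro Bochner_Integration.integral_diff[symmetric] int[OF w1L L2_continuous[OF c\<psi>(1)]]
            int[OF L2_continuous[OF c\<phi>(2)] L2_continuous[OF c\<psi>(1)]])
      finally show "L2_inner ?w (nderiv UNIV 1 \<psi>) = (- 1) ^ 1 * L2_inner (\<lambda>x. weak_deriv 1 u x - ?\<phi>' x) \<psi>"
        unfolding L2_inner_def by (simp only: left_diff_distrib power_one_right mult_minus1)
    qed
    have "(\<lambda>x. weak_deriv 1 u x - ?\<phi>' x) \<in> L2"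
      by (rule L2_diff[OF w1L L2_continuous[OF c\<phi>(2)]])
    then have wH: "?w \<in> Hk 1"
      unfolding Hk_def using wL weak1 is_weak_deriv_0[of ?w] by (auto simp: le_Suc_eq simp del: nderiv.simps)
    obtain c' where c': "AE x in leb. weak_deriv 0 ?w x = c' + prim (weak_deriv 1 ?w) x"
      using Hk_prim[OF wH, of 0] by auto
    have ae': "AE x in leb. U x - \<phi> x = c' + prim (weak_deriv 1 ?w) x"
      using c' weak_deriv_0_AE[OF wH] ae by eventually_elim simp
    have d1: "weak_deriv 1 ?w \<in> L2" using Hk_weak_deriv(1)[OF wH, of 1] by simp
    have cU: "continuous_on {0..1} U"
      using prim_continuous[OF g] by (subst continuous_on_cong[OF refl U]) (auto intro!: continuous_intros)
    have "U y - \<phi> y = c' + prim (weak_deriv 1 ?w) y" if "y \<in> {0..1}" for y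
      by (rule continuous_AE_eq[OF _ _ ae' that]) (intro continuous_intros cU c\<phi> prim_continuous L2_integrable d1)+
    moreover have "AE x in leb. weak_deriv 0 ?w x = U x - \<phi> x"
      using weak_deriv_0_AE[OF wH] ae by eventually_elim simp
    ultimately have "\<bar>U x - \<phi> x\<bar> \<le> L2_norm (weak_deriv 0 ?w) + L2_norm (weak_deriv 1 ?w)"
      using Hk_weak_deriv(1)[OF wH, of 0] x by (intro prim_plus_const_le[OF _ d1]) auto
    then have "\<bar>U x - \<phi> x\<bar> \<le> 2 * \<epsilon>"
      using L2_norm_weak_deriv_le[of 0 1 ?w] L2_norm_weak_deriv_le[of 1 1 ?w] small by linarith
    moreover have "\<phi> x = 0" using x test_vanish[OF \<phi>] by auto
    ultimately show ?thesis by simp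
  qed
  from this[of "\<bar>U x\<bar> / 4"] show ?thesis by (cases "U x = 0") auto
qed

section \<open>The bilinear form in scaled coordinates\<close>

text \<open>In scaled coordinates the power e^(\<beta>-3) of the weight, the Jacobian e, the factor
  |e t|^(-\<beta>) and the product (e t)^2 of the denominators of two difference quotients combine
  to |t|^(2-\<beta>): all powers of e cancel.\<close>

definition kernel_weight :: "real \<Rightarrow> real \<Rightarrow> real" where
  "kernel_weight \<beta> t = indicator {-1<..<1} t * (C_beta \<beta> * \<bar>t\<bar> powr (2 - \<beta>))"

definition kernel_measure :: "real \<Rightarrow> real measure" where
  "kernel_measure \<beta> = density lborel (\<lambda>t. ennreal (kernel_weight \<beta> t))"

lemma space_kernel_measure [simp]: "space (kernel_measure \<beta>) = UNIV"
  and sets_kernel_measure [measurable_cong, simp]: "sets (kernel_measure \<beta>) = sets borel"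
  by (simp_all add: kernel_measure_def)

lemma kernel_weight_measurable [measurable]: "kernel_weight \<beta> \<in> borel_measurable borel"
  unfolding kernel_weight_def by measurable

lemma kernel_weight_nonneg: "\<beta> < 3 \<Longrightarrow> 0 \<le> kernel_weight \<beta> t"
  by (simp add: kernel_weight_def C_beta_def)

lemma kernel_weight_minus: "kernel_weight \<beta> (- t) = kernel_weight \<beta> t"
  by (auto simp: kernel_weight_def indicator_def)

lemma integral_kernel_measure:
  fixes f :: "real \<Rightarrow> real"
  assumes "\<beta> < 3" "f \<in> borel_measurable borel"
  shows "(\<integral>t. f t \<partial>kernel_measure \<beta>) = (\<integral>t. kernel_weight \<beta> t * f t \<partial>lborel)"
  unfolding kernel_measure_def using assms by (subst integral_density) (auto simp: kernel_weight_nonneg)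

lemma integral_kernel_measure_minus:
  fixes f :: "real \<Rightarrow> real"
  assumes "\<beta> < 3" "f \<in> borel_measurable borel"
  shows "(\<integral>t. f (- t) \<partial>kernel_measure \<beta>) = (\<integral>t. f t \<partial>kernel_measure \<beta>)"
proof -
  have "(\<integral>t. kernel_weight \<beta> t * f t \<partial>lborel) = (\<integral>t. kernel_weight \<beta> (- t) * f (- t) \<partial>lborel)"
    using lborel_integral_real_affine[of "-1" "\<lambda>t. kernel_weight \<beta> t * f t" 0] by simp
  then show ?thesis
    using assms integral_kernel_measure[of \<beta> f] integral_kernel_measure[of \<beta> "\<lambda>t. f (- t)"]
    by (simp add: kernel_weight_minus)
qed

lemma nn_integral_abs_powr:
  assumes a: "-1 < a"
  shows "(\<integral>\<^sup>+t. ennreal (\<bar>t\<bar> powr a) * indicator {-1<..<1} t \<partial>lborel) = ennreal (2 / (a + 1))"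
proof -
  have "((\<lambda>t. t powr a) has_integral 1 / (a + 1)) {0..1}"
    using has_integral_powr_from_0[OF a, of 1] by simp
  then have p: "((\<lambda>t. \<bar>t\<bar> powr a) has_integral 1 / (a + 1)) {0..1}"
    by (rule has_integral_cong[THEN iffD1, rotated]) simp
  then have n: "((\<lambda>t. \<bar>t\<bar> powr a) has_integral 1 / (a + 1)) {-1..0}"
    using has_integral_reflect_real[of "\<lambda>t. \<bar>t\<bar> powr a" "1 / (a + 1)" 1 0] by simp
  have "((\<lambda>t. \<bar>t\<bar> powr a) has_integral 1 / (a + 1) + 1 / (a + 1)) {-1..1}"
    by (rule has_integral_combine[OF _ _ n p]) auto
  then have "((\<lambda>t. \<bar>t\<bar> powr a) has_integral 2 / (a + 1)) {-1<..<1}"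
    by (simp add: has_integral_Icc_iff_Ioo)
  then show ?thesis by (intro nn_integral_has_integral_lebesgue') auto
qed

text \<open>The integral of |t|^(2-\<beta>) over (-1,1) is 2/(3-\<beta>), the reciprocal of
  \<open>C_beta \<beta>\<close>.\<close>

lemma emeasure_kernel_measure:
  assumes "0 < \<beta>" "\<beta> < 3"
  shows "emeasure (kernel_measure \<beta>) UNIV = 1"
proof -
  have "emeasure (kernel_measure \<beta>) UNIV = (\<integral>\<^sup>+t. ennreal (kernel_weight \<beta> t) \<partial>lborel)"
    by (simp add: kernel_measure_def emeasure_density)
  also have "\<dots> = (\<integral>\<^sup>+t. ennreal (C_beta \<beta>) * (ennreal (\<bar>t\<bar> powr (2 - \<beta>)) * indicator {-1<..<1} t) \<partial>lborel)"
    using assms by (intro nn_integral_cong) (auto simp: kernel_weight_def C_beta_def indicator_def simp flip: ennreal_mult)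
  also have "\<dots> = ennreal (C_beta \<beta>) * ennreal (2 / (3 - \<beta>))"
    using nn_integral_abs_powr[of "2 - \<beta>"] assms by (subst nn_integral_cmult) auto
  also have "\<dots> = 1"
    using assms by (simp add: C_beta_def ennreal_mult[symmetric])
  finally show ?thesis .
qed

text \<open>At \<open>t = 0\<close> the quotient is 0 by the division convention; this point is null
  for \<open>kernel_measure\<close>.\<close>

definition diff_quot :: "(real \<Rightarrow> real) \<Rightarrow> (real \<Rightarrow> real) \<Rightarrow> real \<Rightarrow> real \<Rightarrow> real" where
  "diff_quot e u x t = (u (x + e x * t) - u x) / (e x * t)"

text \<open>Substituting \<open>y = x + e x * t\<close> turns the weighted window around \<open>x\<close> into a fixed probability
  measure in \<open>t\<close>.\<close>

lemma window_integral:
  assumes \<beta>: "0 < \<beta>" "\<beta> < 3" and r: "0 < r" "r \<le> x" "r \<le> 1 - x"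
    and u: "u \<in> borel_measurable leb" and v: "v \<in> borel_measurable leb"
    and U: "continuous_on UNIV U" and V: "continuous_on UNIV V"
    and uU: "AE y in leb. u y = U y" "u x = U x" and vV: "AE y in leb. v y = V y" "v x = V x"
    and e: "e x = r" and w: "w = C_beta \<beta> * r powr (- (3 - \<beta>))"
  shows "(\<integral>y. w * indicator {z. \<bar>z - x\<bar> < r} y * ((u x - u y) * (v x - v y) / \<bar>x - y\<bar> powr \<beta>) \<partial>leb)
    = (\<integral>t. diff_quot e U x t * diff_quot e V x t \<partial>kernel_measure \<beta>)"
proof -
  have [measurable]: "U \<in> borel_measurable borel" "V \<in> borel_measurable borel"
    using U V by (auto intro: borel_measurable_continuous_onI)
  define G where "G y = w * indicator {z. \<bar>z - x\<bar> < r} y * ((U x - U y) * (V x - V y) / \<bar>x - y\<bar> powr \<beta>)" for y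
  have Gm [measurable]: "G \<in> borel_measurable borel" unfolding G_def by measurable
  have [measurable]: "u \<in> borel_measurable leb" "v \<in> borel_measurable leb" by fact+
  have Gleb: "G \<in> borel_measurable leb"
    by (rule measurable_compose[OF measurable_ident_leb Gm])
  have "(\<integral>y. w * indicator {z. \<bar>z - x\<bar> < r} y * ((u x - u y) * (v x - v y) / \<bar>x - y\<bar> powr \<beta>) \<partial>leb) = (\<integral>y. G y \<partial>leb)"
  proof (rule integral_cong_AE)
    show "AE y in leb. w * indicator {z. \<bar>z - x\<bar> < r} y * ((u x - u y) * (v x - v y) / \<bar>x - y\<bar> powr \<beta>) = G y"
      using uU(1) vV(1) by eventually_elim (simp add: G_def uU(2) vV(2))
    have [measurable]: "{z. \<bar>z - x\<bar> < r} \<in> sets borel" by measurable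
    have "(\<lambda>y. indicat_real {z. \<bar>z - x\<bar> < r} y) \<in> borel_measurable leb"
      by (rule measurable_compose[OF measurable_ident_leb borel_measurable_indicator]) simp
    then show "(\<lambda>y. w * indicator {z. \<bar>z - x\<bar> < r} y * ((u x - u y) * (v x - v y) / \<bar>x - y\<bar> powr \<beta>)) \<in> borel_measurable leb"
      by measurable
  qed (rule Gleb)
  also have "\<dots> = (\<integral>y. indicator Om y *\<^sub>R G y \<partial>lebesgue)"
    by (simp add: integral_restrict_space)
  also have "\<dots> = (\<integral>y. G y \<partial>lebesgue)"
    using r by (intro Bochner_Integration.integral_cong) (auto simp: G_def indicator_def)
  also have "\<dots> = (\<integral>y. G y \<partial>lborel)"
    by (rule integral_completion) simp
  also have "\<dots> = r * (\<integral>t. G (x + r * t) \<partial>lborel)"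
    using lborel_integral_real_affine[of r G x] r by simp
  also have "\<dots> = (\<integral>t. r * G (x + r * t) \<partial>lborel)" by simp
  also have "\<dots> = (\<integral>t. kernel_weight \<beta> t * (diff_quot e U x t * diff_quot e V x t) \<partial>lborel)"
  proof (intro Bochner_Integration.integral_cong refl)
    fix t
    show "r * G (x + r * t) = kernel_weight \<beta> t * (diff_quot e U x t * diff_quot e V x t)"
    proof (cases "\<bar>t\<bar> < 1 \<and> t \<noteq> 0")
      case False
      then have "t = 0 \<or> \<not> \<bar>r * t\<bar> < r" using r by (auto simp: abs_mult)
      then show ?thesis using False by (auto simp: G_def kernel_weight_def diff_quot_def indicator_def)
    next
      case True
      then have a: "\<bar>r * t\<bar> < r" "t \<in> {-1<..<1}" using r by (auto simp: abs_mult)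
      let ?A = "U x - U (x + r * t)" and ?B = "V x - V (x + r * t)"
      have t2: "t\<^sup>2 = \<bar>t\<bar> powr 2" by (simp add: powr_numeral True)
      have p1: "r * r powr (- (3 - \<beta>)) * (r * r) = r powr \<beta>"
      proof -
        have "r * (r * r) = r powr 3" using r by (simp add: powr_numeral power3_eq_cube)
        then have "r * r powr (- (3 - \<beta>)) * (r * r) = r powr 3 * r powr (- (3 - \<beta>))" by (simp add: ac_simps)
        also have "\<dots> = r powr \<beta>" by (simp add: powr_add[symmetric])
        finally show ?thesis .
      qed
      have p2: "\<bar>t\<bar> powr (2 - \<beta>) * \<bar>t\<bar> powr \<beta> = t * t"
        using True by (simp add: powr_add[symmetric] powr_numeral power2_eq_square)
      have rt: "\<bar>r * t\<bar> powr \<beta> = r powr \<beta> * \<bar>t\<bar> powr \<beta>"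
        using r by (simp add: abs_mult powr_mult)
      have pos: "0 < r powr \<beta>" "0 < \<bar>t\<bar> powr \<beta>" using r True by auto
      have L: "r * G (x + r * t) = C_beta \<beta> * ?A * ?B * (r * r powr (- (3 - \<beta>)) / (r powr \<beta> * \<bar>t\<bar> powr \<beta>))"
        using a by (simp add: G_def w rt)
      have R: "kernel_weight \<beta> t * (diff_quot e U x t * diff_quot e V x t)
          = C_beta \<beta> * ?A * ?B * (\<bar>t\<bar> powr (2 - \<beta>) / (r * r * (t * t)))"
        using a by (simp add: kernel_weight_def diff_quot_def e field_simps)
      have "r * r powr (- (3 - \<beta>)) / (r powr \<beta> * \<bar>t\<bar> powr \<beta>) = \<bar>t\<bar> powr (2 - \<beta>) / (r * r * (t * t))"
        using r True pos p1 p2 by (simp add: divide_eq_eq eq_divide_eq ac_simps)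
      then show ?thesis using L R by simp
    qed
  qed
  also have "\<dots> = (\<integral>t. diff_quot e U x t * diff_quot e V x t \<partial>kernel_measure \<beta>)"
    unfolding diff_quot_def using \<beta> by (intro integral_kernel_measure[symmetric]) auto
  finally show ?thesis .
qed

text \<open>The form does not see null sets, so \<open>u\<close> and \<open>v\<close> may be
  replaced by globally continuous functions. The inner integrals agree at every x where the values
  agree too, hence almost everywhere; measurability of the original inner integral is inferred from
  that, by completeness of Lebesgue measure.\<close>

lemma B_delta_eq:
  assumes \<beta>: "0 < \<beta>" "\<beta> < 3"
    and r: "\<And>x. x \<in> Om \<Longrightarrow> 0 < eta_delta q lam \<delta> x \<and> eta_delta q lam \<delta> x \<le> x \<and> eta_delta q lam \<delta> x \<le> 1 - x"
    and em: "eta_delta q lam \<delta> \<in> borel_measurable leb"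
    and u: "u \<in> borel_measurable leb" and v: "v \<in> borel_measurable leb"
    and U: "continuous_on UNIV U" and V: "continuous_on UNIV V"
    and uU: "AE y in leb. u y = U y" and vV: "AE y in leb. v y = V y"
  shows "B_delta \<beta> q lam \<delta> u v =
    (\<integral>x. (\<integral>t. diff_quot (eta_delta q lam \<delta>) U x t * diff_quot (eta_delta q lam \<delta>) V x t \<partial>kernel_measure \<beta>) \<partial>leb)"
proof -
  let ?e = "eta_delta q lam \<delta>"
  let ?L = "\<lambda>x. \<integral>y. w_delta \<beta> q lam \<delta> x * indicator {z. \<bar>z - x\<bar> < ?e x} y *
              ((u x - u y) * (v x - v y) / \<bar>x - y\<bar> powr \<beta>) \<partial>leb"
  let ?R = "\<lambda>x. \<integral>t. diff_quot ?e U x t * diff_quot ?e V x t \<partial>kernel_measure \<beta>"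
  have [measurable]: "U \<in> borel_measurable borel" "V \<in> borel_measurable borel" "?e \<in> borel_measurable leb"
    using U V em by (auto intro: borel_measurable_continuous_onI)
  interpret mu: finite_measure "kernel_measure \<beta>"
    by (rule finite_measureI) (simp add: emeasure_kernel_measure \<beta>)
  have Rm: "?R \<in> borel_measurable leb" unfolding diff_quot_def by measurable
  have ae: "AE x in leb. ?L x = ?R x"
    using uU vV AE_space
  proof eventually_elim
    case (elim x)
    then show ?case using r[of x] by (intro window_integral \<beta> u v U V uU vV) (auto simp: w_delta_def)
  qed
  have Lm: "?L \<in> borel_measurable leb"
  proof -
    have "AE x in lebesgue. indicator Om x * ?R x = indicator Om x * ?L x"
      using ae by (simp add: AE_restrict_space_iff) (erule eventually_mono, auto simp: indicator_def)
    moreover have "(\<lambda>x. indicator Om x * ?R x) \<in> borel_measurable lebesgue"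
      using Rm by (subst (asm) borel_measurable_restrict_space_iff) (simp_all add: mult.commute)
    ultimately have "(\<lambda>x. indicator Om x * ?L x) \<in> borel_measurable lebesgue"
      by (rule borel_measurable_AE[rotated])
    then show ?thesis
      by (subst borel_measurable_restrict_space_iff) (simp_all add: mult.commute)
  qed
  show ?thesis unfolding B_delta_def by (rule integral_cong_AE[OF Lm Rm ae])
qed

section \<open>Lipschitz functions and Bernstein polynomials\<close>

text \<open>Continuity on the whole line serves the measurability of compositions. The Lipschitz
  bound is restricted to [0,1] because the approximating polynomials are in general not Lipschitz on
  the line.\<close>

definition lip :: "real \<Rightarrow> (real \<Rightarrow> real) \<Rightarrow> bool" where
  "lip L u \<longleftrightarrow> continuous_on UNIV u \<and> (\<forall>x\<in>{0..1}. \<forall>y\<in>{0..1}. \<bar>u x - u y\<bar> \<le> L * \<bar>x - y\<bar>)"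

lemma lip_nonneg: "lip L u \<Longrightarrow> 0 \<le> L"
proof -
  assume "lip L u"
  then have "\<bar>u 0 - u 1\<bar> \<le> L * \<bar>0 - 1\<bar>" unfolding lip_def by (metis atLeastAtMost_iff zero_le_one order_refl)
  then show ?thesis by simp
qed

lemma lip_diff: "lip K u \<Longrightarrow> lip L v \<Longrightarrow> lip (K + L) (\<lambda>x. u x - v x)"
  unfolding lip_def
proof (intro conjI ballI)
  fix x y :: real
  assume a: "continuous_on UNIV u \<and> (\<forall>x\<in>{0..1}. \<forall>y\<in>{0..1}. \<bar>u x - u y\<bar> \<le> K * \<bar>x - y\<bar>)"
    "continuous_on UNIV v \<and> (\<forall>x\<in>{0..1}. \<forall>y\<in>{0..1}. \<bar>v x - v y\<bar> \<le> L * \<bar>x - y\<bar>)" "x \<in> {0..1}" "y \<in> {0..1}"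
  then have "\<bar>u x - u y\<bar> \<le> K * \<bar>x - y\<bar>" "\<bar>v x - v y\<bar> \<le> L * \<bar>x - y\<bar>" by blast+
  then show "\<bar>u x - v x - (u y - v y)\<bar> \<le> (K + L) * \<bar>x - y\<bar>" unfolding distrib_right by linarith
qed (auto intro: continuous_intros)

lemma lip_L2: "lip L u \<Longrightarrow> u \<in> L2"
  unfolding lip_def using L2_continuous continuous_on_subset by blast

section \<open>Bernstein polynomials of Lipschitz functions\<close>

lemma DERIV_Bernstein_Suc:
  "(Bernstein (Suc m) k has_real_derivative
     real (Suc m) * ((if k = 0 then 0 else Bernstein m (k - 1) x) - Bernstein m k x)) (at x)"
proof -
  have d: "(Bernstein (Suc m) k has_real_derivative
      real (Suc m choose k) * (real k * x ^ (k - 1) * (1 - x) ^ (Suc m - k) -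
        x ^ k * (real (Suc m - k) * (1 - x) ^ (Suc m - k - 1)))) (at x)"
    unfolding Bernstein_def[abs_def] by (auto intro!: derivative_eq_intros simp: algebra_simps)
  have a: "real (Suc m choose k) * real k = real (Suc m) * (if k = 0 then 0 else real (m choose (k - 1)))"
  proof (cases k)
    case (Suc j)
    have "real ((Suc m choose Suc j) * Suc j) = real (Suc m * (m choose j))"
      by (simp only: Suc_times_binomial_eq)
    then show ?thesis unfolding Suc of_nat_mult by simp
  qed simp
  have b: "real (Suc m choose k) * real (Suc m - k) = real (Suc m) * real (m choose k)"
  proof -
    have "(Suc m choose k) * (Suc m - k) = Suc m * (m choose k)"
      using binomial_absorb_comp[of "Suc m" k] by (metis diff_Suc_1 mult.commute)
    then show ?thesis by (simp only: of_nat_mult[symmetric])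
  qed
  have "real (Suc m choose k) * (real k * x ^ (k - 1) * (1 - x) ^ (Suc m - k) -
        x ^ k * (real (Suc m - k) * (1 - x) ^ (Suc m - k - 1)))
      = (real (Suc m choose k) * real k) * x ^ (k - 1) * (1 - x) ^ (Suc m - k)
        - (real (Suc m choose k) * real (Suc m - k)) * x ^ k * (1 - x) ^ (Suc m - k - 1)"
    by (simp add: algebra_simps)
  also have "\<dots> = real (Suc m) * ((if k = 0 then 0 else Bernstein m (k - 1) x) - Bernstein m k x)"
    unfolding a b by (cases k) (simp_all add: Bernstein_def algebra_simps)
  finally show ?thesis using d by simp
qed

text \<open>Summation by parts. For coefficients sampled from a Lipschitz function, the degree times
  a forward difference is a difference quotient, hence bounded by the Lipschitz constant.\<close>

lemma DERIV_Bernstein_sum: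
  "((\<lambda>x. \<Sum>k\<le>Suc m. c k * Bernstein (Suc m) k x) has_real_derivative
     real (Suc m) * (\<Sum>k\<le>m. (c (Suc k) - c k) * Bernstein m k x)) (at x)"
proof -
  let ?B = "\<lambda>k. if k = 0 then 0 else Bernstein m (k - 1) x"
  have "((\<lambda>x. \<Sum>k\<le>Suc m. c k * Bernstein (Suc m) k x) has_real_derivative
     (\<Sum>k\<le>Suc m. c k * (real (Suc m) * (?B k - Bernstein m k x)))) (at x)"
    by (intro DERIV_sum DERIV_cmult DERIV_Bernstein_Suc)
  also have "(\<Sum>k\<le>Suc m. c k * (real (Suc m) * (?B k - Bernstein m k x)))
      = real (Suc m) * ((\<Sum>k\<le>Suc m. c k * ?B k) - (\<Sum>k\<le>Suc m. c k * Bernstein m k x))"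
    unfolding sum_subtractf[symmetric] sum_distrib_left by (intro sum.cong) (auto simp: algebra_simps)
  also have "(\<Sum>k\<le>Suc m. c k * ?B k) = (\<Sum>k\<le>m. c (Suc k) * Bernstein m k x)"
    by (subst sum.atMost_Suc_shift) simp
  also have "(\<Sum>k\<le>Suc m. c k * Bernstein m k x) = (\<Sum>k\<le>m. c k * Bernstein m k x)"
    by (simp add: Bernstein_def binomial_eq_0)
  also have "(\<Sum>k\<le>m. c (Suc k) * Bernstein m k x) - (\<Sum>k\<le>m. c k * Bernstein m k x)
      = (\<Sum>k\<le>m. (c (Suc k) - c k) * Bernstein m k x)"
    by (simp add: sum_subtractf left_diff_distrib)
  finally show ?thesis .
qed

text \<open>On [0,1] the derivative of a Bernstein polynomial is a convex combination of difference
  quotients of \<open>v\<close>, hence bounded by \<open>L\<close>; the end values are the extreme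
  coefficients. Degree n + 1 avoids the nodes k/0 and fits the derivative formula.\<close>

lemma smooth_lip_approximation:
  assumes v: "lip L v"
  obtains w w' w'' :: "nat \<Rightarrow> real \<Rightarrow> real" where
    "\<And>n x. (w n has_real_derivative w' n x) (at x)" "\<And>n x. (w' n has_real_derivative w'' n x) (at x)"
    "\<And>n. continuous_on UNIV (w'' n)" "\<And>n. lip L (w n)"
    "\<And>n. w n 0 = v 0" "\<And>n. w n 1 = v 1" "\<And>x. x \<in> {0..1} \<Longrightarrow> (\<lambda>n. w n x) \<longlonglongrightarrow> v x"
proof -
  define w where "w n x = (\<Sum>k\<le>Suc n. v (real k / real (Suc n)) * Bernstein (Suc n) k x)" for n x
  have cv: "continuous_on UNIV v" and lv: "\<And>x y. x \<in> {0..1} \<Longrightarrow> y \<in> {0..1} \<Longrightarrow> \<bar>v x - v y\<bar> \<le> L * \<bar>x - y\<bar>"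
    using v by (auto simp: lip_def)
  have poly: "real_polynomial_function (w n)" for n
    unfolding w_def Bernstein_def
    by (intro real_polynomial_function_sum real_polynomial_function.intros real_polynomial_function_power
        real_polynomial_function_diff bounded_linear_ident) auto
  obtain w' where w': "\<And>n. real_polynomial_function (w' n)" "\<And>n x. (w n has_real_derivative w' n x) (at x)"
    using has_real_derivative_polynomial_function[OF poly] by metis
  obtain w'' where w'': "\<And>n. real_polynomial_function (w'' n)" "\<And>n x. (w' n has_real_derivative w'' n x) (at x)"
    using has_real_derivative_polynomial_function[OF w'(1)] by metis
  have cw: "continuous_on UNIV (w n)" for n
    using w'(2) by (meson DERIV_isCont continuous_at_imp_continuous_on)
  have bound: "\<bar>w' n x\<bar> \<le> L" if x: "x \<in> {0..1}" for n x
  proof -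
    have "w' n x = real (Suc n) * (\<Sum>k\<le>n. (v (real (Suc k) / real (Suc n)) - v (real k / real (Suc n))) * Bernstein n k x)"
      using DERIV_unique[OF w'(2)[of n x]] DERIV_Bernstein_sum[where m = n and c = "\<lambda>k. v (real k / real (Suc n))"]
      unfolding w_def[abs_def] by blast
    also have "\<bar>\<dots>\<bar> \<le> real (Suc n) * (\<Sum>k\<le>n. (L / real (Suc n)) * Bernstein n k x)"
      unfolding abs_mult abs_of_nat
    proof (intro mult_left_mono order_trans[OF sum_abs] sum_mono)
      fix k assume k: "k \<in> {..n}"
      have "\<bar>v (real (Suc k) / real (Suc n)) - v (real k / real (Suc n))\<bar>
          \<le> L * \<bar>real (Suc k) / real (Suc n) - real k / real (Suc n)\<bar>"
        using k by (intro lv) auto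
      also have "real (Suc k) / real (Suc n) - real k / real (Suc n) = 1 / real (Suc n)"
        by (simp add: diff_divide_distrib[symmetric])
      finally show "\<bar>(v (real (Suc k) / real (Suc n)) - v (real k / real (Suc n))) * Bernstein n k x\<bar>
          \<le> L / real (Suc n) * Bernstein n k x"
        unfolding abs_mult using x Bernstein_nonneg[of x n k]
        by (intro mult_mono) (simp_all del: of_nat_Suc)
    qed auto
    also have "\<dots> = L" by (simp only: sum_distrib_left[symmetric] sum_Bernstein) simp
    finally show ?thesis .
  qed
  have lipw: "lip L (w n)" for n
    unfolding lip_def
  proof (intro conjI ballI cw)
    fix x y :: real assume xy: "x \<in> {0..1}" "y \<in> {0..1}"
    have "norm (w n x - w n y) \<le> L * norm (x - y)"
      by (rule field_differentiable_bound[of "{0..1}" "w n" "w' n"])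
         (use xy bound w'(2) in \<open>auto intro: has_field_derivative_at_within\<close>)
    then show "\<bar>w n x - w n y\<bar> \<le> L * \<bar>x - y\<bar>" by simp
  qed
  have w0: "w n 0 = v 0" for n
  proof -
    have "w n 0 = (\<Sum>k\<le>Suc n. if k = 0 then v 0 else 0)"
      unfolding w_def by (intro sum.cong) (auto simp: Bernstein_def)
    then show ?thesis by simp
  qed
  have w1: "w n 1 = v 1" for n
  proof -
    have "w n 1 = (\<Sum>k\<le>Suc n. if k = Suc n then v 1 else 0)"
      unfolding w_def by (intro sum.cong) (auto simp: Bernstein_def)
    then show ?thesis by (simp del: sum.atMost_Suc)
  qed
  have lim: "(\<lambda>n. w n x) \<longlonglongrightarrow> v x" if x: "x \<in> {0..1}" for x
  proof (rule LIMSEQ_I)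
    fix r :: real assume "0 < r"
    then obtain N where N: "\<And>n x. N \<le> n \<Longrightarrow> x \<in> {0..1} \<Longrightarrow>
        \<bar>v x - (\<Sum>k\<le>n. v (real k / real n) * Bernstein n k x)\<bar> < r"
      using Bernstein_Weierstrass[of v r] continuous_on_subset[OF cv] by blast
    have "norm (w n x - v x) < r" if "N \<le> n" for n
      using N[of "Suc n" x] that x unfolding w_def by (simp add: abs_minus_commute del: sum.atMost_Suc)
    then show "\<exists>no. \<forall>n\<ge>no. norm (w n x - v x) < r" by blast
  qed
  have "continuous_on UNIV (w'' n)" for n
    using w''(1) continuous_polymonial_function[of "w'' n"]
    by (simp add: real_polynomial_function_eq continuous_at_imp_continuous_on)
  then show ?thesis using that[of w w' w''] w' w'' lipw w0 w1 lim by blast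
qed

section \<open>The form on Lipschitz functions\<close>

text \<open>A continuous radius whose windows stay in [0,1] suffices for boundedness and limits of
  the form on Lipschitz functions; differentiability of the radius enters in the later
  locales.\<close>

locale window =
  fixes \<beta> :: real and e :: "real \<Rightarrow> real"
  assumes beta: "0 < \<beta>" "\<beta> < 3"
    and e_cont: "continuous_on {0..1} e" and e_0: "e 0 = 0" and e_1: "e 1 = 0"
    and e_pos: "\<And>x. x \<in> Om \<Longrightarrow> 0 < e x"
    and e_le: "\<And>x. x \<in> Om \<Longrightarrow> e x \<le> x" "\<And>x. x \<in> Om \<Longrightarrow> e x \<le> 1 - x"
begin

abbreviation "mu \<equiv> kernel_measure \<beta>"
abbreviation "M \<equiv> leb \<Otimes>\<^sub>M kernel_measure \<beta>"

definition dq :: "(real \<Rightarrow> real) \<Rightarrow> real \<times> real \<Rightarrow> real" where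
  "dq u p = diff_quot e u (fst p) (snd p)"

definition form :: "(real \<Rightarrow> real) \<Rightarrow> (real \<Rightarrow> real) \<Rightarrow> real" where
  "form u v = (\<integral>p. dq u p * dq v p \<partial>M)"

sublocale mu: finite_measure mu
  by (rule finite_measureI) (simp add: emeasure_kernel_measure beta)

sublocale pair_sigma_finite leb mu ..

sublocale M: finite_measure M
  by (rule finite_measure_pair_measure) unfold_locales

lemma e_meas [measurable]: "e \<in> borel_measurable leb"
  by (rule borel_measurable_leb_continuous[OF continuous_on_subset[OF e_cont]]) auto

lemma window_mem:
  assumes "x \<in> Om" "\<bar>t\<bar> \<le> 1"
  shows "x + e x * t \<in> {0..1}"
proof -
  have "\<bar>e x * t\<bar> \<le> e x * 1"
    unfolding abs_mult using assms e_pos[OF assms(1)] by (intro mult_mono) auto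
  then show ?thesis using e_le[OF assms(1)] by auto
qed

lemma AE_mu: "AE t in mu. \<bar>t\<bar> < 1 \<and> t \<noteq> 0"
  unfolding kernel_measure_def by (auto simp: AE_density kernel_weight_def indicator_def)

lemma integral_mu_const [simp]: "(\<integral>t. c \<partial>mu) = (c::real)"
  using emeasure_kernel_measure[OF beta] by (simp add: measure_def)

lemma dq_meas:
  assumes "continuous_on UNIV u"
  shows "dq u \<in> borel_measurable M"
proof -
  have [measurable]: "u \<in> borel_measurable borel" using assms by (rule borel_measurable_continuous_onI)
  have [measurable]: "(\<lambda>p. fst p) \<in> borel_measurable M" "(\<lambda>p. e (fst p)) \<in> borel_measurable M" by measurable
  have [measurable]: "(\<lambda>p. snd p) \<in> borel_measurable M" by measurable
  show ?thesis unfolding dq_def[abs_def] diff_quot_def by measurable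
qed

lemma diff_quot_le:
  assumes "lip L u" "x \<in> Om" "\<bar>t\<bar> \<le> 1"
  shows "\<bar>diff_quot e u x t\<bar> \<le> L"
proof (cases "t = 0")
  case True
  then show ?thesis using lip_nonneg[OF assms(1)] by (simp add: diff_quot_def)
next
  case False
  have "\<bar>u (x + e x * t) - u x\<bar> \<le> L * \<bar>(x + e x * t) - x\<bar>"
    using assms(1) window_mem[OF assms(2,3)] assms(2) unfolding lip_def
    by (metis atLeastAtMost_iff greaterThanLessThan_iff less_imp_le)
  then show ?thesis using False e_pos[OF assms(2)]
    by (simp add: diff_quot_def abs_mult divide_le_eq)
qed

lemma AE_M: "AE p in M. \<bar>snd p\<bar> < 1 \<and> snd p \<noteq> 0"
proof (rule AE_pair_measure)
  have [measurable]: "(\<lambda>p. snd p) \<in> borel_measurable M" by measurable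
  show "{p \<in> space M. \<bar>snd p\<bar> < 1 \<and> snd p \<noteq> 0} \<in> sets M" by measurable
  show "AE x in leb. AE y in mu. \<bar>snd (x, y)\<bar> < 1 \<and> snd (x, y) \<noteq> 0" using AE_mu by simp
qed

lemma AE_dq_le: "lip L u \<Longrightarrow> AE p in M. \<bar>dq u p\<bar> \<le> L"
  using AE_M AE_space by eventually_elim (auto simp: dq_def space_pair_measure intro: diff_quot_le)

lemma lip_cont: "lip L u \<Longrightarrow> continuous_on UNIV u"
  by (simp add: lip_def)

lemma dq_mult_integrable:
  assumes "F \<in> borel_measurable M" "AE p in M. \<bar>F p\<bar> \<le> K" "lip L v"
  shows "integrable M (\<lambda>p. F p * dq v p)"
proof (rule M.integrable_const_bound)
  show "AE p in M. norm (F p * dq v p) \<le> K * L"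
    using assms(2) AE_dq_le[OF assms(3)]
  proof eventually_elim
    case (elim p)
    then show ?case unfolding real_norm_def abs_mult by (intro mult_mono) auto
  qed
  show "(\<lambda>p. F p * dq v p) \<in> borel_measurable M"
    using assms dq_meas lip_cont by (intro borel_measurable_times) auto
qed

lemma dq_integrable: "lip K u \<Longrightarrow> lip L v \<Longrightarrow> integrable M (\<lambda>p. dq u p * dq v p)"
  by (intro dq_mult_integrable dq_meas AE_dq_le lip_cont)

lemma dq_diff: "dq (\<lambda>x. u x - v x) p = dq u p - dq v p"
  unfolding dq_def diff_quot_def by (simp add: diff_divide_distrib[symmetric] algebra_simps)

lemma form_diff_left:
  assumes "lip K u" "lip L v" "lip N w"
  shows "form (\<lambda>x. u x - v x) w = form u w - form v w"
  unfolding form_def dq_diff left_diff_distrib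
  by (intro Bochner_Integration.integral_diff dq_integrable[OF assms(1,3)] dq_integrable[OF assms(2,3)])

lemma form_nonneg: "0 \<le> form u u"
  by (simp add: form_def)

lemma measure_M [simp]: "measure M (space M) = 1"
proof -
  have "emeasure M (Om \<times> UNIV) = emeasure leb Om * emeasure mu UNIV"
    by (rule mu.emeasure_pair_measure_Times) (auto simp: sets_restrict_space)
  then show ?thesis
    by (simp add: space_pair_measure measure_def emeasure_kernel_measure[OF beta] emeasure_restrict_space)
qed

text \<open>Difference quotients are at most \<open>L\<close> in modulus and \<open>M\<close> has
  mass one. This is how the interpolation error, a Lipschitz function with a small constant, enters
  the final estimate.\<close>

lemma form_le:
  assumes "lip L u"
  shows "form u u \<le> L\<^sup>2"
proof -
  have "form u u \<le> (\<integral>p. L\<^sup>2 \<partial>M)"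
    unfolding form_def
  proof (rule integral_mono_AE)
    show "AE p in M. dq u p * dq u p \<le> L\<^sup>2"
      using AE_dq_le[OF assms]
      by eventually_elim (simp add: power2_eq_square[symmetric] abs_le_square_iff[symmetric])
  qed (use dq_integrable[OF assms assms] in auto)
  then show ?thesis by simp
qed

lemma dq_CS:
  assumes F: "F \<in> borel_measurable M" "AE p in M. \<bar>F p\<bar> \<le> K" and v: "lip L v" and K: "0 \<le> K"
  shows "\<bar>\<integral>p. F p * dq v p \<partial>M\<bar> \<le> K * sqrt (form v v)"
proof -
  have F2: "integrable M (\<lambda>p. (F p)\<^sup>2)"
  proof (rule M.integrable_const_bound)
    show "AE p in M. norm ((F p)\<^sup>2) \<le> K\<^sup>2"
      using F(2) by eventually_elim (use K in \<open>simp add: abs_le_square_iff[symmetric]\<close>)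
  qed (use F in simp)
  have v2: "integrable M (\<lambda>p. (dq v p)\<^sup>2)"
    using dq_integrable[OF v v] by (simp add: power2_eq_square)
  have "(\<integral>p. (F p)\<^sup>2 \<partial>M) \<le> (\<integral>p. K\<^sup>2 \<partial>M)"
    using F(2) by (intro integral_mono_AE F2) (auto elim!: eventually_mono simp: abs_le_square_iff[symmetric] K)
  then have "sqrt (\<integral>p. (F p)\<^sup>2 \<partial>M) \<le> sqrt (K\<^sup>2)" by (intro real_sqrt_le_mono) simp
  then have *: "sqrt (\<integral>p. (F p)\<^sup>2 \<partial>M) \<le> K" using K by simp
  have "\<bar>\<integral>p. F p * dq v p \<partial>M\<bar> \<le> sqrt (\<integral>p. (F p)\<^sup>2 \<partial>M) * sqrt (\<integral>p. (dq v p)\<^sup>2 \<partial>M)"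
    by (intro abs_integral_Cauchy_Schwarz F dq_meas lip_cont[OF v] F2 v2)
  also have "\<dots> \<le> K * sqrt (form v v)"
    unfolding form_def power2_eq_square[of "dq v _"] by (intro mult_right_mono *) simp
  finally show ?thesis .
qed

lemma form_CS: "lip K u \<Longrightarrow> lip L v \<Longrightarrow> \<bar>form u v\<bar> \<le> sqrt (form u u) * sqrt (form v v)"
  using abs_integral_Cauchy_Schwarz[of "dq u" M "dq v"] dq_meas lip_cont
    dq_integrable[of K u K u] dq_integrable[of L v L v]
  by (simp add: form_def power2_eq_square)

lemma dq_limit:
  assumes w: "\<And>n. lip L (w n)" and v: "lip L v"
    and lim: "\<And>x. x \<in> {0..1} \<Longrightarrow> (\<lambda>n. w n x) \<longlonglongrightarrow> v x"
  shows "AE p in M. (\<lambda>n. dq (w n) p) \<longlonglongrightarrow> dq v p"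
  using AE_M AE_space
proof eventually_elim
  case (elim p)
  then have "fst p + e (fst p) * snd p \<in> {0..1}" "fst p \<in> {0..1}" "e (fst p) * snd p \<noteq> 0"
    using window_mem[of "fst p" "snd p"] e_pos[of "fst p"] by (auto simp: space_pair_measure)
  then show ?case unfolding dq_def diff_quot_def by (intro tendsto_intros lim)
qed

text \<open>The common Lipschitz constant dominates all difference quotients, so pointwise
  convergence on [0,1] is enough.\<close>

lemma form_limit:
  assumes w: "\<And>n. lip L (w n)" and v: "lip L v"
    and lim: "\<And>x. x \<in> {0..1} \<Longrightarrow> (\<lambda>n. w n x) \<longlonglongrightarrow> v x" and u: "lip K u"
  shows "(\<lambda>n. form (w n) (w n)) \<longlonglongrightarrow> form v v" "(\<lambda>n. form u (w n)) \<longlonglongrightarrow> form u v"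
proof -
  have dl: "AE p in M. (\<lambda>n. dq (w n) p) \<longlonglongrightarrow> dq v p"
    by (rule dq_limit[OF w v]) (rule lim)
  have m: "dq (w n) \<in> borel_measurable M" "dq v \<in> borel_measurable M" "dq u \<in> borel_measurable M" for n
    using w v u by (auto intro: dq_meas lip_cont)
  show "(\<lambda>n. form (w n) (w n)) \<longlonglongrightarrow> form v v" unfolding form_def
  proof (rule integral_dominated_convergence[where w = "\<lambda>_. L * L"])
    show "AE p in M. (\<lambda>n. dq (w n) p * dq (w n) p) \<longlonglongrightarrow> dq v p * dq v p"
      using dl by eventually_elim (intro tendsto_intros)
    show "AE p in M. norm (dq (w n) p * dq (w n) p) \<le> L * L" for n
      using AE_dq_le[OF w[of n]]
      by eventually_elim (unfold real_norm_def abs_mult, intro mult_mono, auto)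
  qed (use m in auto)
  show "(\<lambda>n. form u (w n)) \<longlonglongrightarrow> form u v" unfolding form_def
  proof (rule integral_dominated_convergence[where w = "\<lambda>_. K * L"])
    show "AE p in M. (\<lambda>n. dq u p * dq (w n) p) \<longlonglongrightarrow> dq u p * dq v p"
      using dl by eventually_elim (intro tendsto_intros)
    show "AE p in M. norm (dq u p * dq (w n) p) \<le> K * L" for n
      using AE_dq_le[OF w[of n]] AE_dq_le[OF u]
      by eventually_elim (unfold real_norm_def abs_mult, intro mult_mono, use lip_nonneg[OF u] in auto)
  qed (use m in auto)
qed

lemma lip_sup:
  assumes "lip L w" "x \<in> {0..1}"
  shows "\<bar>w x\<bar> \<le> \<bar>w 0\<bar> + L"
proof -
  have "\<bar>w x - w 0\<bar> \<le> L * \<bar>x - 0\<bar>" using assms unfolding lip_def by (metis atLeastAtMost_iff zero_le_one order_refl)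
  also have "\<dots> \<le> L * 1" using assms lip_nonneg[OF assms(1)] by (intro mult_left_mono) auto
  finally show ?thesis by linarith
qed

lemma L2_limit:
  assumes w: "\<And>n. lip L (w n)" and v: "lip L v" and w0: "\<And>n. w n 0 = v 0"
    and lim: "\<And>x. x \<in> {0..1} \<Longrightarrow> (\<lambda>n. w n x) \<longlonglongrightarrow> v x"
  shows "(\<lambda>n. L2_norm (w n)) \<longlonglongrightarrow> L2_norm v"
    and "integrable leb f \<Longrightarrow> (\<lambda>n. \<integral>x. f x * w n x \<partial>leb) \<longlonglongrightarrow> (\<integral>x. f x * v x \<partial>leb)"
proof -
  let ?K = "\<bar>v 0\<bar> + L"
  have K: "\<bar>w n x\<bar> \<le> ?K" if "x \<in> {0..1}" for n x using lip_sup[OF w that, of n] w0 by simp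
  have m: "w n \<in> borel_measurable leb" "v \<in> borel_measurable leb" for n
    using lip_L2[OF w] lip_L2[OF v] by (auto simp: L2_def)
  show "(\<lambda>n. L2_norm (w n)) \<longlonglongrightarrow> L2_norm v" unfolding L2_norm_eq
  proof (intro tendsto_real_sqrt integral_dominated_convergence[where w = "\<lambda>_. ?K\<^sup>2"])
    show "AE x in leb. (\<lambda>n. (w n x)\<^sup>2) \<longlonglongrightarrow> (v x)\<^sup>2"
      by (intro AE_I2 tendsto_intros lim) auto
    show "AE x in leb. norm ((w n x)\<^sup>2) \<le> ?K\<^sup>2" for n
    proof (rule AE_I2)
      fix x assume "x \<in> space leb"
      then have "\<bar>w n x\<bar>\<^sup>2 \<le> ?K\<^sup>2" using K[of x n] by (intro power_mono) auto
      then show "norm ((w n x)\<^sup>2) \<le> ?K\<^sup>2" by simp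
    qed
  qed (use m in auto)
  show "(\<lambda>n. \<integral>x. f x * w n x \<partial>leb) \<longlonglongrightarrow> (\<integral>x. f x * v x \<partial>leb)" if f: "integrable leb f"
  proof (rule integral_dominated_convergence[where w = "\<lambda>x. \<bar>f x\<bar> * ?K"])
    show "AE x in leb. (\<lambda>n. f x * w n x) \<longlonglongrightarrow> f x * v x"
      by (intro AE_I2 tendsto_intros lim) auto
    show "AE x in leb. norm (f x * w n x) \<le> \<bar>f x\<bar> * ?K" for n
      by (intro AE_I2) (auto simp: abs_mult intro!: mult_left_mono K)
  qed (use m f in auto)
qed

end

section \<open>A nonlocal Poincare inequality\<close>

declare measurable_ident_leb [measurable del]

locale window_C1 = window +
  fixes e1 :: "real \<Rightarrow> real"
  assumes e_deriv: "\<And>x. x \<in> Om \<Longrightarrow> (e has_real_derivative e1 x) (at x)"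
    and e1_cont: "continuous_on Om e1"
    and e1_le: "\<And>x. x \<in> Om \<Longrightarrow> \<bar>e1 x\<bar> \<le> 1 / 3"

text \<open>The mean square of the quotient of |t| by the kernel weight, that is
  \<open>2 / (C_beta \<beta> * (\<beta> + 1))\<close>. Without integrability the Bochner integral
  would be 0 and the constant meaningless; the fact \<open>k2\<close> in
  \<open>abs_integral_le_kernel\<close> settles this.\<close>

definition kernel_moment :: "real \<Rightarrow> real" where
  "kernel_moment \<beta> = (\<integral>t. (\<bar>t\<bar> powr (\<beta> - 1) / C_beta \<beta>)\<^sup>2 \<partial>kernel_measure \<beta>)"

lemma kernel_moment_nonneg [simp]: "0 \<le> kernel_moment \<beta>"
  by (simp add: kernel_moment_def)

context window
begin

lemma C_beta_pos: "0 < C_beta \<beta>"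
  using beta by (simp add: C_beta_def)

text \<open>This is where \<open>0 < \<beta>\<close> is needed: the square of the quotient of \<open>\<bar>t\<bar>\<close> and the weight is
  \<open>\<bar>t\<bar> powr (2 * \<beta> - 2)\<close>, which is integrable against the weight only then.\<close>

lemma abs_integral_le_kernel:
  assumes g [measurable]: "g \<in> borel_measurable borel" and B: "\<And>t. \<bar>t\<bar> \<le> 1 \<Longrightarrow> \<bar>g t\<bar> \<le> B"
  shows "(\<integral>t. indicator {-1..1} t * (\<bar>t\<bar> * \<bar>g t\<bar>) \<partial>lborel) \<le> sqrt (kernel_moment \<beta> * (\<integral>t. (g t)\<^sup>2 \<partial>mu))"
proof -
  let ?k = "\<lambda>t. \<bar>t\<bar> powr (\<beta> - 1) / C_beta \<beta>"
  have w: "kernel_weight \<beta> t * ?k t = indicator {-1<..<1} t * \<bar>t\<bar>" for t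
  proof (cases "t = 0")
    case False
    then have "\<bar>t\<bar> powr (2 - \<beta>) * \<bar>t\<bar> powr (\<beta> - 1) = \<bar>t\<bar>"
      by (simp add: powr_add[symmetric])
    then show ?thesis using C_beta_pos by (simp add: kernel_weight_def)
  qed (simp add: kernel_weight_def)
  have "integrable lborel (\<lambda>t. indicator {-1<..<1} t * (\<bar>t\<bar> powr \<beta> / C_beta \<beta>))"
  proof (rule Bochner_Integration.integrable_bound)
    show "integrable lborel (\<lambda>t::real. indicator {-1<..<1} t * (1 / C_beta \<beta>) :: real)"
      by (intro integrable_mult_left integrable_real_indicator) auto
    show "AE t in lborel. norm (indicator {-1<..<1} t * (\<bar>t\<bar> powr \<beta> / C_beta \<beta>)) \<le> norm (indicator {-1<..<1} t * (1 / C_beta \<beta>) :: real)"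
      using C_beta_pos beta by (intro AE_I2) (auto simp: indicator_def divide_right_mono powr_le1)
  qed measurable
  moreover have "kernel_weight \<beta> t * (?k t)\<^sup>2 = indicator {-1<..<1} t * (\<bar>t\<bar> powr \<beta> / C_beta \<beta>)" for t
  proof -
    have "kernel_weight \<beta> t * (?k t)\<^sup>2 = indicator {-1<..<1} t * \<bar>t\<bar> * ?k t"
      unfolding power2_eq_square mult.assoc[symmetric] w by simp
    moreover have "\<bar>t\<bar> * \<bar>t\<bar> powr (\<beta> - 1) = \<bar>t\<bar> powr \<beta>"
      using powr_mult_base[of "\<bar>t\<bar>" "\<beta> - 1"] by simp
    ultimately show ?thesis by simp
  qed
  ultimately have k2: "integrable mu (\<lambda>t. (?k t)\<^sup>2)"
    unfolding kernel_measure_def using beta by (subst integrable_density) (auto simp: kernel_weight_nonneg)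
  have g2: "integrable mu (\<lambda>t. (g t)\<^sup>2)"
  proof (rule mu.integrable_const_bound)
    show "AE t in mu. norm ((g t)\<^sup>2) \<le> B\<^sup>2"
      using AE_mu
    proof eventually_elim
      case (elim t)
      then have "\<bar>g t\<bar>\<^sup>2 \<le> B\<^sup>2" by (intro power_mono B) auto
      then show ?case by simp
    qed
  qed measurable
  have "(\<integral>t. indicator {-1..1} t * (\<bar>t\<bar> * \<bar>g t\<bar>) \<partial>lborel) = (\<integral>t. indicator {-1<..<1} t * (\<bar>t\<bar> * \<bar>g t\<bar>) \<partial>lborel)"
  proof (rule integral_cong_AE)
    have "AE t in lborel. t \<noteq> 1 \<and> t \<noteq> -1" by (intro AE_conjI AE_lborel_singleton)
    then show "AE t in lborel. indicator {-1..1} t * (\<bar>t\<bar> * \<bar>g t\<bar>) = indicator {-1<..<1} t * (\<bar>t\<bar> * \<bar>g t\<bar>)"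
      by eventually_elim (auto simp: indicator_def)
  qed measurable
  also have "\<dots> = (\<integral>t. kernel_weight \<beta> t * (?k t * \<bar>g t\<bar>) \<partial>lborel)"
    unfolding mult.assoc[symmetric] w by simp
  also have "\<dots> = (\<integral>t. ?k t * \<bar>g t\<bar> \<partial>mu)"
    using beta by (intro integral_kernel_measure[symmetric]) auto
  also have "\<dots> \<le> sqrt (\<integral>t. (?k t)\<^sup>2 \<partial>mu) * sqrt (\<integral>t. \<bar>g t\<bar>\<^sup>2 \<partial>mu)"
    by (rule order_trans[OF abs_ge_self abs_integral_Cauchy_Schwarz]) (use k2 g2 in auto)
  finally show ?thesis by (simp add: real_sqrt_mult kernel_moment_def)
qed

lemma diff_quot_meas:
  assumes "continuous_on UNIV u"
  shows "diff_quot e u x \<in> borel_measurable borel"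
proof -
  have [measurable]: "u \<in> borel_measurable borel" using assms by (rule borel_measurable_continuous_onI)
  show ?thesis unfolding diff_quot_def by measurable
qed

text \<open>Dividing the increment by \<open>e x\<close> instead of \<open>e x * t\<close> leaves a
  factor t in front of the difference quotient. This factor allows Lebesgue measure in t to be
  compared with the kernel measure, at the price of \<open>kernel_moment\<close>.\<close>

lemma HK_kernel_le:
  assumes v: "lip L v" and x: "x \<in> Om" and G: "continuous_on {-1..1} G" and B: "\<And>t. t \<in> {-1..1} \<Longrightarrow> \<bar>G t\<bar> \<le> B"
  shows "\<bar>integral {-1..1} (\<lambda>t. G t * ((v (x + e x * t) - v x) / e x))\<bar>
    \<le> B * sqrt (kernel_moment \<beta> * (\<integral>t. (diff_quot e v x t)\<^sup>2 \<partial>mu))"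
proof -
  define p where "p t = (v (x + e x * t) - v x) / e x" for t
  have cv: "continuous_on UNIV v" using v by (rule lip_cont)
  have ex: "e x \<noteq> 0" using e_pos[OF x] by simp
  have cp: "continuous_on A p" for A
    unfolding p_def using ex by (intro continuous_intros continuous_on_compose2[OF cv]) auto
  have B0: "0 \<le> B" using B[of 0] by simp
  have p: "p t = t * diff_quot e v x t" for t by (simp add: diff_quot_def p_def)
  have si: "set_integrable lborel {-1..1} (\<lambda>t. B * \<bar>p t\<bar>)"
    by (intro borel_integrable_atLeastAtMost' continuous_intros cp)
  have "norm (integral {-1..1} (\<lambda>t. G t * p t)) \<le> integral {-1..1} (\<lambda>t. B * \<bar>p t\<bar>)"
    by (rule Henstock_Kurzweil_Integration.integral_norm_bound_integral)
       (simp_all only: real_norm_def abs_mult, auto intro!: integrable_continuous_interval continuous_intros G cp mult_right_mono B)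
  also have "\<dots> = (\<integral>t. indicator {-1..1} t * (B * \<bar>p t\<bar>) \<partial>lborel)"
    using set_borel_integral_eq_integral(2)[OF si, symmetric] by (simp only: set_lebesgue_integral_def real_scaleR_def)
  also have "\<dots> = (\<integral>t. B * (indicator {-1..1} t * (\<bar>t\<bar> * \<bar>diff_quot e v x t\<bar>)) \<partial>lborel)"
    unfolding p abs_mult by (simp add: ac_simps)
  also have "\<dots> = B * (\<integral>t. indicator {-1..1} t * (\<bar>t\<bar> * \<bar>diff_quot e v x t\<bar>) \<partial>lborel)" by simp
  also have "\<dots> \<le> B * sqrt (kernel_moment \<beta> * (\<integral>t. (diff_quot e v x t)\<^sup>2 \<partial>mu))"
    by (intro mult_left_mono B0 abs_integral_le_kernel[where B = L] diff_quot_meas cv diff_quot_le[OF v x])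
  finally show ?thesis by (simp add: p_def)
qed

lemma square_energy:
  assumes v: "lip L v"
  shows "integrable leb (\<lambda>x. \<integral>t. (diff_quot e v x t)\<^sup>2 \<partial>mu)"
    "(\<integral>x. (\<integral>t. (diff_quot e v x t)\<^sup>2 \<partial>mu) \<partial>leb) = form v v"
proof -
  have i: "integrable M (\<lambda>(x, t). (diff_quot e v x t)\<^sup>2)"
    using dq_integrable[OF v v] by (simp add: dq_def[abs_def] power2_eq_square case_prod_beta')
  show "integrable leb (\<lambda>x. \<integral>t. (diff_quot e v x t)\<^sup>2 \<partial>mu)"
    using integrable_fst[OF i] .
  show "(\<integral>x. (\<integral>t. (diff_quot e v x t)\<^sup>2 \<partial>mu) \<partial>leb) = form v v"
    using integral_fst[OF i] by (simp add: form_def dq_def power2_eq_square case_prod_beta')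
qed

end

context window_C1
begin

text \<open>The window average \<open>A\<close> satisfies pointwise bounds on
  \<open>\<bar>v x - A x\<bar>\<close> and \<open>\<bar>A' x\<bar>\<close> by the square root of the
  local energy \<open>?J x\<close>. In \<open>A'\<close> the derivative of v is the t-derivative of
  the increment divided by \<open>e x\<close>, so moving it onto the kernel costs no negative power
  of \<open>e x\<close>. As \<open>A 0 = 0\<close>, the L1 norm of \<open>A'\<close> then bounds
  \<open>A\<close>.\<close>

lemma poincare_smooth:
  assumes v: "lip L v" and v0: "v 0 = 0" and der: "\<And>x. (v has_real_derivative v' x) (at x)"
    and v'c: "continuous_on UNIV v'"
  shows "(L2_norm v)\<^sup>2 \<le> 20 * kernel_moment \<beta> * form v v"
proof -
  let ?J = "\<lambda>x. \<integral>t. (diff_quot e v x t)\<^sup>2 \<partial>mu"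
  \<comment> \<open>Mass one on [-1,1], and zero at both ends so that the integration by parts in t
    has no boundary terms.\<close>
  define k where "k t = 3 / 4 * (1 - t\<^sup>2)" for t :: real
  define A where "A x = integral {-1..1} (\<lambda>t. k t * v (x + e x * t))" for x
  define A' where "A' x = integral {-1..1} (\<lambda>t. k t * ((1 + e1 x * t) * v' (x + e x * t)))" for x
  have cv: "continuous_on UNIV v" using v by (rule lip_cont)
  have k_int: "(k has_integral 1) {-1..1}"
  proof -
    have "(k has_integral (3 / 4 * (1 - 1 ^ 3 / 3) - 3 / 4 * (-1 - (-1) ^ 3 / 3))) {-1..1}"
      unfolding k_def
      by (rule fundamental_theorem_of_calculus)
         (auto simp: has_real_derivative_iff_has_vector_derivative[symmetric] intro!: derivative_eq_intros)
    then show ?thesis by simp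
  qed
  have kc: "continuous_on S k" for S unfolding k_def by (intro continuous_intros)
  have k_le: "\<bar>k t\<bar> \<le> 1" if "t \<in> {-1..1}" for t
  proof -
    have "t\<^sup>2 \<le> 1" using that by (auto simp: abs_square_le_1 abs_le_iff)
    then show ?thesis using zero_le_power2[of t] by (simp only: k_def right_diff_distrib)
  qed
  have Ac: "continuous_on {0..1} A"
  proof -
    have c: "continuous_on ({0..1} \<times> {-1..1}) (\<lambda>(x, t). k t * v (x + e x * t))"
      unfolding case_prod_beta'
      by (intro continuous_intros continuous_on_compose2[OF cv] continuous_on_compose2[OF kc]
          continuous_on_compose2[OF e_cont]) auto
    show ?thesis unfolding A_def
      using integral_continuous_on_param[of "{0..1}" "-1" 1 "\<lambda>x t. k t * v (x + e x * t)"] c by simp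
  qed
  have ecO: "continuous_on Om e" using e_cont by (rule continuous_on_subset) auto
  have c': "continuous_on (Om \<times> {-1..1}) (\<lambda>(x, t). k t * ((1 + e1 x * t) * v' (x + e x * t)))"
    unfolding case_prod_beta'
    by (intro continuous_intros continuous_on_compose2[OF v'c] continuous_on_compose2[OF kc]
          continuous_on_compose2[OF ecO] continuous_on_compose2[OF e1_cont]) auto
  have A'c: "continuous_on Om A'"
    unfolding A'_def
    using integral_continuous_on_param[of Om "-1" 1 "\<lambda>x t. k t * ((1 + e1 x * t) * v' (x + e x * t))"] c' by simp
  have A_der: "(A has_real_derivative A' x) (at x)" if x: "x \<in> Om" for x
  proof -
    have "((\<lambda>x. integral (cbox (-1) 1) (\<lambda>t. k t * v (x + e x * t))) has_field_derivative
        integral (cbox (-1) 1) (\<lambda>t. k t * ((1 + e1 x * t) * v' (x + e x * t)))) (at x within Om)"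
    proof (rule leibniz_rule_field_derivative)
      fix y t :: real assume y: "y \<in> Om"
      have "((\<lambda>y. y + e y * t) has_real_derivative 1 + e1 y * t) (at y)"
        using e_deriv[OF y] by (auto intro!: derivative_eq_intros)
      from DERIV_chain2[OF der this]
      have "((\<lambda>y. v (y + e y * t)) has_real_derivative v' (y + e y * t) * (1 + e1 y * t)) (at y)" .
      then have "((\<lambda>y. k t * v (y + e y * t)) has_real_derivative k t * (v' (y + e y * t) * (1 + e1 y * t))) (at y)"
        by (rule DERIV_cmult)
      then show "((\<lambda>y. k t * v (y + e y * t)) has_field_derivative k t * ((1 + e1 y * t) * v' (y + e y * t))) (at y within Om)"
        by (simp add: mult.commute has_field_derivative_at_within)
    next
      fix y :: real assume "y \<in> Om"
      show "(\<lambda>t. k t * v (y + e y * t)) integrable_on cbox (-1) 1"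
        by (intro integrable_continuous continuous_intros continuous_on_compose2[OF cv] kc) auto
    qed (use c' x in auto)
    then show ?thesis unfolding A_def A'_def using x by (simp add: at_within_open[of x Om])
  qed
  have diff: "\<bar>v x - A x\<bar> \<le> sqrt (kernel_moment \<beta> * ?J x)" if x: "x \<in> Om" for x
  proof -
    have ex: "0 < e x" "e x \<le> 1" using e_pos[OF x] e_le[OF x] x by auto
    have vi: "(\<lambda>t. k t * v (x + e x * t)) integrable_on {-1..1}"
      by (intro integrable_continuous_interval continuous_intros continuous_on_compose2[OF cv] kc) auto
    have "((\<lambda>t. k t * v (x + e x * t) - k t * v x) has_integral A x - 1 * v x) {-1..1}"
      unfolding A_def by (intro has_integral_diff integrable_integral vi has_integral_mult_left k_int)
    then have "A x - v x = integral {-1..1} (\<lambda>t. k t * v (x + e x * t) - k t * v x)"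
      by (simp add: integral_unique)
    \<comment> \<open>The factor \<open>e x\<close>, at most 1, is put into the kernel so that the
      same estimate serves for \<open>A - v\<close> and for \<open>A'\<close>.\<close>
    also have "(\<lambda>t. k t * v (x + e x * t) - k t * v x) = (\<lambda>t. (e x * k t) * ((v (x + e x * t) - v x) / e x))"
      using ex by (auto simp: field_simps)
    finally have eq: "A x - v x = integral {-1..1} (\<lambda>t. (e x * k t) * ((v (x + e x * t) - v x) / e x))" .
    have "\<bar>A x - v x\<bar> \<le> 1 * sqrt (kernel_moment \<beta> * ?J x)"
      unfolding eq
    proof (rule HK_kernel_le[OF v x])
      show "continuous_on {-1..1} (\<lambda>t. e x * k t)" by (intro continuous_intros kc)
      fix t :: real assume "t \<in> {-1..1}"
      then have "\<bar>k t\<bar> \<le> 1" by (rule k_le)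
      then have "e x * \<bar>k t\<bar> \<le> 1 * 1" using ex by (intro mult_mono) auto
      then show "\<bar>e x * k t\<bar> \<le> 1" using ex by (simp add: abs_mult)
    qed
    then show ?thesis by (simp add: abs_minus_commute)
  qed
  have A'_le: "\<bar>A' x\<bar> \<le> 3 * sqrt (kernel_moment \<beta> * ?J x)" if x: "x \<in> Om" for x
  proof -
    have ex: "0 < e x" using e_pos[OF x] .
    define q where "q t = k t * (1 + e1 x * t)" for t
    define q' where "q' t = k t * e1 x + 3 / 4 * (- 2 * t) * (1 + e1 x * t)" for t
    have dq: "(q has_real_derivative q' t) (at t)" for t
    proof -
      have "(k has_real_derivative 3 / 4 * (- 2 * t)) (at t)"
        unfolding k_def by (auto intro!: derivative_eq_intros)
      moreover have "((\<lambda>t. 1 + e1 x * t) has_real_derivative e1 x) (at t)"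
        by (auto intro!: derivative_eq_intros)
      ultimately show ?thesis unfolding q_def q'_def by (rule DERIV_mult')
    qed
    have q'c: "continuous_on S q'" for S unfolding q'_def by (intro continuous_intros kc)
    \<comment> \<open>The factor \<open>e x\<close> of the chain rule cancels the denominator;
      subtracting \<open>v x\<close> does not change the derivative and produces the
      increment.\<close>
    have dv: "((\<lambda>t. (v (x + e x * t) - v x) / e x) has_real_derivative v' (x + e x * t)) (at t)" for t
      using ex by (auto intro!: derivative_eq_intros DERIV_chain2[OF der])
    have i1: "(\<lambda>t. q' t * ((v (x + e x * t) - v x) / e x)) integrable_on {-1..1}"
      using ex by (intro integrable_continuous_interval continuous_intros continuous_on_compose2[OF cv] q'c) auto
    have i2: "(\<lambda>t. q t * v' (x + e x * t)) integrable_on {-1..1}"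
      unfolding q_def by (intro integrable_continuous_interval continuous_intros continuous_on_compose2[OF v'c] kc) auto
    have "((\<lambda>t. q t * v' (x + e x * t) + q' t * ((v (x + e x * t) - v x) / e x)) has_integral
        q 1 * ((v (x + e x * 1) - v x) / e x) - q (-1) * ((v (x + e x * -1) - v x) / e x)) {-1..1}"
    proof (rule fundamental_theorem_of_calculus)
      fix t :: real
      show "((\<lambda>t. q t * ((v (x + e x * t) - v x) / e x)) has_vector_derivative
          q t * v' (x + e x * t) + q' t * ((v (x + e x * t) - v x) / e x)) (at t within {-1..1})"
        using has_field_derivative_at_within[OF DERIV_mult'[OF dq dv]]
        unfolding has_real_derivative_iff_has_vector_derivative .
    qed simp
    moreover have "q 1 = 0" "q (-1) = 0" by (simp_all add: q_def k_def)
    ultimately have "integral {-1..1} (\<lambda>t. q t * v' (x + e x * t) + q' t * ((v (x + e x * t) - v x) / e x)) = 0"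
      by (simp add: integral_unique)
    then have "integral {-1..1} (\<lambda>t. q' t * ((v (x + e x * t) - v x) / e x)) + integral {-1..1} (\<lambda>t. q t * v' (x + e x * t)) = 0"
      using Henstock_Kurzweil_Integration.integral_add[OF i2 i1] by simp
    moreover have "A' x = integral {-1..1} (\<lambda>t. q t * v' (x + e x * t))"
      unfolding A'_def q_def by (simp add: mult.assoc)
    ultimately have "\<bar>A' x\<bar> = \<bar>integral {-1..1} (\<lambda>t. q' t * ((v (x + e x * t) - v x) / e x))\<bar>" by linarith
    also have "\<dots> \<le> 3 * sqrt (kernel_moment \<beta> * ?J x)"
    proof (rule HK_kernel_le[OF v x q'c])
      fix t :: real assume t: "t \<in> {-1..1}"
      have "\<bar>k t * e1 x\<bar> \<le> 1 * (1 / 3)"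
        unfolding abs_mult by (intro mult_mono e1_le[OF x] k_le t) auto
      moreover have "\<bar>e1 x * t\<bar> \<le> 1 / 3 * 1"
        unfolding abs_mult using t by (intro mult_mono e1_le[OF x]) auto
      then have "\<bar>1 + e1 x * t\<bar> \<le> 4 / 3" by linarith
      then have "\<bar>3 / 4 * (- 2 * t)\<bar> * \<bar>1 + e1 x * t\<bar> \<le> (3 / 2) * (4 / 3)"
        using t by (intro mult_mono) auto
      then have "\<bar>3 / 4 * (- 2 * t) * (1 + e1 x * t)\<bar> \<le> 2" by (simp add: abs_mult)
      \<comment> \<open>The two terms contribute 1/3 and 2; their sum is rounded up to 3.\<close>
      ultimately show "\<bar>q' t\<bar> \<le> 3" unfolding q'_def by linarith
    qed
    finally show ?thesis .
  qed
  have J0: "0 \<le> ?J x" for x by simp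
  have Ji: "integrable leb ?J" and Jf: "(\<integral>x. ?J x \<partial>leb) = form v v" using square_energy[OF v] by auto
  have A'2: "(A' x)\<^sup>2 \<le> 9 * kernel_moment \<beta> * ?J x" if "x \<in> Om" for x
  proof -
    have "\<bar>A' x\<bar>\<^sup>2 \<le> (3 * sqrt (kernel_moment \<beta> * ?J x))\<^sup>2" using A'_le[OF that] by (intro power_mono) auto
    then show ?thesis by (simp add: power_mult_distrib)
  qed
  have A'm: "A' \<in> borel_measurable leb" using A'c by (rule borel_measurable_leb_continuous)
  have A'2i: "integrable leb (\<lambda>x. (A' x)\<^sup>2)"
    by (rule Bochner_Integration.integrable_bound[of leb "\<lambda>x. 9 * kernel_moment \<beta> * ?J x"])
       (use Ji A'm A'2 in \<open>auto intro!: AE_I2 order_trans[OF _ abs_ge_self]\<close>)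
  then have A'L2: "A' \<in> L2" using A'm by (simp add: L2_def)
  have A'n: "(L2_norm A')\<^sup>2 \<le> 9 * kernel_moment \<beta> * form v v"
  proof -
    have "(L2_norm A')\<^sup>2 \<le> (\<integral>x. 9 * kernel_moment \<beta> * ?J x \<partial>leb)"
      unfolding L2_norm_square using A'2i Ji A'2 by (intro integral_mono) auto
    then show ?thesis using Jf by simp
  qed
  have A0: "A 0 = 0" unfolding A_def by (simp add: e_0 v0)
  have A_sup: "(A x)\<^sup>2 \<le> 9 * kernel_moment \<beta> * form v v" if x: "x \<in> Om" for x
  proof -
    have "A x = (\<integral>y. indicator {0<..<x} y * A' y \<partial>leb)"
      using integral_leb_deriv[of 0 x A A'] x continuous_on_subset[OF Ac] A_der L2_integrable[OF A'L2] A0 by auto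
    also have "\<bar>\<dots>\<bar> \<le> (\<integral>y. \<bar>A' y\<bar> \<partial>leb)"
      using prim_diff_le[OF L2_integrable[OF A'L2], of x 0] by (simp add: prim_def)
    also have "\<dots> \<le> L2_norm A'" by (rule L1_le_L2[OF A'L2])
    finally have "\<bar>A x\<bar>\<^sup>2 \<le> (L2_norm A')\<^sup>2" by (intro power_mono) auto
    then show ?thesis using A'n by simp
  qed
  have "(L2_norm v)\<^sup>2 \<le> (\<integral>x. 2 * kernel_moment \<beta> * ?J x + 18 * kernel_moment \<beta> * form v v \<partial>leb)"
    unfolding L2_norm_square
  proof (rule integral_mono)
    show "integrable leb (\<lambda>x. (v x)\<^sup>2)" using lip_L2[OF v] by (simp add: L2_def)
    show "integrable leb (\<lambda>x. 2 * kernel_moment \<beta> * ?J x + 18 * kernel_moment \<beta> * form v v)" using Ji by simp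
    fix x :: real assume "x \<in> space leb"
    then have x: "x \<in> Om" by simp
    have "\<bar>v x - A x\<bar>\<^sup>2 \<le> (sqrt (kernel_moment \<beta> * ?J x))\<^sup>2" using diff[OF x] by (intro power_mono) auto
    then have 1: "(v x - A x)\<^sup>2 \<le> kernel_moment \<beta> * ?J x" by simp
    \<comment> \<open>This square is the gap in v^2 \<le> 2 (v - A)^2 + 2 A^2. The final constant is
      20 = 2 + 2 * 9, where 9 is the square of the constant for \<open>A'\<close>.\<close>
    have "0 \<le> (v x - 2 * A x)\<^sup>2" by simp
    then have "(v x)\<^sup>2 \<le> 2 * (v x - A x)\<^sup>2 + 2 * (A x)\<^sup>2"
      by (simp add: power2_eq_square algebra_simps)
    then show "(v x)\<^sup>2 \<le> 2 * kernel_moment \<beta> * ?J x + 18 * kernel_moment \<beta> * form v v"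
      using 1 A_sup[OF x] by linarith
  qed
  also have "\<dots> = 20 * kernel_moment \<beta> * form v v" using Ji Jf by simp
  finally show ?thesis .
qed

lemma poincare:
  assumes v: "lip L v" and v0: "v 0 = 0"
  shows "(L2_norm v)\<^sup>2 \<le> 20 * kernel_moment \<beta> * form v v"
proof -
  obtain w w' w'' where w: "\<And>n x. (w n has_real_derivative w' n x) (at x)" "\<And>n x. (w' n has_real_derivative w'' n x) (at x)"
    "\<And>n. lip L (w n)" "\<And>n. w n 0 = v 0" "\<And>x. x \<in> {0..1} \<Longrightarrow> (\<lambda>n. w n x) \<longlonglongrightarrow> v x"
    using smooth_lip_approximation[OF v] by metis
  have "continuous_on UNIV (w' n)" for n
    using w(2) by (meson DERIV_isCont continuous_at_imp_continuous_on)
  then have le: "(L2_norm (w n))\<^sup>2 \<le> 20 * kernel_moment \<beta> * form (w n) (w n)" for n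
    using w v0 by (intro poincare_smooth) auto
  have "(\<lambda>n. L2_norm (w n)) \<longlonglongrightarrow> L2_norm v"
    by (rule L2_limit(1)[OF w(3) v w(4)]) (rule w(5))
  moreover have "(\<lambda>n. form (w n) (w n)) \<longlonglongrightarrow> form v v"
    by (rule form_limit(1)[OF w(3) v _ v]) (rule w(5))
  ultimately show ?thesis
    by (intro LIMSEQ_le[of "\<lambda>n. (L2_norm (w n))\<^sup>2" _ "\<lambda>n. 20 * kernel_moment \<beta> * form (w n) (w n)"] tendsto_intros)
       (use le in auto)
qed

end

section \<open>Moving derivatives across a shifted function\<close>

lemma abs_mult_le: "\<bar>a\<bar> \<le> A \<Longrightarrow> \<bar>b\<bar> \<le> B \<Longrightarrow> \<bar>a * b\<bar> \<le> A * (B::real)"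
  unfolding abs_mult by (intro mult_mono) auto

lemma abs_add_le: "\<bar>a\<bar> \<le> A \<Longrightarrow> \<bar>b\<bar> \<le> B \<Longrightarrow> \<bar>a + b\<bar> \<le> A + (B::real)"
  by linarith

lemma abs_diff_le: "\<bar>a\<bar> \<le> A \<Longrightarrow> \<bar>b\<bar> \<le> B \<Longrightarrow> \<bar>a - b\<bar> \<le> A + (B::real)"
  by linarith

lemma L2_norm_le_sup:
  assumes f: "f \<in> L2" and le: "\<And>x. x \<in> Om \<Longrightarrow> \<bar>f x\<bar> \<le> B" and B: "0 \<le> B"
  shows "L2_norm f \<le> B"
proof (rule power2_le_imp_le[OF _ B])
  have "(L2_norm f)\<^sup>2 \<le> (\<integral>x. B\<^sup>2 \<partial>leb)"
    unfolding L2_norm_square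
  proof (rule integral_mono)
    show "integrable leb (\<lambda>x. (f x)\<^sup>2)" using f by (simp add: L2_def)
    fix x assume "x \<in> space leb"
    then have "\<bar>f x\<bar>\<^sup>2 \<le> B\<^sup>2" using le[of x] by (intro power_mono) auto
    then show "(f x)\<^sup>2 \<le> B\<^sup>2" by simp
  qed simp
  then show "(L2_norm f)\<^sup>2 \<le> B\<^sup>2" by simp
qed

text \<open>The factor \<open>b\<close> may have no limit at the end points and carries arbitrary
  values there; \<open>a\<close> forces the product to 0.\<close>

lemma continuous_vanishing_mult_bounded:
  fixes a b :: "real \<Rightarrow> real"
  assumes a: "continuous_on {0..1} a" "a 0 = 0" "a 1 = 0"
    and b: "continuous_on Om b" "\<And>x. x \<in> Om \<Longrightarrow> \<bar>b x\<bar> \<le> B"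
  shows "continuous_on {0..1} (\<lambda>x. a x * b x)"
  unfolding continuous_on_def
proof
  fix x :: real assume x: "x \<in> {0..1}"
  show "((\<lambda>x. a x * b x) \<longlongrightarrow> a x * b x) (at x within {0..1})"
  proof (cases "x \<in> Om")
    case True
    then have *: "at x within {0..1} = at x within Om"
      by (intro at_within_nhd[of x Om]) auto
    have "continuous_on Om a" using a(1) by (rule continuous_on_subset) auto
    then show ?thesis unfolding * using b True by (auto simp: continuous_on_def intro!: tendsto_intros)
  next
    case False
    then have ax: "a x = 0" using x a by (cases "x = 0") auto
    let ?K = "max B (max \<bar>b 0\<bar> \<bar>b 1\<bar>)"
    have "(a \<longlongrightarrow> a x) (at x within {0..1})" using a(1) x by (simp add: continuous_on_def)
    then have "(a \<longlongrightarrow> 0) (at x within {0..1})" using ax by simp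
    then have "((\<lambda>x. \<bar>a x\<bar> * ?K) \<longlongrightarrow> \<bar>0\<bar> * ?K) (at x within {0..1})" by (intro tendsto_intros)
    moreover have "norm (a y * b y) \<le> \<bar>a y\<bar> * ?K" if "y \<in> {0..1}" for y
    proof -
      have "\<bar>b y\<bar> \<le> ?K" using b(2)[of y] that by (cases "y = 0 \<or> y = 1") auto
      then show ?thesis by (simp add: abs_mult mult_left_mono del: max.bounded_iff)
    qed
    ultimately have "((\<lambda>x. a x * b x) \<longlongrightarrow> 0) (at x within {0..1})"
      by (intro Lim_null_comparison[of "\<lambda>x. a x * b x" "\<lambda>x. \<bar>a x\<bar> * ?K"])
         (auto simp: eventually_at_filter intro!: always_eventually)
    then show ?thesis by (simp add: ax)
  qed
qed

text \<open>No bound on \<open>e3\<close> alone is assumed, since it may grow like the inverse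
  boundary distance; only its product with \<open>e\<close> is controlled. \<open>D\<close> measures
  the radius and its derivatives, while \<open>E\<close> is a majorant of \<open>D\<close> and 1
  that absorbs powers of \<open>D\<close> beyond the second.\<close>

locale window_C3 = window_C1 +
  fixes e2 e3 :: "real \<Rightarrow> real" and D E :: real
  assumes e1_cont': "continuous_on {0..1} e1" and e1_0: "e1 0 = 0" and e1_1: "e1 1 = 0"
    and e1_deriv: "\<And>x. x \<in> Om \<Longrightarrow> (e1 has_real_derivative e2 x) (at x)"
    and e2_deriv: "\<And>x. x \<in> Om \<Longrightarrow> (e2 has_real_derivative e3 x) (at x)"
    and e3_cont: "continuous_on Om e3"
    and e_D: "\<And>x. x \<in> Om \<Longrightarrow> \<bar>e x\<bar> \<le> D" and e1_D: "\<And>x. x \<in> Om \<Longrightarrow> \<bar>e1 x\<bar> \<le> D"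
    and e2_D: "\<And>x. x \<in> Om \<Longrightarrow> \<bar>e2 x\<bar> \<le> D" and e3_D: "\<And>x. x \<in> Om \<Longrightarrow> \<bar>e x * e3 x\<bar> \<le> D * D"
    and D_E: "D \<le> E" and E_1: "1 \<le> E"
begin

lemma D_nonneg: "0 \<le> D"
  using e_D[of "1/2"] by simp

lemma e2_cont: "continuous_on Om e2"
  using e2_deriv by (meson DERIV_isCont continuous_at_imp_continuous_on)

text \<open>Keeping \<open>e * e2\<close> as one function confines \<open>e3\<close> to the
  derivative \<open>z'\<close>, where it comes multiplied by \<open>e\<close>. Moreover
  \<open>z\<close> extends continuously by 0 to the end points, which is not known of
  \<open>e2\<close>.\<close>

definition z :: "real \<Rightarrow> real" where "z x = e x * e2 x"

definition z' :: "real \<Rightarrow> real" where "z' x = e1 x * e2 x + e x * e3 x"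

lemma z_cont: "continuous_on {0..1} z"
  unfolding z_def[abs_def] by (intro continuous_vanishing_mult_bounded[where B = D] e_cont e_0 e_1 e2_cont e2_D)

lemma z_0 [simp]: "z 0 = 0" and z_1 [simp]: "z 1 = 0"
  by (simp_all add: z_def e_0 e_1)

lemma z_deriv: "x \<in> Om \<Longrightarrow> (z has_real_derivative z' x) (at x)"
  unfolding z_def[abs_def] z'_def using e_deriv[of x] e2_deriv[of x]
  by (auto intro!: derivative_eq_intros)

lemma z_D: "x \<in> Om \<Longrightarrow> \<bar>z x\<bar> \<le> D * D"
  unfolding z_def by (intro abs_mult_le e_D e2_D)

lemma z'_D: "x \<in> Om \<Longrightarrow> \<bar>z' x\<bar> \<le> D * D + D * D"
  unfolding z'_def by (intro abs_add_le abs_mult_le[of _ D _ D] e1_D e2_D e3_D)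

text \<open>The reciprocal Jacobian of the shift from x to \<open>x + \<tau> * e x\<close>. It turns
  a derivative of w at the shifted point into the x-derivative of the composition, as integration by
  parts requires.\<close>

definition \<rho> :: "real \<Rightarrow> real \<Rightarrow> real" where "\<rho> \<tau> x = 1 / (1 + \<tau> * e1 x)"

lemma \<tau>_e1:
  assumes "\<bar>\<tau>\<bar> \<le> 1" "x \<in> {0..1}"
  shows "\<bar>\<tau> * e1 x\<bar> \<le> 1 / 3"
proof -
  have "\<bar>e1 x\<bar> \<le> 1 / 3" using e1_le[of x] assms(2) e1_0 e1_1 by (cases "x = 0 \<or> x = 1") auto
  then have "\<bar>\<tau> * e1 x\<bar> \<le> 1 * (1 / 3)" using assms by (intro abs_mult_le)
  then show ?thesis by simp
qed

lemma \<rho>_pos: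
  assumes "\<bar>\<tau>\<bar> \<le> 1" "x \<in> {0..1}"
  shows "2 / 3 \<le> 1 + \<tau> * e1 x"
  using \<tau>_e1[OF assms] by linarith

lemma \<rho>_le:
  assumes "\<bar>\<tau>\<bar> \<le> 1" "x \<in> {0..1}"
  shows "\<bar>\<rho> \<tau> x\<bar> \<le> 2"
  using \<rho>_pos[OF assms] by (simp add: \<rho>_def abs_if divide_le_eq)

lemma \<rho>_cont: "\<bar>\<tau>\<bar> \<le> 1 \<Longrightarrow> continuous_on {0..1} (\<rho> \<tau>)"
  unfolding \<rho>_def[abs_def] using \<rho>_pos[of \<tau>]
  by (intro continuous_intros e1_cont') force

lemma \<rho>_deriv:
  assumes "\<bar>\<tau>\<bar> \<le> 1" "x \<in> Om"
  shows "(\<rho> \<tau> has_real_derivative - \<tau> * e2 x * (\<rho> \<tau> x * \<rho> \<tau> x)) (at x)"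
proof -
  have n: "1 + \<tau> * e1 x \<noteq> 0" using \<rho>_pos[of \<tau> x] assms by auto
  show ?thesis unfolding \<rho>_def[abs_def] using n e1_deriv[OF assms(2)]
    by (auto intro!: derivative_eq_intros simp: field_simps)
qed

lemma comp_cont:
  assumes "continuous_on UNIV w"
  shows "continuous_on {0..1} (\<lambda>x. w (x + \<tau> * e x))"
  by (intro continuous_on_compose2[OF assms] continuous_intros e_cont) auto

lemma comp_deriv:
  assumes der: "\<And>x. (w has_real_derivative w' x) (at x)" and \<tau>: "\<bar>\<tau>\<bar> \<le> 1" and x: "x \<in> Om"
  shows "((\<lambda>x. w (x + \<tau> * e x)) has_real_derivative w' (x + \<tau> * e x) * (1 + \<tau> * e1 x)) (at x)"
  using e_deriv[OF x] by (auto intro!: derivative_eq_intros DERIV_chain2[OF der])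

text \<open>The shift fixes 0 and 1 and has Jacobian at least 2/3, so the change of variables costs
  3/2 in the square, rounded up to 4. It is carried out with an antiderivative of the square of
  \<open>v\<close> and the fundamental theorem on both sides.\<close>

lemma comp_norm:
  assumes v: "continuous_on UNIV v" and \<tau>: "\<bar>\<tau>\<bar> \<le> 1"
  shows "L2_norm (\<lambda>x. v (x + \<tau> * e x)) \<le> 2 * L2_norm v"
proof -
  have c2: "continuous_on UNIV (\<lambda>x. (v x)\<^sup>2)" using v by (intro continuous_intros)
  then have "isCont (\<lambda>x. (v x)\<^sup>2) x" for x by (simp add: continuous_on_eq_continuous_at)
  then obtain W where W: "\<And>x. (W has_real_derivative (v x)\<^sup>2) (at x)"
    using einterval_antiderivative[of "-\<infinity>" "\<infinity>" "\<lambda>x. (v x)\<^sup>2"]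
    by (auto simp: has_real_derivative_iff_has_vector_derivative)
  have Wc: "continuous_on UNIV W" using W by (meson DERIV_isCont continuous_at_imp_continuous_on)
  have i: "integrable leb (\<lambda>x. (v (x + \<tau> * e x))\<^sup>2 * (1 + \<tau> * e1 x))"
    by (intro integrable_leb_continuous_Icc continuous_intros comp_cont[OF v] e1_cont')
  have i': "integrable leb (\<lambda>x. (v (x + \<tau> * e x))\<^sup>2)"
    by (intro integrable_leb_continuous_Icc continuous_intros comp_cont[OF v])
  have "(L2_norm (\<lambda>x. v (x + \<tau> * e x)))\<^sup>2 \<le> (\<integral>x. 3 / 2 * ((v (x + \<tau> * e x))\<^sup>2 * (1 + \<tau> * e1 x)) \<partial>leb)"
    unfolding L2_norm_square
  proof (intro integral_mono i')
    show "integrable leb (\<lambda>x. 3 / 2 * ((v (x + \<tau> * e x))\<^sup>2 * (1 + \<tau> * e1 x)))" using i by simp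
    fix x :: real assume "x \<in> space leb"
    then have "2 / 3 \<le> 1 + \<tau> * e1 x" using \<rho>_pos[OF \<tau>, of x] by simp
    then have "(v (x + \<tau> * e x))\<^sup>2 * (2 / 3) \<le> (v (x + \<tau> * e x))\<^sup>2 * (1 + \<tau> * e1 x)" by (intro mult_left_mono) auto
    then show "(v (x + \<tau> * e x))\<^sup>2 \<le> 3 / 2 * ((v (x + \<tau> * e x))\<^sup>2 * (1 + \<tau> * e1 x))" by simp
  qed
  also have "\<dots> = 3 / 2 * (\<integral>x. (v (x + \<tau> * e x))\<^sup>2 * (1 + \<tau> * e1 x) \<partial>leb)" by simp
  also have "(\<integral>x. (v (x + \<tau> * e x))\<^sup>2 * (1 + \<tau> * e1 x) \<partial>leb) = W (1 + \<tau> * e 1) - W (0 + \<tau> * e 0)"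
    by (intro integral_leb_deriv_Om[where F = "\<lambda>x. W (x + \<tau> * e x)"] comp_cont[OF Wc] comp_deriv[OF W \<tau>] i) auto
  also have "\<dots> = W 1 - W 0" by (simp add: e_0 e_1)
  also have "\<dots> = (\<integral>x. (v x)\<^sup>2 \<partial>leb)"
    by (intro integral_leb_deriv_Om[symmetric] continuous_on_subset[OF Wc] W integrable_leb_continuous_Icc continuous_on_subset[OF c2]) auto
  also have "3 / 2 * (\<integral>x. (v x)\<^sup>2 \<partial>leb) \<le> 4 * (L2_norm v)\<^sup>2" by (simp add: L2_norm_square)
  also have "\<dots> = (2 * L2_norm v)\<^sup>2" by (simp add: power_mult_distrib)
  finally show ?thesis by (rule power2_le_imp_le) simp
qed

text \<open>The coefficient vanishes at both ends, so \<open>w\<close> may take any values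
  there.\<close>

lemma ibp_once:
  assumes F: "continuous_on {0..1} F" "F 0 = 0" "F 1 = 0"
    and F': "\<And>x. x \<in> Om \<Longrightarrow> (F has_real_derivative F' x) (at x)"
    and w: "\<And>x. (w has_real_derivative w' x) (at x)" "continuous_on UNIV w'"
    and F'i: "integrable leb F'" and \<tau>: "\<bar>\<tau>\<bar> \<le> 1"
  shows "(\<integral>x. F x * (w' (x + \<tau> * e x) * (1 + \<tau> * e1 x)) \<partial>leb) = - (\<integral>x. F' x * w (x + \<tau> * e x) \<partial>leb)"
proof -
  have wc: "continuous_on UNIV w" using w(1) by (meson DERIV_isCont continuous_at_imp_continuous_on)
  obtain B where B: "\<And>x. x \<in> {0..1} \<Longrightarrow> \<bar>w (x + \<tau> * e x)\<bar> \<le> B"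
    using continuous_Icc_bounded[OF comp_cont[OF wc]] by blast
  have i1: "integrable leb (\<lambda>x. F' x * w (x + \<tau> * e x))"
    by (rule integrable_mult_bounded[OF F'i, where B = B])
       (use B in \<open>auto intro!: borel_measurable_leb_continuous continuous_on_subset[OF comp_cont[OF wc]]\<close>)
  have i2: "integrable leb (\<lambda>x. F x * (w' (x + \<tau> * e x) * (1 + \<tau> * e1 x)))"
    by (intro integrable_leb_continuous_Icc continuous_intros F(1) comp_cont[OF w(2)] e1_cont')
  have "(\<integral>x. F x * (w' (x + \<tau> * e x) * (1 + \<tau> * e1 x)) + F' x * w (x + \<tau> * e x) \<partial>leb)
      = F 1 * w (1 + \<tau> * e 1) - F 0 * w (0 + \<tau> * e 0)"
  proof (rule integral_leb_deriv_Om[where F = "\<lambda>x. F x * w (x + \<tau> * e x)"])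
    show "continuous_on {0..1} (\<lambda>x. F x * w (x + \<tau> * e x))" by (intro continuous_intros F(1) comp_cont[OF wc])
    show "((\<lambda>x. F x * w (x + \<tau> * e x)) has_real_derivative
        F x * (w' (x + \<tau> * e x) * (1 + \<tau> * e1 x)) + F' x * w (x + \<tau> * e x)) (at x)" if "x \<in> Om" for x
      using DERIV_mult'[OF F'[OF that] comp_deriv[OF w(1) \<tau> that]] .
    show "integrable leb (\<lambda>x. F x * (w' (x + \<tau> * e x) * (1 + \<tau> * e1 x)) + F' x * w (x + \<tau> * e x))"
      using i1 i2 by simp
  qed
  then show ?thesis using F i1 i2 by simp
qed

end

text \<open>The fourth derivative of \<open>u\<close> enters only as the square integrable density
  \<open>g\<close> of \<open>u3\<close>; the lower ones are bounded uniformly by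
  \<open>U\<close>.\<close>

locale consistency = window_C3 +
  fixes u u1 u2 u3 g :: "real \<Rightarrow> real" and c U :: real
  assumes u1_cont: "continuous_on {0..1} u1" and u2_cont: "continuous_on {0..1} u2"
    and u3_cont: "continuous_on {0..1} u3"
    and u_deriv: "\<And>x. x \<in> Om \<Longrightarrow> (u has_real_derivative u1 x) (at x)"
    and u1_deriv: "\<And>x. x \<in> Om \<Longrightarrow> (u1 has_real_derivative u2 x) (at x)"
    and u2_deriv: "\<And>x. x \<in> Om \<Longrightarrow> (u2 has_real_derivative u3 x) (at x)"
    and g: "g \<in> L2" and u3_prim: "\<And>x. x \<in> {0..1} \<Longrightarrow> u3 x = c + prim g x"
    and u1_U: "\<And>x. x \<in> {0..1} \<Longrightarrow> \<bar>u1 x\<bar> \<le> U" and u2_U: "\<And>x. x \<in> {0..1} \<Longrightarrow> \<bar>u2 x\<bar> \<le> U"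
    and u3_U: "\<And>x. x \<in> {0..1} \<Longrightarrow> \<bar>u3 x\<bar> \<le> U" and g_U: "L2_norm g \<le> U"
begin

lemma U_nonneg: "0 \<le> U"
  using u1_U[of 0] by simp

lemma Om_conts:
  "continuous_on Om e" "continuous_on Om e1" "continuous_on Om z" "continuous_on Om u1" "continuous_on Om u2"
  "continuous_on Om u3" "\<bar>\<tau>\<bar> \<le> 1 \<Longrightarrow> continuous_on Om (\<rho> \<tau>)" "continuous_on Om z'"
proof -
  show "continuous_on Om e" "continuous_on Om e1" "continuous_on Om z" "continuous_on Om u1" "continuous_on Om u2"
    "continuous_on Om u3" "\<bar>\<tau>\<bar> \<le> 1 \<Longrightarrow> continuous_on Om (\<rho> \<tau>)"
    using e_cont e1_cont z_cont u1_cont u2_cont u3_cont \<rho>_cont[of \<tau>] by (auto elim!: continuous_on_subset)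
  then show "continuous_on Om z'" unfolding z'_def[abs_def]
    by (intro continuous_intros e2_cont e3_cont)
qed

lemmas U_bounds = u1_U u2_U u3_U e_D e1_D e2_D z_D z'_D

text \<open>Terms of third and fourth order in \<open>D\<close> occur, and \<open>D\<close> need not
  be below 1; they are traded for \<open>D * D\<close> times powers of \<open>E\<close>.\<close>

lemma power_bounds:
  "D * D * D \<le> D * D * E" "D * D * D * D \<le> D * D * (E * E)" "D * D \<le> D * D * E" "D * D * E \<le> D * D * (E * E)" "0 \<le> D * D * (E * E)"
proof -
  have DD: "0 \<le> D * D" using D_nonneg by simp
  have E0: "0 \<le> E" using E_1 by simp
  show 1: "D * D * D \<le> D * D * E" using D_E DD by (rule mult_left_mono)
  have "D * D \<le> E * E" using D_E D_nonneg E0 by (intro mult_mono)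
  then have "D * D * (D * D) \<le> D * D * (E * E)" using DD by (rule mult_left_mono)
  then show "D * D * D * D \<le> D * D * (E * E)" by (simp add: mult.assoc)
  show "0 \<le> D * D * (E * E)" using DD by simp
  show "D * D \<le> D * D * E" using mult_left_mono[OF E_1 DD] by simp
  show "D * D * E \<le> D * D * (E * E)" using mult_left_mono[OF mult_left_mono[OF E_1 E0] DD] by simp
qed

text \<open>Two integrations by parts move both derivatives off \<open>v\<close>. Differentiating
  the coefficient never lowers the number of factors among \<open>e\<close> and its derivatives
  below two, so the result remains of order \<open>D * D\<close>. The constant 400 is 200 times the
  factor 2 of \<open>comp_norm\<close>.\<close>

lemma first_order_term:
  assumes v: "\<And>x. (v has_real_derivative v' x) (at x)" "\<And>x. (v' has_real_derivative v'' x) (at x)"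
    "continuous_on UNIV v''" and \<tau>: "\<bar>\<tau>\<bar> \<le> 1"
  shows "\<bar>\<integral>x. u1 x * e1 x * e x * v'' (x + \<tau> * e x) \<partial>leb\<bar> \<le> 400 * (E * E) * (D * D) * U * L2_norm v"
proof -
  have v'c: "continuous_on UNIV v'" and vc: "continuous_on UNIV v"
    using v by (meson DERIV_isCont continuous_at_imp_continuous_on)+
  let ?r = "\<rho> \<tau>"
  define F where "F x = u1 x * e1 x * e x" for x
  define F' where "F' x = u2 x * e1 x * e x + u1 x * z x + u1 x * e1 x * e1 x" for x
  define F'' where "F'' x = (u3 x * e1 x * e x + u2 x * e2 x * e x + u2 x * e1 x * e1 x) + (u2 x * z x + u1 x * z' x)
      + (u2 x * e1 x * e1 x + u1 x * e2 x * e1 x + u1 x * e1 x * e2 x)" for x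
  define H where "H x = u1 x * e1 x * z x" for x
  define H' where "H' x = u2 x * e1 x * z x + u1 x * e2 x * z x + u1 x * e1 x * z' x" for x
  \<comment> \<open>\<open>G\<close> is \<open>?r\<close> times the derivative of
    \<open>F * ?r\<close>: the coefficient left by the first integration by parts, prepared for the
    second. Differentiating \<open>?r\<close> produces \<open>F * e2\<close>, which is
    \<open>H\<close>.\<close>
  define G where "G x = F' x * (?r x * ?r x) - \<tau> * H x * (?r x * ?r x * ?r x)" for x
  define G' where "G' x = F'' x * (?r x * ?r x) - 2 * \<tau> * F' x * e2 x * (?r x * ?r x * ?r x)
     - \<tau> * H' x * (?r x * ?r x * ?r x) + 3 * \<tau> * \<tau> * H x * e2 x * (?r x * ?r x * ?r x * ?r x)" for x
  note der = u1_deriv u2_deriv e_deriv e1_deriv z_deriv \<rho>_deriv[OF \<tau>]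
  note oc = Om_conts(1-6) Om_conts(7)[OF \<tau>] Om_conts(8) e2_cont
  have dF: "(F has_real_derivative F' x) (at x)" if "x \<in> Om" for x
    unfolding F_def[abs_def] F'_def using that
    by (auto intro!: derivative_eq_intros der simp: z_def algebra_simps)
  have dF': "(F' has_real_derivative F'' x) (at x)" if "x \<in> Om" for x
    unfolding F'_def[abs_def] F''_def using that
    by (auto intro!: derivative_eq_intros der simp: algebra_simps)
  have dH: "(H has_real_derivative H' x) (at x)" if "x \<in> Om" for x
    unfolding H_def[abs_def] H'_def using that
    by (auto intro!: derivative_eq_intros der simp: algebra_simps)
  have dG: "(G has_real_derivative G' x) (at x)" if "x \<in> Om" for x
    unfolding G_def[abs_def] G'_def using that
    by (auto intro!: derivative_eq_intros dF' dH \<rho>_deriv[OF \<tau>] simp: algebra_simps)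
  have Fc: "continuous_on {0..1} F" unfolding F_def[abs_def] by (intro continuous_intros u1_cont e_cont e1_cont')
  have F'c: "continuous_on {0..1} F'"
    unfolding F'_def[abs_def] by (intro continuous_intros u1_cont u2_cont e_cont e1_cont' z_cont)
  have Hc: "continuous_on {0..1} H"
    unfolding H_def[abs_def] by (intro continuous_intros u1_cont e1_cont' z_cont)
  have Gc: "continuous_on {0..1} G"
    unfolding G_def[abs_def] by (intro continuous_intros F'c Hc \<rho>_cont[OF \<tau>])
  have G01: "G 0 = 0" "G 1 = 0" by (simp_all add: G_def F'_def H_def e_0 e_1 e1_0 e1_1)
  have F01: "F 0 = 0" "F 1 = 0" by (simp_all add: F_def e_0 e_1)
  have G'c: "continuous_on Om G'"
    unfolding G'_def[abs_def] F''_def F'_def H_def H'_def by (intro continuous_intros oc)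
  have bF': "\<bar>F' x\<bar> \<le> U * D * D + U * (D * D) + U * D * D" if "x \<in> Om" for x
    unfolding F'_def using that by (intro abs_add_le abs_mult_le U_bounds) auto
  have bH: "\<bar>H x\<bar> \<le> U * D * (D * D)" if "x \<in> Om" for x
    unfolding H_def using that by (intro abs_mult_le U_bounds) auto
  have bG': "\<bar>G' x\<bar> \<le> 200 * (E * E) * (D * D) * U" if x: "x \<in> Om" for x
  proof -
    have F'': "\<bar>F'' x\<bar> \<le> (U * D * D + U * D * D + U * D * D) + (U * (D * D) + U * (D * D + D * D))
        + (U * D * D + U * D * D + U * D * D)"
      unfolding F''_def using x by (intro abs_add_le abs_mult_le U_bounds) auto
    have H': "\<bar>H' x\<bar> \<le> U * D * (D * D) + U * D * (D * D) + U * D * (D * D + D * D)"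
      unfolding H'_def using x by (intro abs_add_le abs_mult_le U_bounds) auto
    have r: "\<bar>?r x\<bar> \<le> 2" using \<rho>_le[OF \<tau>] x by simp
    have n: "\<bar>2 * \<tau>\<bar> \<le> 2" "\<bar>3 * \<tau> * \<tau>\<bar> \<le> 3"
      using \<tau> abs_mult_le[OF \<tau> \<tau>] by (auto simp: abs_mult)
    have "\<bar>G' x\<bar> \<le> (9 * (U * (D * D))) * (2 * 2) + 2 * (3 * (U * (D * D))) * E * (2 * 2 * 2)
        + 1 * (4 * (U * (D * D * D))) * (2 * 2 * 2) + 3 * (U * (D * D * D)) * D * (2 * 2 * 2 * 2)"
      unfolding G'_def using F'' H' r n \<tau> bF'[OF x] bH[OF x] e2_D[OF x] D_E
      by (intro abs_add_le abs_diff_le abs_mult_le) (simp_all add: algebra_simps)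
    \<comment> \<open>These coefficients add up to 164; 200 is a round majorant.\<close>
    also have "\<dots> = U * (36 * (D * D) + 48 * (D * D * E) + 32 * (D * D * D) + 48 * (D * D * D * D))"
      by (simp add: algebra_simps)
    also have "\<dots> \<le> U * (200 * (D * D * (E * E)))"
      using U_nonneg power_bounds by (intro mult_left_mono) linarith+
    finally show ?thesis by (simp add: algebra_simps)
  qed
  have G'i: "integrable leb G'" using G'c bG' by (rule integrable_leb_continuous)
  define Fr' where "Fr' x = F' x * ?r x - \<tau> * H x * (?r x * ?r x)" for x
  have dFr: "((\<lambda>x. F x * ?r x) has_real_derivative Fr' x) (at x)" if "x \<in> Om" for x
  proof -
    have "F x * (- \<tau> * e2 x * (?r x * ?r x)) + F' x * ?r x = Fr' x"
      by (simp add: Fr'_def F_def H_def z_def algebra_simps)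
    then show ?thesis using DERIV_mult'[OF dF[OF that] \<rho>_deriv[OF \<tau> that]] by simp
  qed
  have Fr'c: "continuous_on {0..1} Fr'"
    unfolding Fr'_def[abs_def] by (intro continuous_intros F'c Hc \<rho>_cont[OF \<tau>])
  have rr: "?r x * (1 + \<tau> * e1 x) = 1" if "x \<in> {0..1}" for x
    using \<rho>_pos[OF \<tau> that] by (simp add: \<rho>_def)
  have "(\<integral>x. F x * v'' (x + \<tau> * e x) \<partial>leb) = (\<integral>x. F x * ?r x * (v'' (x + \<tau> * e x) * (1 + \<tau> * e1 x)) \<partial>leb)"
    using rr by (intro Bochner_Integration.integral_cong) (auto simp: ac_simps)
  also have "\<dots> = - (\<integral>x. Fr' x * v' (x + \<tau> * e x) \<partial>leb)"
    by (rule ibp_once[OF _ _ _ dFr v(2,3) integrable_leb_continuous_Icc[OF Fr'c] \<tau>])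
       (auto intro!: continuous_intros Fc \<rho>_cont \<tau> simp: F01)
  also have "(\<integral>x. Fr' x * v' (x + \<tau> * e x) \<partial>leb) = (\<integral>x. G x * (v' (x + \<tau> * e x) * (1 + \<tau> * e1 x)) \<partial>leb)"
  proof (intro Bochner_Integration.integral_cong refl)
    fix x assume "x \<in> space leb"
    then have "?r x * (1 + \<tau> * e1 x) = 1" using rr[of x] by simp
    moreover have "G x * (1 + \<tau> * e1 x) = Fr' x * (?r x * (1 + \<tau> * e1 x))"
      by (simp add: G_def Fr'_def algebra_simps)
    ultimately have "G x * (1 + \<tau> * e1 x) = Fr' x" by (simp only: mult_1_right)
    moreover have "G x * (v' (x + \<tau> * e x) * (1 + \<tau> * e1 x)) = G x * (1 + \<tau> * e1 x) * v' (x + \<tau> * e x)"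
      by (simp only: ac_simps)
    ultimately show "Fr' x * v' (x + \<tau> * e x) = G x * (v' (x + \<tau> * e x) * (1 + \<tau> * e1 x))" by simp
  qed
  also have "\<dots> = - (\<integral>x. G' x * v (x + \<tau> * e x) \<partial>leb)"
    by (rule ibp_once[OF Gc G01 dG v(1) v'c G'i \<tau>])
  finally have eq: "(\<integral>x. F x * v'' (x + \<tau> * e x) \<partial>leb) = (\<integral>x. G' x * v (x + \<tau> * e x) \<partial>leb)" by simp
  have G'L2: "G' \<in> L2" using G'c bG' by (intro L2_bounded[where B = "200 * (E * E) * (D * D) * U"] borel_measurable_leb_continuous)
  have G'n: "L2_norm G' \<le> 200 * (E * E) * (D * D) * U"
    using bG' by (intro L2_norm_le_sup G'L2) (use U_nonneg E_1 D_nonneg in auto)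
  have "\<bar>\<integral>x. G' x * v (x + \<tau> * e x) \<partial>leb\<bar> \<le> L2_norm G' * L2_norm (\<lambda>x. v (x + \<tau> * e x))"
    by (rule L2_inner_le[OF G'L2 L2_continuous[OF comp_cont[OF vc]]])
  also have "\<dots> \<le> (200 * (E * E) * (D * D) * U) * (2 * L2_norm v)"
    by (intro mult_mono G'n comp_norm[OF vc \<tau>]) (use U_nonneg E_1 D_nonneg in auto)
  finally show ?thesis unfolding eq[symmetric] F_def by (simp add: algebra_simps)
qed

text \<open>The coefficient contains \<open>u2\<close>, so a second integration by parts would
  differentiate \<open>u3\<close>. After the first one the coefficient is therefore split into
  \<open>u3 * a\<close>, treated with the primitive formula for \<open>u3\<close>, and a
  differentiable rest \<open>b\<close>. The constant 500 rounds up 2 * 240 + 8.\<close>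

lemma zeroth_order_term:
  assumes v: "\<And>x. (v has_real_derivative v' x) (at x)" "\<And>x. (v' has_real_derivative v'' x) (at x)"
    "continuous_on UNIV v''" and \<tau>: "\<bar>\<tau>\<bar> \<le> 1"
  shows "\<bar>\<integral>x. u2 x * (e x * e x) * v'' (x + \<tau> * e x) \<partial>leb\<bar> \<le> 500 * (E * E) * (D * D) * U * L2_norm v"
proof -
  have v'c: "continuous_on UNIV v'" and vc: "continuous_on UNIV v"
    using v by (meson DERIV_isCont continuous_at_imp_continuous_on)+
  let ?r = "\<rho> \<tau>" and ?V = "\<lambda>x. v (x + \<tau> * e x)" and ?V' = "\<lambda>x. v' (x + \<tau> * e x) * (1 + \<tau> * e1 x)"
  define a where "a x = e x * e x * (?r x * ?r x)" for x
  define a' where "a' x = 2 * (e x * e1 x * (?r x * ?r x)) - 2 * (\<tau> * e x * z x * (?r x * ?r x * ?r x))" for x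
  define H where "H x = u2 x * e x * z x" for x
  define H' where "H' x = u3 x * e x * z x + u2 x * e1 x * z x + u2 x * e x * z' x" for x
  define b where "b x = 2 * (u2 x * e x * e1 x * (?r x * ?r x)) - \<tau> * H x * (?r x * ?r x * ?r x)" for x
  define b' where "b' x = 2 * ((u3 x * e x * e1 x + u2 x * e1 x * e1 x + u2 x * z x) * (?r x * ?r x)
        - 2 * (\<tau> * u2 x * e1 x * z x * (?r x * ?r x * ?r x)))
      - \<tau> * H' x * (?r x * ?r x * ?r x) + 3 * \<tau> * \<tau> * H x * e2 x * (?r x * ?r x * ?r x * ?r x)" for x
  note der = u1_deriv u2_deriv e_deriv e1_deriv z_deriv \<rho>_deriv[OF \<tau>]
  note oc = Om_conts(1-6) Om_conts(7)[OF \<tau>] Om_conts(8) e2_cont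
  have da: "(a has_real_derivative a' x) (at x)" if "x \<in> Om" for x
    unfolding a_def[abs_def] a'_def using that
    by (auto intro!: derivative_eq_intros der simp: z_def algebra_simps)
  have dH: "(H has_real_derivative H' x) (at x)" if "x \<in> Om" for x
    unfolding H_def[abs_def] H'_def using that
    by (auto intro!: derivative_eq_intros der simp: algebra_simps)
  have db: "(b has_real_derivative b' x) (at x)" if "x \<in> Om" for x
    unfolding b_def[abs_def] b'_def using that
    by (auto intro!: derivative_eq_intros dH der simp: z_def algebra_simps)
  have ac: "continuous_on {0..1} a" unfolding a_def[abs_def] by (intro continuous_intros e_cont \<rho>_cont[OF \<tau>])
  have a'c: "continuous_on {0..1} a'"
    unfolding a'_def[abs_def] by (intro continuous_intros e_cont e1_cont' z_cont \<rho>_cont[OF \<tau>])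
  have Hc: "continuous_on {0..1} H" unfolding H_def[abs_def] by (intro continuous_intros u2_cont e_cont z_cont)
  have bc: "continuous_on {0..1} b"
    unfolding b_def[abs_def] by (intro continuous_intros u2_cont e_cont e1_cont' Hc \<rho>_cont[OF \<tau>])
  have b'c: "continuous_on Om b'"
    unfolding b'_def[abs_def] H_def H'_def by (intro continuous_intros oc)
  have ends: "a 0 = 0" "a 1 = 0" "b 0 = 0" "b 1 = 0"
    by (simp_all add: a_def b_def H_def e_0 e_1)
  have aB: "\<bar>a x\<bar> \<le> 4 * (D * D)" and R: "\<bar>u3 x * a' x + b' x\<bar> \<le> 240 * (E * E) * (D * D) * U" and b'B: "\<bar>b' x\<bar> \<le> 240 * (E * E) * (D * D) * U" if x: "x \<in> Om" for x
  proof -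
    have r: "\<bar>?r x\<bar> \<le> 2" using \<rho>_le[OF \<tau>] x by simp
    have xI: "x \<in> {0..1}" using x by simp
    have "\<bar>a x\<bar> \<le> D * D * (2 * 2)" unfolding a_def by (intro abs_mult_le r e_D x)
    then show "\<bar>a x\<bar> \<le> 4 * (D * D)" by simp
    have a': "\<bar>a' x\<bar> \<le> 2 * (D * D * (2 * 2)) + 2 * (1 * D * (D * D) * (2 * 2 * 2))"
      unfolding a'_def by (intro abs_diff_le abs_mult_le U_bounds r \<tau> x) auto
    have H: "\<bar>H x\<bar> \<le> U * D * (D * D)"
      unfolding H_def by (intro abs_mult_le U_bounds x xI)
    have H': "\<bar>H' x\<bar> \<le> U * D * (D * D) + U * D * (D * D) + U * D * (D * D + D * D)"
      unfolding H'_def by (intro abs_add_le abs_mult_le U_bounds x xI)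
    have n: "\<bar>3 * \<tau> * \<tau>\<bar> \<le> 3"
      using abs_mult_le[OF \<tau> \<tau>] by (auto simp: abs_mult)
    have b1: "\<bar>(u3 x * e x * e1 x + u2 x * e1 x * e1 x + u2 x * z x) * (?r x * ?r x)\<bar>
        \<le> (U * D * D + U * D * D + U * (D * D)) * (2 * 2)"
      by (intro abs_add_le abs_mult_le U_bounds r x xI)
    have b2: "\<bar>\<tau> * u2 x * e1 x * z x * (?r x * ?r x * ?r x)\<bar> \<le> 1 * U * D * (D * D) * (2 * 2 * 2)"
      by (intro abs_mult_le U_bounds r \<tau> x xI)
    have b3: "\<bar>\<tau> * H' x * (?r x * ?r x * ?r x)\<bar> \<le> 1 * (U * D * (D * D) + U * D * (D * D) + U * D * (D * D + D * D)) * (2 * 2 * 2)"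
      by (intro abs_mult_le H' r \<tau>)
    have b4: "\<bar>3 * \<tau> * \<tau> * H x * e2 x * (?r x * ?r x * ?r x * ?r x)\<bar> \<le> 3 * (U * D * (D * D)) * D * (2 * 2 * 2 * 2)"
      by (intro abs_mult_le n H r e2_D x)
    have four: "\<bar>2 * (p1 - 2 * p2) - p3 + p4\<bar> \<le> 2 * q1 + 4 * q2 + q3 + q4"
      if "\<bar>p1\<bar> \<le> q1" "\<bar>p2\<bar> \<le> q2" "\<bar>p3\<bar> \<le> q3" "\<bar>p4\<bar> \<le> q4" for p1 p2 p3 p4 q1 q2 q3 q4 :: real
      using that unfolding abs_le_iff by auto
    have "\<bar>b' x\<bar> \<le> 2 * ((U * D * D + U * D * D + U * (D * D)) * (2 * 2)) + 4 * (1 * U * D * (D * D) * (2 * 2 * 2))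
       + 1 * (U * D * (D * D) + U * D * (D * D) + U * D * (D * D + D * D)) * (2 * 2 * 2) + 3 * (U * D * (D * D)) * D * (2 * 2 * 2 * 2)"
      unfolding b'_def by (rule four[OF b1 b2 b3 b4])
    also have "\<dots> = U * (24 * (D * D) + 64 * (D * D * D) + 48 * (D * D * D * D))"
      by (simp add: algebra_simps)
    finally have b': "\<bar>b' x\<bar> \<le> U * (24 * (D * D) + 64 * (D * D * D) + 48 * (D * D * D * D))" .
    also have "\<dots> \<le> U * (240 * (D * D * (E * E)))"
      by (rule mult_left_mono[OF _ U_nonneg]) (use power_bounds in linarith)
    finally show "\<bar>b' x\<bar> \<le> 240 * (E * E) * (D * D) * U" by (simp add: algebra_simps)
    have "\<bar>u3 x * a' x\<bar> \<le> U * (2 * (D * D * (2 * 2)) + 2 * (1 * D * (D * D) * (2 * 2 * 2)))"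
      by (intro abs_mult_le a' u3_U xI)
    then have "\<bar>u3 x * a' x + b' x\<bar> \<le> U * (32 * (D * D) + 80 * (D * D * D) + 48 * (D * D * D * D))"
      using b' by (simp add: algebra_simps)
    also have "\<dots> \<le> U * (240 * (D * D * (E * E)))"
      by (rule mult_left_mono[OF _ U_nonneg]) (use power_bounds in linarith)
    finally show "\<bar>u3 x * a' x + b' x\<bar> \<le> 240 * (E * E) * (D * D) * U" by (simp add: algebra_simps)
  qed
  define F where "F x = u2 x * (e x * e x) * ?r x" for x
  define F' where "F' x = (u3 x * (e x * e x) + u2 x * (2 * (e x * e1 x))) * ?r x - \<tau> * H x * (?r x * ?r x)" for x
  have dF: "(F has_real_derivative F' x) (at x)" if "x \<in> Om" for x
    unfolding F_def[abs_def] F'_def H_def using that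
    by (auto intro!: derivative_eq_intros der simp: z_def algebra_simps)
  have Fc: "continuous_on {0..1} F"
    unfolding F_def[abs_def] by (intro continuous_intros u2_cont e_cont \<rho>_cont[OF \<tau>])
  have F'c: "continuous_on {0..1} F'"
    unfolding F'_def[abs_def] by (intro continuous_intros u2_cont u3_cont e_cont e1_cont' Hc \<rho>_cont[OF \<tau>])
  have rr: "?r x * (1 + \<tau> * e1 x) = 1" if "x \<in> {0..1}" for x
    using \<rho>_pos[OF \<tau> that] by (simp add: \<rho>_def)
  have Vc: "continuous_on {0..1} ?V" by (rule comp_cont[OF vc])
  have V'c: "continuous_on {0..1} ?V'" by (intro continuous_intros comp_cont[OF v'c] e1_cont')
  have dV: "(?V has_real_derivative ?V' x) (at x)" if "x \<in> Om" for x
    by (rule comp_deriv[OF v(1) \<tau> that])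
  have "(\<integral>x. u2 x * (e x * e x) * v'' (x + \<tau> * e x) \<partial>leb) = (\<integral>x. F x * (v'' (x + \<tau> * e x) * (1 + \<tau> * e1 x)) \<partial>leb)"
  proof (intro Bochner_Integration.integral_cong refl)
    fix x assume "x \<in> space leb"
    then have r1: "?r x * (1 + \<tau> * e1 x) = 1" using rr[of x] by simp
    have "F x * (v'' (x + \<tau> * e x) * (1 + \<tau> * e1 x)) = u2 x * (e x * e x) * v'' (x + \<tau> * e x) * (?r x * (1 + \<tau> * e1 x))"
      unfolding F_def by (simp only: ac_simps)
    then show "u2 x * (e x * e x) * v'' (x + \<tau> * e x) = F x * (v'' (x + \<tau> * e x) * (1 + \<tau> * e1 x))"
      unfolding r1 mult_1_right by (rule sym)
  qed
  also have "\<dots> = - (\<integral>x. F' x * v' (x + \<tau> * e x) \<partial>leb)"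
    by (rule ibp_once[OF Fc _ _ dF v(2,3) integrable_leb_continuous_Icc[OF F'c] \<tau>]) (auto simp: F_def e_0 e_1)
  \<comment> \<open>Inserting \<open>?r x * (1 + \<tau> * e1 x) = 1\<close> restores the total
    derivative \<open>?V'\<close> and sorts the coefficient into the part with \<open>u3\<close> and
    the rest \<open>b\<close>.\<close>
  also have "(\<integral>x. F' x * v' (x + \<tau> * e x) \<partial>leb) = (\<integral>x. u3 x * (a x * ?V' x) + b x * ?V' x \<partial>leb)"
  proof (intro Bochner_Integration.integral_cong refl)
    fix x assume "x \<in> space leb"
    then have r1: "?r x * (1 + \<tau> * e1 x) = 1" using rr[of x] by simp
    have "u3 x * (a x * ?V' x) + b x * ?V' x = F' x * v' (x + \<tau> * e x) * (?r x * (1 + \<tau> * e1 x))"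
      by (simp add: a_def b_def F'_def algebra_simps)
    then show "F' x * v' (x + \<tau> * e x) = u3 x * (a x * ?V' x) + b x * ?V' x"
      unfolding r1 by simp
  qed
  also have "\<dots> = (\<integral>x. u3 x * (a x * ?V' x) \<partial>leb) + (\<integral>x. b x * ?V' x \<partial>leb)"
    by (intro Bochner_Integration.integral_add integrable_leb_continuous_Icc continuous_on_mult u3_cont ac V'c bc)
  also have "(\<integral>x. b x * ?V' x \<partial>leb) = - (\<integral>x. b' x * ?V x \<partial>leb)"
    by (rule ibp_once[OF bc ends(3,4) db v(1) v'c integrable_leb_continuous[OF b'c b'B] \<tau>])
  also have "(\<integral>x. u3 x * (a x * ?V' x) \<partial>leb) = - (\<integral>x. g x * (a x * ?V x) \<partial>leb) - (\<integral>x. u3 x * (a' x * ?V x) \<partial>leb)"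
  proof -
    have gi: "integrable leb g" using g by (rule L2_integrable)
    \<comment> \<open>\<open>W'\<close> is the derivative of \<open>a * ?V\<close>, which vanishes
      at both ends. Hence the constant \<open>c\<close> in \<open>u3\<close> drops out, and
      \<open>prim g\<close> contributes minus the integral of \<open>g * a * ?V\<close>.\<close>
    define W' where "W' x = a x * ?V' x + a' x * ?V x" for x
    have Wc: "continuous_on {0..1} (\<lambda>x. a x * ?V x)" by (intro continuous_on_mult ac Vc)
    have W'c: "continuous_on {0..1} W'" unfolding W'_def[abs_def]
      by (intro continuous_on_add continuous_on_mult ac Vc a'c V'c)
    have dW: "((\<lambda>x. a x * ?V x) has_real_derivative W' x) (at x)" if "x \<in> Om" for x
      unfolding W'_def by (rule DERIV_mult'[OF da[OF that] dV[OF that]])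
    obtain B where B: "\<And>x. x \<in> {0..1} \<Longrightarrow> \<bar>W' x\<bar> \<le> B" using continuous_Icc_bounded[OF W'c] by blast
    have W'm: "W' \<in> borel_measurable leb"
      using integrable_leb_continuous_Icc[OF W'c] by simp
    have p: "(\<integral>x. prim g x * W' x \<partial>leb) = - (\<integral>x. g x * (a x * ?V x) \<partial>leb)"
      using prim_by_parts[OF gi Wc dW W'm, of B] B ends by simp
    have W'0: "(\<integral>x. W' x \<partial>leb) = 0"
      using integral_leb_deriv_Om[OF Wc dW integrable_leb_continuous_Icc[OF W'c]] ends by simp
    have "(\<integral>x. u3 x * (a x * ?V' x) \<partial>leb) = (\<integral>x. (c * W' x + prim g x * W' x) - u3 x * (a' x * ?V x) \<partial>leb)"
    proof (intro Bochner_Integration.integral_cong refl)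
      fix x assume "x \<in> space leb"
      then have "u3 x * W' x = c * W' x + prim g x * W' x" using u3_prim[of x] by (simp add: distrib_right)
      then show "u3 x * (a x * ?V' x) = (c * W' x + prim g x * W' x) - u3 x * (a' x * ?V x)"
        by (simp add: W'_def algebra_simps)
    qed
    also have "\<dots> = (\<integral>x. c * W' x + prim g x * W' x \<partial>leb) - (\<integral>x. u3 x * (a' x * ?V x) \<partial>leb)"
      by (intro Bochner_Integration.integral_diff integrable_leb_continuous_Icc continuous_on_add continuous_on_mult
          continuous_on_const W'c prim_continuous gi u3_cont a'c Vc)
    also have "(\<integral>x. c * W' x + prim g x * W' x \<partial>leb) = (\<integral>x. c * W' x \<partial>leb) + (\<integral>x. prim g x * W' x \<partial>leb)"
      by (intro Bochner_Integration.integral_add integrable_leb_continuous_Icc continuous_on_mult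
          continuous_on_const W'c prim_continuous gi)
    finally show ?thesis using p W'0 by simp
  qed
  finally have eq: "(\<integral>x. u2 x * (e x * e x) * v'' (x + \<tau> * e x) \<partial>leb) =
    (\<integral>x. g x * (a x * ?V x) \<partial>leb) + ((\<integral>x. u3 x * (a' x * ?V x) \<partial>leb) + (\<integral>x. b' x * ?V x \<partial>leb))" by simp
  have aV: "(\<lambda>x. a x * ?V x) \<in> L2" by (intro L2_continuous continuous_on_mult ac Vc)
  have VL2: "?V \<in> L2" by (rule L2_continuous[OF Vc])
  let ?R = "\<lambda>x. u3 x * a' x + b' x"
  have Rc: "continuous_on Om ?R"
    by (intro continuous_on_add continuous_on_mult b'c continuous_on_subset[OF u3_cont] continuous_on_subset[OF a'c]) auto
  have RL2: "?R \<in> L2"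
    by (rule L2_bounded[OF borel_measurable_leb_continuous[OF Rc] R])
  have nn: "0 \<le> 240 * (E * E) * (D * D) * U" "0 \<le> 4 * (D * D)"
    using U_nonneg E_1 D_nonneg by auto
  have Rn: "L2_norm ?R \<le> 240 * (E * E) * (D * D) * U"
    by (rule L2_norm_le_sup[OF RL2 R nn(1)])
  have "(\<integral>x. u3 x * (a' x * ?V x) \<partial>leb) + (\<integral>x. b' x * ?V x \<partial>leb) = (\<integral>x. ?R x * ?V x \<partial>leb)"
  proof -
    obtain K where K: "\<And>x. x \<in> {0..1} \<Longrightarrow> \<bar>?V x\<bar> \<le> K" using continuous_Icc_bounded[OF Vc] by blast
    have "integrable leb (\<lambda>x. b' x * ?V x)"
      by (rule integrable_mult_bounded[OF integrable_leb_continuous[OF b'c b'B], where B = K])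
         (use K VL2 in \<open>auto simp: L2_def\<close>)
    moreover have "integrable leb (\<lambda>x. u3 x * (a' x * ?V x))"
      by (intro integrable_leb_continuous_Icc continuous_on_mult u3_cont a'c Vc)
    ultimately show ?thesis by (simp add: distrib_right mult.assoc)
  qed
  moreover have "\<bar>\<integral>x. ?R x * ?V x \<partial>leb\<bar> \<le> (240 * (E * E) * (D * D) * U) * (2 * L2_norm v)"
    by (rule order_trans[OF L2_inner_le[OF RL2 VL2]]) (intro mult_mono Rn comp_norm[OF vc \<tau>] nn, auto)
  moreover have "\<bar>\<integral>x. g x * (a x * ?V x) \<partial>leb\<bar> \<le> U * (4 * (D * D) * (2 * L2_norm v))"
  proof -
    have "(L2_norm (\<lambda>x. a x * ?V x))\<^sup>2 \<le> (\<integral>x. (4 * (D * D))\<^sup>2 * (?V x)\<^sup>2 \<partial>leb)"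
      unfolding L2_norm_square
    proof (rule integral_mono)
      show "integrable leb (\<lambda>x. (a x * ?V x)\<^sup>2)" using aV by (simp add: L2_def)
      show "integrable leb (\<lambda>x. (4 * (D * D))\<^sup>2 * (?V x)\<^sup>2)" using VL2 by (simp add: L2_def)
      fix x assume "x \<in> space leb"
      then have "\<bar>a x\<bar>\<^sup>2 \<le> (4 * (D * D))\<^sup>2" using aB[of x] by (intro power_mono) auto
      then show "(a x * ?V x)\<^sup>2 \<le> (4 * (D * D))\<^sup>2 * (?V x)\<^sup>2"
        unfolding power_mult_distrib[of "a x"] by (intro mult_right_mono) auto
    qed
    also have "\<dots> = (4 * (D * D) * L2_norm ?V)\<^sup>2" by (simp add: power_mult_distrib L2_norm_square)
    finally have "L2_norm (\<lambda>x. a x * ?V x) \<le> 4 * (D * D) * L2_norm ?V"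
      by (rule power2_le_imp_le) (use nn in simp)
    also have "\<dots> \<le> 4 * (D * D) * (2 * L2_norm v)"
      by (intro mult_left_mono comp_norm[OF vc \<tau>] nn)
    finally show ?thesis
      by (intro order_trans[OF L2_inner_le[OF g aV]] mult_mono g_U) (use U_nonneg in auto)
  qed
  moreover have "U * (4 * (D * D) * (2 * L2_norm v)) \<le> U * (8 * (D * D * (E * E)) * L2_norm v)"
  proof -
    have "4 * (D * D) * (2 * L2_norm v) = 8 * (D * D) * L2_norm v" by simp
    also have "\<dots> \<le> 8 * (D * D * (E * E)) * L2_norm v"
      by (rule mult_right_mono) (use power_bounds in auto)
    finally show ?thesis by (rule mult_left_mono[OF _ U_nonneg])
  qed
  moreover have "0 \<le> U * (D * D * (E * E) * L2_norm v)"
    using U_nonneg power_bounds(5) by (intro mult_nonneg_nonneg[of U] mult_nonneg_nonneg[of _ "L2_norm v"]) auto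
  ultimately show ?thesis unfolding eq by (simp add: algebra_simps)
qed

end

section \<open>Consistency\<close>

text \<open>The function \<open>f s + f (- s)\<close> has derivative \<open>f' s - f' (- s)\<close>,
  which is at most 2 B. The bound is cruder than B t^2 but uniform in t.\<close>

lemma second_difference_le:
  fixes f f' f'' :: "real \<Rightarrow> real"
  assumes f: "\<And>t. (f has_real_derivative f' t) (at t)" and f': "\<And>t. (f' has_real_derivative f'' t) (at t)"
    and B: "\<And>t. \<bar>t\<bar> \<le> 1 \<Longrightarrow> \<bar>f'' t\<bar> \<le> B" and t: "\<bar>t\<bar> \<le> 1"
  shows "\<bar>f t + f (- t) - 2 * f 0\<bar> \<le> 2 * B"
proof -
  have B0: "0 \<le> B" using B[of 0] by simp
  have d: "\<bar>f' s - f' (- s)\<bar> \<le> 2 * B" if s: "\<bar>s\<bar> \<le> 1" for s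
  proof -
    have "norm (f' s - f' (- s)) \<le> B * norm (s - - s)"
      by (rule field_differentiable_bound[of "{-1..1}" f' f'']) (use s B f' in \<open>auto intro: has_field_derivative_at_within\<close>)
    also have "\<dots> \<le> B * 2" using s B0 by (intro mult_left_mono) auto
    finally show ?thesis by simp
  qed
  have "norm ((f t + f (- t)) - (f 0 + f (- 0))) \<le> (2 * B) * norm (t - 0)"
  proof (rule field_differentiable_bound[of "{-1..1}" "\<lambda>s. f s + f (- s)" "\<lambda>s. f' s - f' (- s)"])
    show "((\<lambda>s. f s + f (- s)) has_field_derivative f' s - f' (- s)) (at s within {-1..1})" for s
    proof -
      have "((\<lambda>s. f (- s)) has_real_derivative f' (- s) * - 1) (at s)"
        by (rule DERIV_chain2[OF f]) (auto intro!: derivative_eq_intros)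
      from DERIV_add[OF f[of s] this] show ?thesis by (simp add: has_field_derivative_at_within)
    qed
    show "norm (f' s - f' (- s)) \<le> 2 * B" if "s \<in> {-1..1}" for s using d[of s] that by auto
  qed (use t in auto)
  also have "\<dots> \<le> 2 * B * 1" using t B0 by (intro mult_left_mono) auto
  finally show ?thesis by simp
qed

lemma HK_eq_leb: "continuous_on {0..1} f \<Longrightarrow> integral {0..1} f = (\<integral>x. f x \<partial>leb)" for f :: "real \<Rightarrow> real"
  by (simp add: integral_leb_eq_HK integrable_leb_continuous_Icc)

context consistency
begin

text \<open>Each derivative in the shift parameter brings out one factor \<open>e x\<close>; this is
  the source of smallness in the horizon.\<close>

lemma shift_integral_deriv:
  assumes G: "continuous_on {0..1} G" and w: "\<And>x. (w has_real_derivative w' x) (at x)" and w': "continuous_on UNIV w'"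
  shows "((\<lambda>\<tau>. \<integral>x. G x * w (x + \<tau> * e x) \<partial>leb) has_real_derivative (\<integral>x. G x * e x * w' (x + \<tau> * e x) \<partial>leb)) (at \<tau>)"
proof -
  have wc: "continuous_on UNIV w" using w by (meson DERIV_isCont continuous_at_imp_continuous_on)
  have "((\<lambda>\<tau>. integral (cbox 0 1) (\<lambda>x. G x * w (x + \<tau> * e x))) has_field_derivative
      integral (cbox 0 1) (\<lambda>x. G x * e x * w' (x + \<tau> * e x))) (at \<tau> within UNIV)"
  proof (rule leibniz_rule_field_derivative)
    show "((\<lambda>\<tau>. G x * w (x + \<tau> * e x)) has_field_derivative G x * e x * w' (x + \<tau> * e x)) (at \<tau> within UNIV)" for \<tau> x
      by (auto intro!: derivative_eq_intros DERIV_chain2[OF w])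
    show "(\<lambda>x. G x * w (x + \<tau> * e x)) integrable_on cbox 0 1" for \<tau>
      using integrable_continuous_interval[OF continuous_on_mult[OF G comp_cont[OF wc]]] by simp
    show "continuous_on (UNIV \<times> cbox 0 1) (\<lambda>(\<tau>, x). G x * e x * w' (x + \<tau> * e x))"
      unfolding case_prod_beta'
      by (intro continuous_intros continuous_on_compose2[OF G] continuous_on_compose2[OF e_cont] continuous_on_compose2[OF w']) auto
  qed auto
  moreover have "integral (cbox 0 1) (\<lambda>x. G x * w (x + \<tau> * e x)) = (\<integral>x. G x * w (x + \<tau> * e x) \<partial>leb)" for \<tau>
    using HK_eq_leb[OF continuous_on_mult[OF G comp_cont[OF wc]]] by simp
  moreover have "integral (cbox 0 1) (\<lambda>x. G x * e x * w' (x + \<tau> * e x)) = (\<integral>x. G x * e x * w' (x + \<tau> * e x) \<partial>leb)" for \<tau>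
    using HK_eq_leb[OF continuous_on_mult[OF continuous_on_mult[OF G e_cont] comp_cont[OF w']]] by simp
  ultimately show ?thesis by simp
qed

lemma taylor_remainder:
  assumes x: "x \<in> Om" and t: "\<bar>t\<bar> < 1" "t \<noteq> 0"
  shows "\<bar>diff_quot e u x t - (u1 x + e x * t / 2 * u2 x)\<bar> \<le> D * D * U"
proof -
  let ?s = "e x * t"
  have s0: "?s \<noteq> 0" using e_pos[OF x] t by simp
  \<comment> \<open>Strictness keeps the whole segment from x to the shifted point inside
    \<open>Om\<close>, where the derivatives exist.\<close>
  have se: "\<bar>?s\<bar> < e x" using e_pos[OF x] t by (simp add: abs_mult)
  have y: "x + ?s \<in> Om" using se e_le[OF x] x by auto
  \<comment> \<open>The list encodes the sequence of derivatives of \<open>u\<close> that the Taylor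
    theorem expects.\<close>
  let ?d = "\<lambda>m. [u, u1, u2, u3] ! m"
  have "\<exists>\<xi>. (if x + ?s < x then x + ?s < \<xi> \<and> \<xi> < x else x < \<xi> \<and> \<xi> < x + ?s) \<and>
      u (x + ?s) = (\<Sum>m<3. ?d m x / fact m * (x + ?s - x) ^ m) + ?d 3 \<xi> / fact 3 * (x + ?s - x) ^ 3"
  proof (rule Taylor[where a = "min x (x + ?s)" and b = "max x (x + ?s)"])
    show "\<forall>m t. m < 3 \<and> min x (x + ?s) \<le> t \<and> t \<le> max x (x + ?s) \<longrightarrow> DERIV (?d m) t :> ?d (Suc m) t"
    proof (intro allI impI)
      fix m :: nat and r assume a: "m < 3 \<and> min x (x + ?s) \<le> r \<and> r \<le> max x (x + ?s)"
      then have r: "r \<in> Om" using x y by auto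
      from a have "m = 0 \<or> m = 1 \<or> m = 2" by auto
      then show "DERIV (?d m) r :> ?d (Suc m) r"
        using u_deriv[OF r] u1_deriv[OF r] u2_deriv[OF r] by (auto simp: numeral_2_eq_2)
    qed
  qed (use s0 in auto)
  then obtain \<xi> where \<xi>: "if x + ?s < x then x + ?s < \<xi> \<and> \<xi> < x else x < \<xi> \<and> \<xi> < x + ?s"
    and T: "u (x + ?s) = (\<Sum>m<3. ?d m x / fact m * (x + ?s - x) ^ m) + ?d 3 \<xi> / fact 3 * (x + ?s - x) ^ 3" by blast
  have \<xi>O: "\<xi> \<in> {0..1}" using \<xi> x y by (auto split: if_splits)
  have "u (x + ?s) - u x = u1 x * ?s + u2 x / 2 * ?s\<^sup>2 + u3 \<xi> / 6 * ?s ^ 3"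
    using T by (simp add: numeral_3_eq_3 numeral_2_eq_2 eval_nat_numeral fact_numeral)
  then have "diff_quot e u x t = (u1 x * ?s + u2 x / 2 * ?s\<^sup>2 + u3 \<xi> / 6 * ?s ^ 3) / ?s"
    by (simp add: diff_quot_def)
  also have "\<dots> = u1 x + ?s / 2 * u2 x + u3 \<xi> * (?s * ?s) / 6"
    using s0 by (simp add: field_simps power2_eq_square power3_eq_cube)
  finally have "diff_quot e u x t - (u1 x + ?s / 2 * u2 x) = u3 \<xi> * (?s * ?s) / 6" by simp
  then have "\<bar>diff_quot e u x t - (u1 x + ?s / 2 * u2 x)\<bar> = \<bar>u3 \<xi> * (?s * ?s)\<bar> / 6" by (simp only: abs_divide abs_numeral)
  moreover have "\<bar>u3 \<xi> * (?s * ?s)\<bar> \<le> U * (D * D)"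
    using se e_D[OF x] by (intro abs_mult_le u3_U \<xi>O) auto
  moreover have "0 \<le> U * (D * D)" using U_nonneg by simp
  moreover have "U * (D * D) = D * D * U" by (simp only: ac_simps)
  ultimately show ?thesis by linarith
qed

text \<open>For fixed t, the Taylor part of \<open>u\<close> tested with the quotient of
  \<open>v\<close> gives \<open>P t + (k t - k 0) / 2\<close>, where \<open>P\<close> is a mean of
  \<open>h\<close>, and \<open>h \<tau> = - k \<tau> - \<tau> * l \<tau>\<close> by integration by
  parts. To leading order this is \<open>- k 0\<close>, the local form. The first-order deviations
  are odd in t and cancel against the even kernel measure.\<close>

lemma consistency_smooth:
  assumes u: "lip K u" and v: "lip L v" and v01: "v 0 = 0" "v 1 = 0"
    and dv: "\<And>x. (v has_real_derivative v' x) (at x)" "\<And>x. (v' has_real_derivative v'' x) (at x)"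
    "continuous_on UNIV v''"
  shows "\<bar>form u v + (\<integral>x. u2 x * v x \<partial>leb)\<bar> \<le> 2000 * (E * E) * (D * D) * U * (L2_norm v + sqrt (form v v))"
proof -
  have v'c: "continuous_on UNIV v'" and vc: "continuous_on UNIV v"
    using dv by (meson DERIV_isCont continuous_at_imp_continuous_on)+
  define X where "X = (E * E) * (D * D) * U * L2_norm v"
  have X0: "0 \<le> X" unfolding X_def using U_nonneg by simp
  define k where "k \<tau> = (\<integral>x. u2 x * v (x + \<tau> * e x) \<partial>leb)" for \<tau>
  define k' where "k' \<tau> = (\<integral>x. u2 x * e x * v' (x + \<tau> * e x) \<partial>leb)" for \<tau>
  define k'' where "k'' \<tau> = (\<integral>x. u2 x * e x * e x * v'' (x + \<tau> * e x) \<partial>leb)" for \<tau>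
  define l where "l \<tau> = (\<integral>x. u1 x * e1 x * v' (x + \<tau> * e x) \<partial>leb)" for \<tau>
  define l' where "l' \<tau> = (\<integral>x. u1 x * e1 x * e x * v'' (x + \<tau> * e x) \<partial>leb)" for \<tau>
  define h where "h \<tau> = (\<integral>x. u1 x * v' (x + \<tau> * e x) \<partial>leb)" for \<tau>
  have dk: "(k has_real_derivative k' \<tau>) (at \<tau>)" for \<tau>
    unfolding k_def[abs_def] k'_def by (rule shift_integral_deriv[OF u2_cont dv(1) v'c])
  have dk': "(k' has_real_derivative k'' \<tau>) (at \<tau>)" for \<tau>
    unfolding k'_def[abs_def] k''_def
    by (rule shift_integral_deriv[OF continuous_on_mult[OF u2_cont e_cont] dv(2,3)])
  have dl: "(l has_real_derivative l' \<tau>) (at \<tau>)" for \<tau>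
    unfolding l_def[abs_def] l'_def
    by (rule shift_integral_deriv[OF continuous_on_mult[OF u1_cont e1_cont'] dv(2,3)])
  have dh: "(h has_real_derivative (\<integral>x. u1 x * e x * v'' (x + \<tau> * e x) \<partial>leb)) (at \<tau>)" for \<tau>
    unfolding h_def[abs_def] by (rule shift_integral_deriv[OF u1_cont dv(2,3)])
  have hc: "continuous_on UNIV h" using dh by (meson DERIV_isCont continuous_at_imp_continuous_on)
  have k''_le: "\<bar>k'' \<tau>\<bar> \<le> 500 * X" if "\<bar>\<tau>\<bar> \<le> 1" for \<tau>
    using zeroth_order_term[OF dv that] by (simp add: k''_def X_def mult.assoc)
  have l'_le: "\<bar>l' \<tau>\<bar> \<le> 400 * X" if "\<bar>\<tau>\<bar> \<le> 1" for \<tau>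
    using first_order_term[OF dv that] by (simp add: l'_def X_def mult.assoc)
  have k2: "\<bar>k t + k (- t) - 2 * k 0\<bar> \<le> 1000 * X" if "\<bar>t\<bar> \<le> 1" for t
    using second_difference_le[OF dk dk' k''_le that] by simp
  \<comment> \<open>Since \<open>l\<close> already contains \<open>e1\<close>, one derivative in the
    shift parameter suffices for second order.\<close>
  have l2: "\<bar>t * (l t - l (- t))\<bar> \<le> 800 * X" if t: "\<bar>t\<bar> \<le> 1" for t
  proof -
    have "norm (l t - l (- t)) \<le> (400 * X) * norm (t - - t)"
      by (rule field_differentiable_bound[of "{-1..1}" l l']) (use t l'_le dl in \<open>auto intro: has_field_derivative_at_within\<close>)
    also have "\<dots> \<le> (400 * X) * 2" using t X0 by (intro mult_left_mono) auto
    finally have "\<bar>l t - l (- t)\<bar> \<le> 800 * X" by simp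
    from abs_mult_le[OF t this] show ?thesis by simp
  qed
  \<comment> \<open>Integrate the derivative of \<open>u1 x * v (x + \<tau> * e x)\<close>. The
    Jacobian produces the term with \<open>e1\<close>, and the end values vanish because the shift
    fixes 0 and 1.\<close>
  have h_eq: "h \<tau> = - k \<tau> - \<tau> * l \<tau>" if \<tau>: "\<bar>\<tau>\<bar> \<le> 1" for \<tau>
  proof -
    have i: "integrable leb (\<lambda>x. u1 x * v' (x + \<tau> * e x))" "integrable leb (\<lambda>x. u1 x * e1 x * v' (x + \<tau> * e x))"
      "integrable leb (\<lambda>x. u2 x * v (x + \<tau> * e x))"
      by (intro integrable_leb_continuous_Icc continuous_on_mult u1_cont u2_cont e1_cont' comp_cont v'c vc)+
    have "(\<integral>x. (u1 x * v' (x + \<tau> * e x) + \<tau> * (u1 x * e1 x * v' (x + \<tau> * e x))) + u2 x * v (x + \<tau> * e x) \<partial>leb)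
        = u1 1 * v (1 + \<tau> * e 1) - u1 0 * v (0 + \<tau> * e 0)"
    proof (rule integral_leb_deriv_Om[where F = "\<lambda>x. u1 x * v (x + \<tau> * e x)"])
      show "continuous_on {0..1} (\<lambda>x. u1 x * v (x + \<tau> * e x))" by (intro continuous_on_mult u1_cont comp_cont vc)
      show "((\<lambda>x. u1 x * v (x + \<tau> * e x)) has_real_derivative
          (u1 x * v' (x + \<tau> * e x) + \<tau> * (u1 x * e1 x * v' (x + \<tau> * e x))) + u2 x * v (x + \<tau> * e x)) (at x)" if "x \<in> Om" for x
        using DERIV_mult'[OF u1_deriv[OF that] comp_deriv[OF dv(1) \<tau> that]] by (simp add: algebra_simps)
      show "integrable leb (\<lambda>x. (u1 x * v' (x + \<tau> * e x) + \<tau> * (u1 x * e1 x * v' (x + \<tau> * e x))) + u2 x * v (x + \<tau> * e x))"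
        using i by simp
    qed
    then have "(h \<tau> + \<tau> * l \<tau>) + k \<tau> = 0"
      using i v01 by (simp add: e_0 e_1 h_def l_def k_def)
    then show ?thesis by simp
  qed
  have h2: "\<bar>h t + h (- t) + 2 * k 0\<bar> \<le> 1800 * X" if t: "\<bar>t\<bar> \<le> 1" for t
  proof -
    have "h t + h (- t) + 2 * k 0 = - (k t + k (- t) - 2 * k 0) - t * (l t - l (- t))"
      using h_eq[of t] h_eq[of "- t"] t by (simp add: algebra_simps)
    then show ?thesis using k2[OF t] l2[OF t] by linarith
  qed
  define P where "P t = (\<integral>x. u1 x * diff_quot e v x t \<partial>leb)" for t
  \<comment> \<open>The difference quotient of \<open>v\<close> is the mean of its derivative along
    the segment; exchanging the two integrals turns \<open>P\<close> into a mean of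
    \<open>h\<close>.\<close>
  have P_eq: "P t = integral {0..1} (\<lambda>s. h (s * t))" if t: "t \<noteq> 0" for t
  proof -
    let ?f = "\<lambda>x s. u1 x * v' (x + s * t * e x)"
    have c2: "continuous_on ({0..1} \<times> {0..1}) (\<lambda>(x, s). ?f x s)"
      unfolding case_prod_beta'
      by (intro continuous_intros continuous_on_compose2[OF u1_cont] continuous_on_compose2[OF e_cont] continuous_on_compose2[OF v'c]) auto
    have dq: "u1 x * diff_quot e v x t = integral {0..1} (?f x)" if x: "x \<in> Om" for x
    proof -
      have te: "t * e x \<noteq> 0" using t e_pos[OF x] by simp
      have HI: "((\<lambda>s. u1 x * v' (x + s * t * e x)) has_integral u1 x * v (x + 1 * t * e x) / (t * e x) - u1 x * v (x + 0 * t * e x) / (t * e x)) {0..1}"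
      proof (rule fundamental_theorem_of_calculus)
        fix s :: real
        have "((\<lambda>s. u1 x * v (x + s * t * e x) / (t * e x)) has_real_derivative u1 x * v' (x + s * t * e x)) (at s)"
          using te by (auto intro!: derivative_eq_intros DERIV_chain2[OF dv(1)])
        then show "((\<lambda>s. u1 x * v (x + s * t * e x) / (t * e x)) has_vector_derivative u1 x * v' (x + s * t * e x)) (at s within {0..1})"
          by (simp add: has_real_derivative_iff_has_vector_derivative[symmetric] has_field_derivative_at_within)
      qed simp
      show ?thesis
        unfolding integral_unique[OF HI]
        by (simp add: diff_quot_def right_diff_distrib diff_divide_distrib mult.commute[of "e x"])
    qed
    have c1: "continuous_on {0..1} (\<lambda>x. integral {0..1} (?f x))"
      using integral_continuous_on_param[of "{0..1}" 0 1 ?f] c2 by simp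
    have "P t = (\<integral>x. integral {0..1} (?f x) \<partial>leb)"
      unfolding P_def using dq by (intro Bochner_Integration.integral_cong) auto
    also have "\<dots> = integral {0..1} (\<lambda>x. integral {0..1} (?f x))" by (rule HK_eq_leb[OF c1, symmetric])
    also have "\<dots> = integral {0..1} (\<lambda>s. integral {0..1} (\<lambda>x. ?f x s))"
      using integral_swap_continuous[of 0 0 1 1 ?f] c2 by (simp add: cbox_Pair_eq)
    also have "\<dots> = integral {0..1} (\<lambda>s. h (s * t))"
      unfolding h_def
      by (intro Henstock_Kurzweil_Integration.integral_cong HK_eq_leb continuous_on_mult u1_cont comp_cont v'c)
    finally show ?thesis .
  qed
  have P2: "\<bar>P t + P (- t) + 2 * k 0\<bar> \<le> 1800 * X" if t: "t \<noteq> 0" "\<bar>t\<bar> < 1" for t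
  proof -
    have i: "(\<lambda>s. h (s * r)) integrable_on {0..1}" for r
      by (intro integrable_continuous_interval continuous_on_compose2[OF hc] continuous_intros) auto
    have "((\<lambda>s. h (s * t) + h (s * - t) + 2 * k 0) has_integral P t + P (- t) + 2 * k 0) {0..1}"
      using has_integral_add[OF has_integral_add[OF integrable_integral[OF i[of t]] integrable_integral[OF i[of "- t"]]]
          has_integral_const_real[of "2 * k 0" 0 1]] P_eq[of t] P_eq[of "- t"] t by simp
    then have "norm (P t + P (- t) + 2 * k 0) \<le> 1800 * X * measure lborel (cbox 0 (1::real))"
    proof (intro has_integral_bound[where f = "\<lambda>s. h (s * t) + h (s * - t) + 2 * k 0"])
      fix s :: real assume "s \<in> cbox 0 1"
      then have "\<bar>s * t\<bar> \<le> 1 * 1" unfolding abs_mult using t by (intro mult_mono) auto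
      then show "norm (h (s * t) + h (s * - t) + 2 * k 0) \<le> 1800 * X" using h2[of "s * t"] by simp
    qed (use X0 in auto)
    then show ?thesis by simp
  qed
  \<comment> \<open>The leading two terms of the difference quotient of \<open>u\<close>. The
    remainder is of size \<open>D * D * U\<close> and is paired with the energy of \<open>v\<close>
    by Cauchy-Schwarz.\<close>
  define A where "A p = u1 (fst p) + e (fst p) * snd p / 2 * u2 (fst p)" for p
  have [measurable]: "u1 \<in> borel_measurable leb" "u2 \<in> borel_measurable leb"
    using Om_conts(4,5) borel_measurable_leb_continuous by auto
  have Am: "A \<in> borel_measurable M"
  proof -
    have [measurable]: "(\<lambda>p. snd p) \<in> borel_measurable M" by measurable
    show ?thesis unfolding A_def[abs_def] by measurable
  qed
  have AB: "AE p in M. \<bar>A p\<bar> \<le> U + D * 1 / 2 * U"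
    using AE_M AE_space
  proof eventually_elim
    case (elim p)
    then have x: "fst p \<in> Om" by (simp add: space_pair_measure mem_Times_iff)
    then have "\<bar>e (fst p) * snd p * u2 (fst p)\<bar> \<le> D * 1 * U" using elim
      by (intro abs_mult_le u2_U e_D) auto
    then have "\<bar>e (fst p) * snd p / 2 * u2 (fst p)\<bar> \<le> D * 1 / 2 * U" by simp
    then show ?case unfolding A_def using x by (intro abs_add_le u1_U) auto
  qed
  have um: "dq u \<in> borel_measurable M" by (rule dq_meas[OF lip_cont[OF u]])
  have RB: "AE p in M. \<bar>dq u p - A p\<bar> \<le> D * D * U"
    using AE_M AE_space
  proof eventually_elim
    case (elim p)
    then have "fst p \<in> Om" by (simp add: space_pair_measure mem_Times_iff)
    then show ?case unfolding dq_def A_def using elim by (intro taylor_remainder) auto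
  qed
  have Ai: "integrable M (\<lambda>p. A p * dq v p)" by (rule dq_mult_integrable[OF Am AB v])
  have Ri: "integrable M (\<lambda>p. (dq u p - A p) * dq v p)"
    using Am um by (intro dq_mult_integrable[OF _ RB v]) simp
  have "form u v = (\<integral>p. A p * dq v p + (dq u p - A p) * dq v p \<partial>M)"
    unfolding form_def by (intro Bochner_Integration.integral_cong) (auto simp: algebra_simps)
  also have "\<dots> = (\<integral>p. A p * dq v p \<partial>M) + (\<integral>p. (dq u p - A p) * dq v p \<partial>M)"
    by (rule Bochner_Integration.integral_add[OF Ai Ri])
  finally have form_eq: "form u v = (\<integral>p. A p * dq v p \<partial>M) + (\<integral>p. (dq u p - A p) * dq v p \<partial>M)" .
  have R_le: "\<bar>\<integral>p. (dq u p - A p) * dq v p \<partial>M\<bar> \<le> D * D * U * sqrt (form v v)"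
    using Am um U_nonneg by (intro dq_CS[OF _ RB v]) auto
  \<comment> \<open>With \<open>k 0\<close> added, the mean of \<open>N\<close> is the consistency
    error up to the Taylor remainder.\<close>
  define N where "N t = (\<integral>x. A (x, t) * dq v (x, t) \<partial>leb) + k 0" for t
  have Ai': "integrable M (\<lambda>(x, t). A (x, t) * dq v (x, t))" using Ai by (simp add: case_prod_beta')
  have Ni: "integrable mu N"
    unfolding N_def using integrable_snd[OF Ai'] by simp
  have Nint: "(\<integral>t. N t \<partial>mu) = (\<integral>p. A p * dq v p \<partial>M) + k 0"
    unfolding N_def using integrable_snd[OF Ai'] integral_snd[OF Ai'] emeasure_kernel_measure[OF beta]
    by (simp add: case_prod_beta' measure_def)
  have N_eq: "N t = P t + (k t - k 0) / 2 + k 0" if t: "t \<noteq> 0" "\<bar>t\<bar> < 1" for t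
  proof -
    \<comment> \<open>The linear Taylor term cancels the denominator of the quotient and leaves half
      an increment of \<open>v\<close>.\<close>
    have cdq: "u1 x * diff_quot e v x t = A (x, t) * dq v (x, t) - (u2 x * v (x + t * e x) - u2 x * v x) / 2" if "x \<in> Om" for x
      using e_pos[OF that] t by (simp add: A_def dq_def diff_quot_def field_simps)
    have i: "integrable leb (\<lambda>x. u2 x * v (x + t * e x))" "integrable leb (\<lambda>x. u2 x * v x)"
      by (intro integrable_leb_continuous_Icc continuous_on_mult u2_cont comp_cont vc continuous_on_subset[OF vc] subset_UNIV)+
    have b: "integrable leb (\<lambda>x. u1 x * diff_quot e v x t)"
    proof (rule integrable_mult_bounded[OF integrable_leb_continuous_Icc[OF u1_cont], where B = L])
      have [measurable]: "v \<in> borel_measurable borel" using vc by (rule borel_measurable_continuous_onI)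
      note measurable_ident_leb [measurable]
      show "(\<lambda>x. diff_quot e v x t) \<in> borel_measurable leb" unfolding diff_quot_def by measurable
      show "\<bar>diff_quot e v x t\<bar> \<le> L" if "x \<in> space leb" for x using diff_quot_le[OF v, of x t] that t by simp
    qed
    have "(\<integral>x. A (x, t) * dq v (x, t) \<partial>leb) = (\<integral>x. u1 x * diff_quot e v x t + (u2 x * v (x + t * e x) - u2 x * v x) / 2 \<partial>leb)"
      using cdq by (intro Bochner_Integration.integral_cong) auto
    also have "\<dots> = P t + (k t - k 0) / 2"
      using b i by (simp add: P_def k_def)
    finally show ?thesis by (simp add: N_def)
  qed
  have N2: "\<bar>N t + N (- t)\<bar> \<le> 2300 * X" if t: "t \<noteq> 0" "\<bar>t\<bar> < 1" for t
  proof -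
    have "N t + N (- t) = (P t + P (- t) + 2 * k 0) + (k t + k (- t) - 2 * k 0) / 2"
      using N_eq[of t] N_eq[of "- t"] t by (simp add: field_simps)
    moreover have "\<bar>(k t + k (- t) - 2 * k 0) / 2\<bar> \<le> 500 * X" using k2[of t] t by simp
    note abs_add_le[OF P2[OF t] this]
    ultimately show ?thesis by simp
  qed
  have Nm: "N \<in> borel_measurable borel" using Ni by (simp add: measurable_cong_sets[OF sets_kernel_measure refl] borel_measurable_integrable)
  have Nmi: "integrable mu (\<lambda>t. N (- t))"
  proof -
    have "integrable lborel (\<lambda>t. kernel_weight \<beta> t * N t)"
      using Ni beta Nm unfolding kernel_measure_def by (subst (asm) integrable_density) (auto simp: kernel_weight_nonneg)
    then have "integrable lborel (\<lambda>t. kernel_weight \<beta> (0 + -1 * t) * N (0 + -1 * t))"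
      by (rule lborel_integrable_real_affine) simp
    then show ?thesis
      using beta Nm unfolding kernel_measure_def by (subst integrable_density) (auto simp: kernel_weight_nonneg kernel_weight_minus)
  qed
  \<comment> \<open>The kernel measure is invariant under reflection, so only
    \<open>N t + N (- t)\<close> counts; its bound is 2300 = 1800 + 1000 / 2.\<close>
  have "2 * (\<integral>t. N t \<partial>mu) = (\<integral>t. N t + N (- t) \<partial>mu)"
    using Ni Nmi integral_kernel_measure_minus[OF beta(2) Nm] by simp
  also have "\<bar>\<dots>\<bar> \<le> (\<integral>t. \<bar>N t + N (- t)\<bar> \<partial>mu)" by (rule integral_abs_bound)
  also have "\<dots> \<le> (\<integral>t. 2300 * X \<partial>mu)"
  proof (rule integral_mono_AE)
    show "integrable mu (\<lambda>t. \<bar>N t + N (- t)\<bar>)" using Ni Nmi by simp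
    show "AE t in mu. \<bar>N t + N (- t)\<bar> \<le> 2300 * X"
      using AE_mu by eventually_elim (rule N2, auto)
  qed simp
  also have "\<dots> = 2300 * X" by (rule integral_mu_const)
  finally have "\<bar>\<integral>t. N t \<partial>mu\<bar> \<le> 1150 * X" by simp
  moreover have "k 0 = (\<integral>x. u2 x * v x \<partial>leb)" by (simp add: k_def)
  ultimately have main: "\<bar>form u v + (\<integral>x. u2 x * v x \<partial>leb)\<bar> \<le> 1150 * X + D * D * U * sqrt (form v v)"
    using form_eq Nint R_le by linarith
  \<comment> \<open>Because \<open>E\<close> is at least 1, the remainder can share the prefactor
    \<open>E * E\<close> of the main part.\<close>
  have "1 * (D * D * U * sqrt (form v v)) \<le> (E * E) * (D * D * U * sqrt (form v v))"
  proof (rule mult_right_mono)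
    show "1 \<le> E * E" using mult_mono[OF E_1 E_1] E_1 by simp
    show "0 \<le> D * D * U * sqrt (form v v)" using U_nonneg form_nonneg by simp
  qed
  moreover have "0 \<le> (E * E) * (D * D * U * sqrt (form v v))" using U_nonneg form_nonneg by simp
  ultimately have "1150 * X + D * D * U * sqrt (form v v) \<le> 2000 * X + 2000 * ((E * E) * (D * D * U * sqrt (form v v)))"
    using X0 by linarith
  also have "\<dots> = 2000 * (E * E) * (D * D) * U * (L2_norm v + sqrt (form v v))"
    by (simp add: X_def algebra_simps)
  finally show ?thesis using main by linarith
qed

text \<open>The bound contains no derivative of \<open>v\<close>, so it survives the limit along
  smooth approximations with the same Lipschitz constant.\<close>

lemma consistency_estimate:
  assumes u: "lip K u" and v: "lip L v" and v01: "v 0 = 0" "v 1 = 0"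
  shows "\<bar>form u v + (\<integral>x. u2 x * v x \<partial>leb)\<bar> \<le> 2000 * (E * E) * (D * D) * U * (L2_norm v + sqrt (form v v))"
proof -
  obtain w w' w'' where w: "\<And>n x. (w n has_real_derivative w' n x) (at x)" "\<And>n x. (w' n has_real_derivative w'' n x) (at x)"
    "\<And>n. continuous_on UNIV (w'' n)" "\<And>n. lip L (w n)" "\<And>n. w n 0 = v 0" "\<And>n. w n 1 = v 1"
    "\<And>x. x \<in> {0..1} \<Longrightarrow> (\<lambda>n. w n x) \<longlonglongrightarrow> v x"
    using smooth_lip_approximation[OF v] by metis
  have le: "\<bar>form u (w n) + (\<integral>x. u2 x * w n x \<partial>leb)\<bar> \<le> 2000 * (E * E) * (D * D) * U * (L2_norm (w n) + sqrt (form (w n) (w n)))" for n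
    using w v01 by (intro consistency_smooth[OF u]) auto
  have "(\<lambda>n. L2_norm (w n)) \<longlonglongrightarrow> L2_norm v"
    by (rule L2_limit(1)[OF w(4) v w(5)]) (rule w(7))
  moreover have "(\<lambda>n. \<integral>x. u2 x * w n x \<partial>leb) \<longlonglongrightarrow> (\<integral>x. u2 x * v x \<partial>leb)"
    by (rule L2_limit(2)[OF w(4) v w(5) _ integrable_leb_continuous_Icc[OF u2_cont]]) (rule w(7))
  moreover have "(\<lambda>n. form (w n) (w n)) \<longlonglongrightarrow> form v v"
    by (rule form_limit(1)[OF w(4) v _ u]) (rule w(7))
  moreover have "(\<lambda>n. form u (w n)) \<longlonglongrightarrow> form u v"
    by (rule form_limit(2)[OF w(4) v _ u]) (rule w(7))
  ultimately show ?thesis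
    by (intro LIMSEQ_le[of "\<lambda>n. \<bar>form u (w n) + (\<integral>x. u2 x * w n x \<partial>leb)\<bar>" _
          "\<lambda>n. 2000 * (E * E) * (D * D) * U * (L2_norm (w n) + sqrt (form (w n) (w n)))"] tendsto_intros)
       (use le in auto)
qed

end

section \<open>Piecewise affine functions\<close>

text \<open>Members of \<open>V_h\<close> are arbitrary outside [0,1], whereas \<open>lip\<close>
  asks for continuity on the line; extension by the end values reconciles the two.\<close>

definition clamp01 :: "(real \<Rightarrow> real) \<Rightarrow> real \<Rightarrow> real" where
  "clamp01 f x = f (max 0 (min 1 x))"

lemma clamp01_eq [simp]: "x \<in> {0..1} \<Longrightarrow> clamp01 f x = f x"
  by (simp add: clamp01_def)

lemma lip_clamp01:
  assumes f: "L-lipschitz_on {0..1} f"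
  shows "lip L (clamp01 f)"
  unfolding lip_def
proof (intro conjI ballI)
  have "continuous_on {0..1} f" using f by (rule lipschitz_on_continuous_on)
  then show "continuous_on UNIV (clamp01 f)"
    unfolding clamp01_def[abs_def] by (rule continuous_on_compose2) (auto intro!: continuous_intros)
  show "\<bar>clamp01 f x - clamp01 f y\<bar> \<le> L * \<bar>x - y\<bar>" if "x \<in> {0..1}" "y \<in> {0..1}" for x y
    using lipschitz_onD[OF f that] that by (simp add: dist_real_def)
qed

text \<open>The hypothesis concerns half-open cells, as in \<open>V_h\<close>. Continuity carries
  the bound to the closed cells, and these are joined one by one with the same constant.\<close>

lemma piecewise_lipschitz:
  fixes f :: "real \<Rightarrow> real"
  assumes N: "1 \<le> N" and f: "continuous_on {0..1} f"
    and L: "\<And>i x y. i \<in> {1..N} \<Longrightarrow> (real i - 1) / real N < x \<Longrightarrow> x < y \<Longrightarrow> y \<le> real i / real N \<Longrightarrow>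
      \<bar>f x - f y\<bar> \<le> L * \<bar>x - y\<bar>" and L0: "0 \<le> L"
  shows "L-lipschitz_on {0..1} f"
proof -
  have cell: "L-lipschitz_on {(real i - 1) / real N..real i / real N} f" if i: "i \<in> {1..N}" for i
  proof -
    let ?a = "(real i - 1) / real N" and ?b = "real i / real N"
    have ab: "?a < ?b" using N by (simp add: divide_strict_right_mono)
    have "L-lipschitz_on {?a<..?b} f"
    proof (rule lipschitz_onI[OF _ L0])
      fix x y assume xy: "x \<in> {?a<..?b}" "y \<in> {?a<..?b}"
      consider "x < y" | "y < x" | "x = y" by linarith
      then show "dist (f x) (f y) \<le> L * dist x y"
        using L[OF i, of x y] L[OF i, of y x] xy by cases (auto simp: dist_real_def abs_minus_commute)
    qed
    moreover have cl: "closure {?a<..?b} = {?a..?b}" using ab by (rule closure_greaterThanAtMost)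
    moreover have "continuous_on {?a..?b} f"
      using i N by (intro continuous_on_subset[OF f]) (auto simp: field_simps)
    ultimately show ?thesis using lipschitz_on_closure[of L "{?a<..?b}" f] by simp
  qed
  have "L-lipschitz_on {0..real k / real N} f" if "k \<le> N" for k
    using that
  proof (induction k)
    case 0
    then show ?case using L0 by (auto simp: lipschitz_on_def)
  next
    case (Suc k)
    then have 1: "L-lipschitz_on {0..real k / real N} f" by simp
    have 2: "L-lipschitz_on {real k / real N..real (Suc k) / real N} f" using cell[of "Suc k"] Suc.prems by simp
    show ?case using lipschitz_on_concat[OF 1 2] by simp
  qed
  from this[of N] show ?thesis using N by simp
qed

lemma V_h_lipschitz:
  assumes v: "v \<in> V_h N" and N: "1 \<le> N"
  obtains L where "L-lipschitz_on {0..1} v"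
proof -
  have "\<forall>i\<in>{1..N}. \<exists>b. \<exists>a. \<forall>x\<in>{(real i - 1) / real N<..real i / real N}. v x = a + b * x"
    using v unfolding V_h_def by blast
  then obtain b where b: "\<And>i. i \<in> {1..N} \<Longrightarrow> \<exists>a. \<forall>x\<in>{(real i - 1) / real N<..real i / real N}. v x = a + b i * x"
    by metis
  \<comment> \<open>A crude constant: the estimates use only that some Lipschitz bound exists, never
    its size.\<close>
  let ?L = "\<Sum>i\<in>{1..N}. \<bar>b i\<bar>"
  have "?L-lipschitz_on {0..1} v"
  proof (rule piecewise_lipschitz[OF N])
    show "continuous_on {0..1} v" using v by (simp add: V_h_def)
    show "0 \<le> ?L" by (simp add: sum_nonneg)
    fix i x y assume i: "i \<in> {1..N}" and xy: "(real i - 1) / real N < x" "x < y" "y \<le> real i / real N"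
    obtain a where "\<forall>x\<in>{(real i - 1) / real N<..real i / real N}. v x = a + b i * x" using b[OF i] by blast
    then have "v x - v y = b i * (x - y)" using xy by (simp add: right_diff_distrib)
    then have "\<bar>v x - v y\<bar> = \<bar>b i\<bar> * \<bar>x - y\<bar>" by (simp add: abs_mult)
    also have "\<dots> \<le> ?L * \<bar>x - y\<bar>"
      using i by (intro mult_right_mono member_le_sum) auto
    finally show "\<bar>v x - v y\<bar> \<le> ?L * \<bar>x - y\<bar>" .
  qed
  then show ?thesis using that by blast
qed

lemma V_h_diff:
  assumes u: "u \<in> V_h N" and v: "v \<in> V_h N"
  shows "(\<lambda>x. u x - v x) \<in> V_h N"
proof -
  have "\<exists>a b. \<forall>x\<in>{(real i - 1) / real N<..real i / real N}. u x - v x = a + b * x" if i: "i \<in> {1..N}" for i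
  proof -
    obtain a b where 1: "\<forall>x\<in>{(real i - 1) / real N<..real i / real N}. u x = a + b * x"
      using u i unfolding V_h_def by blast
    obtain c d where 2: "\<forall>x\<in>{(real i - 1) / real N<..real i / real N}. v x = c + d * x"
      using v i unfolding V_h_def by blast
    show ?thesis by (intro exI[of _ "a - c"] exI[of _ "b - d"]) (use 1 2 in \<open>simp add: algebra_simps\<close>)
  qed
  then show ?thesis using u v unfolding V_h_def by (auto intro: continuous_on_diff)
qed

text \<open>A sum of hat functions, which makes continuity immediate; on each cell only two of them
  survive.\<close>

definition interp :: "nat \<Rightarrow> (real \<Rightarrow> real) \<Rightarrow> real \<Rightarrow> real" where
  "interp N u x = (\<Sum>j\<le>N. u (real j / real N) * max 0 (1 - \<bar>real N * x - real j\<bar>))"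

lemma interp_cell:
  assumes N: "1 \<le> N" and i: "i \<in> {1..N}" and x: "(real i - 1) / real N \<le> x" "x \<le> real i / real N"
  shows "interp N u x = u ((real i - 1) / real N) * (real i - real N * x) + u (real i / real N) * (real N * x - (real i - 1))"
proof -
  have Nx: "real i - 1 \<le> real N * x" "real N * x \<le> real i"
    using x N by (auto simp: field_simps)
  have "interp N u x = (\<Sum>j\<in>{i - 1, i}. u (real j / real N) * max 0 (1 - \<bar>real N * x - real j\<bar>))"
    unfolding interp_def
  proof (rule sum.mono_neutral_right)
    show "\<forall>j\<in>{..N} - {i - 1, i}. u (real j / real N) * max 0 (1 - \<bar>real N * x - real j\<bar>) = 0"
    proof
      fix j assume "j \<in> {..N} - {i - 1, i}"
      then have "j + 1 \<le> i - 1 \<or> i + 1 \<le> j" by auto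
      then have "real j + 1 \<le> real i - 1 \<or> real i + 1 \<le> real j" using i by (auto simp: of_nat_diff)
      then have "1 - \<bar>real N * x - real j\<bar> \<le> 0" using Nx by linarith
      then show "u (real j / real N) * max 0 (1 - \<bar>real N * x - real j\<bar>) = 0" by simp
    qed
  qed (use i in auto)
  also have "\<dots> = u (real (i - 1) / real N) * max 0 (1 - \<bar>real N * x - real (i - 1)\<bar>) + u (real i / real N) * max 0 (1 - \<bar>real N * x - real i\<bar>)"
    using i by (subst sum.insert) auto
  also have "real (i - 1) = real i - 1" using i by (simp add: of_nat_diff)
  also have "max 0 (1 - \<bar>real N * x - (real i - 1)\<bar>) = real i - real N * x" using Nx by simp
  also have "max 0 (1 - \<bar>real N * x - real i\<bar>) = real N * x - (real i - 1)" using Nx by simp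
  finally show ?thesis .
qed

lemma interp_V_h:
  assumes N: "1 \<le> N" and u: "u 0 = 0" "u 1 = 0"
  shows "interp N u \<in> V_h N"
  unfolding V_h_def
proof (intro CollectI conjI ballI)
  show "continuous_on {0..1} (interp N u)"
    unfolding interp_def[abs_def] by (intro continuous_intros)
  fix i assume i: "i \<in> {1..N}"
  let ?p = "u ((real i - 1) / real N)" and ?q = "u (real i / real N)"
  show "\<exists>a b. \<forall>x\<in>{(real i - 1) / real N<..real i / real N}. interp N u x = a + b * x"
    by (intro exI[of _ "?p * real i - ?q * (real i - 1)"] exI[of _ "(?q - ?p) * real N"])
       (simp add: interp_cell[OF N i] algebra_simps)
next
  show "interp N u 0 = 0" using interp_cell[OF N, of 1 0 u] N u by simp
  show "interp N u 1 = 0" using interp_cell[OF N, of N 1 u] N u by (simp add: divide_le_eq)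
qed

text \<open>On a cell the slope of the interpolant is \<open>U1 \<xi>\<close> by the mean value
  theorem, and every slope of \<open>U\<close> there differs from it by at most \<open>K\<close>
  times the cell length. Measuring the error by its Lipschitz constant makes \<open>form_le\<close>
  applicable, uniformly in the horizon.\<close>

lemma interp_error_lipschitz:
  assumes N: "1 \<le> N" and U: "continuous_on {0..1} U"
    and dU: "\<And>x. x \<in> Om \<Longrightarrow> (U has_real_derivative U1 x) (at x)"
    and dU1: "\<And>x. x \<in> Om \<Longrightarrow> (U1 has_real_derivative U2 x) (at x)"
    and K: "\<And>x. x \<in> {0..1} \<Longrightarrow> \<bar>U2 x\<bar> \<le> K"
  shows "(K / real N)-lipschitz_on {0..1} (\<lambda>x. U x - interp N U x)"
proof (rule piecewise_lipschitz[OF N])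
  have K0: "0 \<le> K" using K[of 0] by simp
  then show "0 \<le> K / real N" by simp
  show "continuous_on {0..1} (\<lambda>x. U x - interp N U x)"
    unfolding interp_def[abs_def] by (intro continuous_intros U)
  fix i x y assume i: "i \<in> {1..N}" and xy: "(real i - 1) / real N < x" "x < y" "y \<le> real i / real N"
  let ?a = "(real i - 1) / real N" and ?b = "real i / real N"
  have N0: "0 < real N" using N by simp
  have "1 \<le> real i" "real i \<le> real N" using i by auto
  then have ab: "0 \<le> ?a" "?b \<le> 1" "?a < ?b" "?b - ?a = 1 / real N"
    using N0 by (auto simp: divide_strict_right_mono diff_divide_distrib[symmetric])
  have mvt: "\<exists>z. p < z \<and> z < q \<and> U q - U p = (q - p) * U1 z" if pq: "0 \<le> p" "p < q" "q \<le> 1" for p q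
  proof -
    have "\<exists>l z. p < z \<and> z < q \<and> DERIV U z :> l \<and> U q - U p = (q - p) * l"
    proof (rule MVT[OF pq(2)])
      show "continuous_on {p..q} U" using pq by (intro continuous_on_subset[OF U]) auto
      show "U differentiable (at x)" if "p < x" "x < q" for x
        using dU[of x] that pq real_differentiable_def by force
    qed
    then show ?thesis using dU DERIV_unique pq by (metis greaterThanLessThan_iff le_less_trans less_le_trans)
  qed
  obtain \<xi> where \<xi>: "?a < \<xi>" "\<xi> < ?b" "U ?b - U ?a = (?b - ?a) * U1 \<xi>" using mvt[of ?a ?b] ab by auto
  obtain \<zeta> where \<zeta>: "x < \<zeta>" "\<zeta> < y" "U y - U x = (y - x) * U1 \<zeta>" using mvt[of x y] ab xy by auto
  have "interp N U y - interp N U x = real N * (U ?b - U ?a) * (y - x)"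
    using xy by (simp add: interp_cell[OF N i] algebra_simps)
  also have "\<dots> = U1 \<xi> * (y - x)" using \<xi>(3) ab(4) N0 by simp
  finally have I: "interp N U y - interp N U x = U1 \<xi> * (y - x)" .
  have "\<bar>U1 \<zeta> - U1 \<xi>\<bar> \<le> K / real N"
  proof -
    have "norm (U1 \<zeta> - U1 \<xi>) \<le> K * norm (\<zeta> - \<xi>)"
    proof (rule field_differentiable_bound[of Om U1 U2])
      show "(U1 has_field_derivative U2 z) (at z within Om)" if "z \<in> Om" for z
        using dU1[OF that] by (rule has_field_derivative_at_within)
      show "norm (U2 z) \<le> K" if "z \<in> Om" for z using K[of z] that by simp
    qed (use \<xi> \<zeta> ab xy in auto)
    also have "\<dots> \<le> K * (1 / real N)"
      using \<xi> \<zeta> ab xy K0 by (intro mult_left_mono) auto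
    finally show ?thesis by simp
  qed
  moreover have "(U y - interp N U y) - (U x - interp N U x) = (U1 \<zeta> - U1 \<xi>) * (y - x)"
    using I \<zeta>(3) by (simp add: algebra_simps)
  then have "\<bar>(U x - interp N U x) - (U y - interp N U y)\<bar> = \<bar>U1 \<zeta> - U1 \<xi>\<bar> * \<bar>x - y\<bar>"
    by (metis abs_minus_commute abs_mult)
  ultimately show "\<bar>(U x - interp N U x) - (U y - interp N U y)\<bar> \<le> K / real N * \<bar>x - y\<bar>"
    by (simp add: mult_right_mono del: times_divide_eq_left)
qed

section \<open>Admissibility of the localized window\<close>

lemma bdist_eq:
  assumes "x \<in> {0..1}"
  shows "bdist x = min x (1 - x)"
proof -
  have "frontier Om = {0, 1}" by (simp add: frontier_def)
  then have "bdist x = Min (dist x ` {0, 1})"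
    unfolding bdist_def infdist_def by (simp add: cInf_eq_Min)
  also have "\<dots> = min x (1 - x)" using assms by (simp add: dist_real_def)
  finally show ?thesis .
qed

lemma Ck_on_deriv:
  assumes "Ck_on k S f" "j < k" "x \<in> interior S"
  shows "(nderiv S j f has_real_derivative nderiv S (Suc j) f x) (at x)"
  using assms at_within_interior[OF assms(3)] interior_subset unfolding Ck_on_def by (metis subsetD)

lemma Ck_on_continuous: "Ck_on k S f \<Longrightarrow> j \<le> k \<Longrightarrow> continuous_on S (nderiv S j f)"
  unfolding Ck_on_def by blast

text \<open>Doubling is iterated \<open>log 2 k0\<close> times, rounded up at the price of one
  factor \<open>Cq\<close>, and \<open>Cq powr log 2 k0 = k0 powr log 2 Cq\<close>. This is the
  origin of the third entry of the maximum in \<open>delta0\<close>.\<close>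

lemma localization_q_doubling:
  assumes q: "localization_q q Cq" and k0: "1 \<le> k0" and r: "0 < r"
  shows "q (k0 * r) \<le> Cq * k0 powr (log 2 Cq) * r"
proof -
  have Cq: "1 \<le> Cq" and dbl: "\<And>r. 0 < r \<Longrightarrow> q (2 * r) \<le> Cq * q r"
    and q_le: "\<And>r. 0 < r \<Longrightarrow> q r \<le> r" using q by (auto simp: localization_q_def)
  have mono: "q a \<le> q b" if "0 \<le> a" "a \<le> b" for a b
  proof (rule DERIV_nonneg_imp_increasing_open[OF that(2)])
    have ck: "Ck_on 3 {0..} q" using q by (simp add: localization_q_def)
    show "continuous_on {a..b} q"
      using Ck_on_continuous[OF ck, of 0] that by (auto elim: continuous_on_subset)
    fix x assume x: "a < x" "x < b"
    have "(q has_real_derivative nderiv {0..} 1 q x) (at x)"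
      using Ck_on_deriv[OF ck, of 0 x] x that by (simp add: interior_real_atLeast)
    moreover have "0 \<le> nderiv {0..} 1 q x" using q x that by (simp add: localization_q_def)
    ultimately show "\<exists>y. DERIV q x :> y \<and> 0 \<le> y" by blast
  qed
  have pow: "q (2 ^ n * s) \<le> Cq ^ n * q s" if "0 < s" for n s
  proof (induction n)
    case (Suc n)
    have "q (2 ^ Suc n * s) = q (2 * (2 ^ n * s))" by (simp add: mult.assoc)
    also have "\<dots> \<le> Cq * q (2 ^ n * s)" using that by (intro dbl) simp
    also have "\<dots> \<le> Cq * (Cq ^ n * q s)" using Suc Cq by (intro mult_left_mono) auto
    finally show ?case by (simp add: mult.assoc)
  qed simp
  define n where "n = nat \<lceil>log 2 k0\<rceil>"
  have l0: "0 \<le> log 2 k0" using k0 by simp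
  then have n: "log 2 k0 \<le> real n" "real n \<le> 1 + log 2 k0"
    unfolding n_def by linarith+
  have "k0 = 2 powr (log 2 k0)" using k0 by simp
  also have "\<dots> \<le> 2 powr (real n)" using n by (intro powr_mono) auto
  also have "\<dots> = 2 ^ n" by (simp add: powr_realpow)
  finally have k0n: "k0 \<le> 2 ^ n" .
  have "Cq ^ n = Cq powr real n" using Cq by (simp add: powr_realpow)
  also have "\<dots> \<le> Cq powr (1 + log 2 k0)" using n Cq by (intro powr_mono) auto
  also have "\<dots> = Cq * Cq powr (log 2 k0)" using Cq by (simp add: powr_add)
  also have "Cq powr (log 2 k0) = k0 powr (log 2 Cq)"
    using Cq k0 by (simp add: powr_def log_def)
  finally have Cn: "Cq ^ n \<le> Cq * k0 powr (log 2 Cq)" .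
  have "q (k0 * r) \<le> q (2 ^ n * r)" using k0 k0n r by (intro mono mult_right_mono) auto
  also have "\<dots> \<le> Cq ^ n * q r" by (rule pow[OF r])
  also have "\<dots> \<le> Cq ^ n * r" using q_le[OF r] Cq by (intro mult_left_mono) auto
  also have "\<dots> \<le> Cq * k0 powr (log 2 Cq) * r" using Cn r by (intro mult_right_mono) auto
  finally show ?thesis .
qed

text \<open>The radius is a multiple of \<open>\<delta>\<close>, so one \<open>E\<close> serves all
  horizons. The third derivative of \<open>lam\<close> loses two powers of the boundary distance:
  one is regained from \<open>q1 (lam x)\<close>, the other from the factor
  \<open>e x\<close>.\<close>

lemma eta_delta_window:
  assumes \<beta>: "0 < \<beta>" "\<beta> < 3" and pair: "smooth_localization_pair q lam Cq \<kappa>"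
  shows "\<exists>E. \<forall>\<delta>. 0 < \<delta> \<and> \<delta> < delta_star Cq \<kappa> \<longrightarrow>
    (\<exists>e1 e2 e3. window_C3 \<beta> (eta_delta q lam \<delta>) e1 e2 e3 (\<delta> * E) E)"
proof -
  have lq: "localization_q q Cq" and ll: "localization_lam lam \<kappa>" and ck_lam: "Ck_on 3 Om lam"
    using pair by (auto simp: smooth_localization_pair_def localization_pair_def)
  obtain \<kappa>3 where \<kappa>3: "0 < \<kappa>3" "\<And>x. x \<in> Om \<Longrightarrow> \<bar>nderiv Om 3 lam x\<bar> \<le> \<kappa>3 * bdist x powi (-2)"
    using pair by (auto simp: smooth_localization_pair_def)
  have ck_q: "Ck_on 3 {0..} q" using lq by (simp add: localization_q_def)
  obtain Q3 where Q3: "\<And>r. 0 \<le> r \<Longrightarrow> \<bar>nderiv {0..} 3 q r\<bar> \<le> Q3"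
    using lq unfolding localization_q_def bounded_iff by force
  define q1 q2 q3 where "q1 = nderiv {0..} 1 q" and "q2 = nderiv {0..} 2 q" and "q3 = nderiv {0..} 3 q"
  define l1 l2 l3 where "l1 = nderiv Om 1 lam" and "l2 = nderiv Om 2 lam" and "l3 = nderiv Om 3 lam"
  have q_der: "(q has_real_derivative q1 r) (at r)" "(q1 has_real_derivative q2 r) (at r)" "(q2 has_real_derivative q3 r) (at r)"
    if "0 < r" for r
    using Ck_on_deriv[OF ck_q, of 0 r] Ck_on_deriv[OF ck_q, of 1 r] Ck_on_deriv[OF ck_q, of 2 r] that
    by (auto simp: q1_def q2_def q3_def interior_real_atLeast numeral_2_eq_2 numeral_3_eq_3)
  have l_der: "(lam has_real_derivative l1 x) (at x)" "(l1 has_real_derivative l2 x) (at x)" "(l2 has_real_derivative l3 x) (at x)"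
    if "x \<in> Om" for x
    using Ck_on_deriv[OF ck_lam, of 0 x] Ck_on_deriv[OF ck_lam, of 1 x] Ck_on_deriv[OF ck_lam, of 2 x] that
    by (auto simp: l1_def l2_def l3_def interior_open numeral_2_eq_2 numeral_3_eq_3)
  have q_cont: "continuous_on {0..} q" "continuous_on {0..} q1" "continuous_on {0..} q2" "continuous_on {0..} q3"
    using Ck_on_continuous[OF ck_q, of 0] Ck_on_continuous[OF ck_q, of 1] Ck_on_continuous[OF ck_q, of 2] Ck_on_continuous[OF ck_q, of 3]
    by (simp_all add: q1_def q2_def q3_def)
  have l_cont: "continuous_on Om l1" "continuous_on Om l2" "continuous_on Om l3"
    using Ck_on_continuous[OF ck_lam, of 1] Ck_on_continuous[OF ck_lam, of 2] Ck_on_continuous[OF ck_lam, of 3]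
    by (simp_all add: l1_def l2_def l3_def)
  have k: "1 \<le> \<kappa> 0" "0 < \<kappa> 1" "0 < \<kappa> 2" and lam_cont: "continuous_on {0..1} lam"
    and lam_nn: "\<And>x. x \<in> {0..1} \<Longrightarrow> 0 \<le> lam x"
    and lam_b: "\<And>x. x \<in> {0..1} \<Longrightarrow> inverse (\<kappa> 0) * bdist x \<le> lam x \<and> lam x \<le> \<kappa> 0 * bdist x"
    and lj: "\<And>j x. j \<le> 2 \<Longrightarrow> x \<in> Om \<Longrightarrow> \<bar>nderiv Om j lam x\<bar> \<le> \<kappa> j * bdist x powi (1 - int j)"
    using ll unfolding localization_lam_def by auto
  have Cq: "1 \<le> Cq" using lq by (simp add: localization_q_def)
  have q0: "q 0 = 0" "q1 0 = 0" using lq by (auto simp: localization_q_def q1_def)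
  have q_b: "0 < q r" "q r \<le> r" if "0 < r" for r using lq that by (auto simp: localization_q_def)
  have q1_b: "0 \<le> q1 r" "q1 r \<le> 1" and q2_b: "\<bar>q2 r\<bar> \<le> 1" and q3_b: "\<bar>q3 r\<bar> \<le> Q3" if "0 \<le> r" for r
    using lq that Q3[OF that] by (auto simp: localization_q_def q1_def q2_def q3_def)
  \<comment> \<open>From \<open>q1 0 = 0\<close> and \<open>q2 \<le> 1\<close>. This gives the power
    of the boundary distance that offsets the singular derivatives of \<open>lam\<close>.\<close>
  have q1_le: "q1 r \<le> r" if "0 < r" for r
  proof -
    have "\<exists>l z. 0 < z \<and> z < r \<and> DERIV q1 z :> l \<and> q1 r - q1 0 = (r - 0) * l"
    proof (rule MVT[OF that])
      show "continuous_on {0..r} q1" by (rule continuous_on_subset[OF q_cont(2)]) auto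
      show "q1 differentiable (at x)" if "0 < x" for x using q_der(2)[OF that] real_differentiable_def by blast
    qed
    then obtain l z where z: "0 < z" "z < r" "DERIV q1 z :> l" "q1 r = r * l" using q0 by auto
    then have "l = q2 z" using q_der(2)[of z] DERIV_unique by blast
    then have "l \<le> 1" using q2_b[of z] z by auto
    then show ?thesis using z that by (simp add: mult_left_le)
  qed
  let ?d = "\<lambda>x::real. min x (1 - x)"
  have d_pos: "0 < ?d x" "?d x \<le> 1" if "x \<in> Om" for x using that by auto
  have bd: "bdist x = ?d x" if "x \<in> {0..1}" for x using bdist_eq[OF that] .
  have lam_pos: "0 < lam x" and lam_le: "lam x \<le> \<kappa> 0 * ?d x" if x: "x \<in> Om" for x
  proof -
    have b: "bdist x = ?d x" using bd[of x] x by auto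
    have "0 < inverse (\<kappa> 0) * ?d x" using k d_pos[OF x] by (intro mult_pos_pos) auto
    then show "0 < lam x" using lam_b[of x] x unfolding b by auto
    show "lam x \<le> \<kappa> 0 * ?d x" using lam_b[of x] x unfolding b by auto
  qed
  have lam01: "lam 0 = 0" "lam 1 = 0"
    using lam_b[of 0] lam_b[of 1] lam_nn[of 0] lam_nn[of 1] bd[of 0] bd[of 1] by auto
  have l1_b: "\<bar>l1 x\<bar> \<le> \<kappa> 1" and l2_b: "\<bar>l2 x\<bar> \<le> \<kappa> 2 / ?d x" and l3_b: "\<bar>l3 x\<bar> \<le> \<kappa>3 / (?d x * ?d x)" if x: "x \<in> Om" for x
    using lj[of 1 x] lj[of 2 x] \<kappa>3(2)[of x] x bd[of x]
    by (auto simp: l1_def l2_def l3_def power_int_minus divide_inverse power2_eq_square)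
  have Q30: "0 \<le> Q3" using q3_b[of 0] by auto
  \<comment> \<open>\<open>c * \<delta>\<close> will bound \<open>e3\<close> times the boundary
    distance. \<open>E\<close> is a sum of nonnegative terms so that it dominates each constant
    below.\<close>
  define c where "c = Q3 * (\<kappa> 1 * \<kappa> 1 * \<kappa> 1) + 3 * \<kappa> 1 * \<kappa> 2 + \<kappa> 0 * \<kappa>3"
  define E where "E = 1 + \<kappa> 0 + \<kappa> 1 + (\<kappa> 1 * \<kappa> 1 + \<kappa> 0 * \<kappa> 2) + \<kappa> 0 * c"
  have c0: "0 \<le> c" unfolding c_def using k \<kappa>3(1) Q30 by auto
  have Eb: "1 \<le> E" "\<kappa> 0 \<le> E" "\<kappa> 1 \<le> E" "\<kappa> 1 * \<kappa> 1 + \<kappa> 0 * \<kappa> 2 \<le> E" "\<kappa> 0 * c \<le> E"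
    unfolding E_def using k c0 by auto
  show ?thesis
  proof (intro exI[of _ E] allI impI)
    fix \<delta> assume \<delta>: "0 < \<delta> \<and> \<delta> < delta_star Cq \<kappa>"
    \<comment> \<open>From \<open>\<delta> * m \<le> 1 / 3\<close> follow three bounds:
      \<open>\<delta> \<le> 1 / 3\<close> gives \<open>\<delta> * E \<le> E\<close>, the one with
      \<open>\<kappa> 1\<close> gives slope at most 1/3, and the one with \<open>Cq\<close> keeps
      the windows inside the interval.\<close>
    define m where "m = Max {1, \<kappa> 1, Cq * \<kappa> 0 powr log 2 Cq}"
    have m: "1 \<le> m" "\<kappa> 1 \<le> m" "Cq * \<kappa> 0 powr log 2 Cq \<le> m" unfolding m_def by auto
    have "\<delta> < inverse (3 * m)" using \<delta> by (simp add: delta_star_def delta0_def m_def)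
    then have \<delta>m: "\<delta> * m \<le> 1 / 3" using m by (simp add: field_simps)
    have \<delta>1: "\<delta> \<le> 1 / 3" using \<delta>m \<delta> mult_left_mono[OF m(1), of \<delta>] by linarith
    have \<delta>\<kappa>: "\<delta> * \<kappa> 1 \<le> 1 / 3" using \<delta>m \<delta> mult_left_mono[OF m(2), of \<delta>] by linarith
    have \<delta>C: "\<delta> * (Cq * \<kappa> 0 powr log 2 Cq) \<le> 1 / 3" using \<delta>m \<delta> mult_left_mono[OF m(3), of \<delta>] by linarith
    let ?e = "eta_delta q lam \<delta>"
    define e1 where "e1 x = \<delta> * q1 (lam x) * l1 x" for x
    define e2 where "e2 x = \<delta> * (q2 (lam x) * (l1 x * l1 x) + q1 (lam x) * l2 x)" for x
    define e3 where "e3 x = \<delta> * (q3 (lam x) * (l1 x * l1 x * l1 x) + 3 * (q2 (lam x) * (l1 x * l2 x)) + q1 (lam x) * l3 x)" for x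
    have e_def: "?e = (\<lambda>x. \<delta> * q (lam x))" by (auto simp: eta_delta_def)
    have ql_cont: "continuous_on {0..1} (\<lambda>x. q (lam x))" "continuous_on {0..1} (\<lambda>x. q1 (lam x))"
      using lam_nn by (intro continuous_on_compose2[OF q_cont(1) lam_cont], simp add: image_subset_iff)
        (intro continuous_on_compose2[OF q_cont(2) lam_cont], simp add: image_subset_iff lam_nn)
    have lam_contO: "continuous_on Om lam" by (rule continuous_on_subset[OF lam_cont]) auto
    have img: "lam ` Om \<subseteq> {0..}" using lam_pos by (simp add: image_subset_iff less_imp_le)
    have qlO: "continuous_on Om (\<lambda>x. q1 (lam x))" "continuous_on Om (\<lambda>x. q2 (lam x))" "continuous_on Om (\<lambda>x. q3 (lam x))"
      by (rule continuous_on_compose2[OF q_cont(2) lam_contO img] continuous_on_compose2[OF q_cont(3) lam_contO img]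
          continuous_on_compose2[OF q_cont(4) lam_contO img])+
    have q1l: "0 \<le> q1 (lam x)" "q1 (lam x) \<le> 1" "q1 (lam x) \<le> \<kappa> 0 * ?d x" if x: "x \<in> Om" for x
      using q1_b[of "lam x"] q1_le[OF lam_pos[OF x]] lam_pos[OF x] lam_le[OF x] by auto
    have el: "0 < ?e x" "?e x \<le> \<delta> * (\<kappa> 0 * ?d x)" "?e x \<le> ?d x" if x: "x \<in> Om" for x
    proof -
      have ql: "0 < q (lam x)" "q (lam x) \<le> lam x" using q_b[OF lam_pos[OF x]] by auto
      show "0 < ?e x" unfolding e_def using \<delta> ql by simp
      show "?e x \<le> \<delta> * (\<kappa> 0 * ?d x)" unfolding e_def using \<delta> ql lam_le[OF x] by (intro mult_left_mono) auto
      \<comment> \<open>Monotonicity of \<open>q\<close> makes the doubling bound, stated for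
        multiples of the distance, applicable to \<open>lam x\<close>.\<close>
      have mono: "q (lam x) \<le> q (\<kappa> 0 * ?d x)"
      proof (rule DERIV_nonneg_imp_increasing_open[OF lam_le[OF x]])
        show "continuous_on {lam x..\<kappa> 0 * ?d x} q"
          using lam_pos[OF x] by (intro continuous_on_subset[OF q_cont(1)]) auto
        show "\<exists>y. DERIV q r :> y \<and> 0 \<le> y" if "lam x < r" for r
          using q_der(1)[of r] q1_b[of r] lam_pos[OF x] that by (intro exI[of _ "q1 r"]) auto
      qed
      have "?e x \<le> \<delta> * (Cq * \<kappa> 0 powr (log 2 Cq) * ?d x)"
        unfolding e_def using \<delta> mono localization_q_doubling[OF lq k(1) d_pos(1)[OF x]]
        by (intro mult_left_mono) linarith+
      also have "\<dots> = \<delta> * (Cq * \<kappa> 0 powr (log 2 Cq)) * ?d x" by (simp only: mult.assoc)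
      also have "\<dots> \<le> 1 * ?d x" using \<delta>C d_pos[OF x] by (intro mult_right_mono) auto
      finally show "?e x \<le> ?d x" by simp
    qed
    have e1b: "\<bar>e1 x\<bar> \<le> \<delta> * 1 * \<kappa> 1" if x: "x \<in> Om" for x
      unfolding e1_def using \<delta> q1l[OF x] l1_b[OF x] by (intro abs_mult_le) auto
    have t1: "\<bar>q1 (lam x) * l2 x\<bar> \<le> \<kappa> 0 * \<kappa> 2" and t2: "\<bar>q1 (lam x) * l3 x\<bar> \<le> \<kappa> 0 * \<kappa>3 / ?d x" if x: "x \<in> Om" for x
    proof -
      have "\<bar>q1 (lam x) * l2 x\<bar> \<le> (\<kappa> 0 * ?d x) * (\<kappa> 2 / ?d x)"
        using q1l[OF x] l2_b[OF x] by (intro abs_mult_le) auto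
      then show "\<bar>q1 (lam x) * l2 x\<bar> \<le> \<kappa> 0 * \<kappa> 2" using d_pos[OF x] by (simp del: min_def)
      have "\<bar>q1 (lam x) * l3 x\<bar> \<le> (\<kappa> 0 * ?d x) * (\<kappa>3 / (?d x * ?d x))"
        using q1l[OF x] l3_b[OF x] by (intro abs_mult_le) auto
      then show "\<bar>q1 (lam x) * l3 x\<bar> \<le> \<kappa> 0 * \<kappa>3 / ?d x" using d_pos[OF x] by simp
    qed
    have e2b: "\<bar>e2 x\<bar> \<le> \<delta> * (1 * (\<kappa> 1 * \<kappa> 1) + \<kappa> 0 * \<kappa> 2)" if x: "x \<in> Om" for x
      unfolding e2_def using \<delta> q2_b[of "lam x"] lam_pos[OF x]
      by (intro abs_mult_le[of \<delta>] abs_add_le abs_mult_le[of _ 1] abs_mult_le l1_b x t1) auto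
    have e3b: "\<bar>e3 x\<bar> \<le> \<delta> * (c / ?d x)" if x: "x \<in> Om" for x
    proof -
      have "\<bar>e3 x\<bar> \<le> \<delta> * (Q3 * (\<kappa> 1 * \<kappa> 1 * \<kappa> 1) + 3 * (1 * (\<kappa> 1 * (\<kappa> 2 / ?d x))) + \<kappa> 0 * \<kappa>3 / ?d x)"
        unfolding e3_def using \<delta> q3_b[of "lam x"] q2_b[of "lam x"] lam_pos[OF x]
        by (intro abs_mult_le[of \<delta>] abs_add_le abs_mult_le[of "3::real"] abs_mult_le[of _ 1] abs_mult_le[of _ Q3] abs_mult_le l1_b l2_b x t2) auto
      \<comment> \<open>The bounded term is divided by the distance, which is at most 1, to reach a
        common denominator.\<close>
      also have "\<dots> \<le> \<delta> * (Q3 * (\<kappa> 1 * \<kappa> 1 * \<kappa> 1) / ?d x + 3 * (1 * (\<kappa> 1 * (\<kappa> 2 / ?d x))) + \<kappa> 0 * \<kappa>3 / ?d x)"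
      proof -
        have "0 \<le> Q3 * (\<kappa> 1 * \<kappa> 1 * \<kappa> 1)" using Q30 k by simp
        then have "Q3 * (\<kappa> 1 * \<kappa> 1 * \<kappa> 1) \<le> Q3 * (\<kappa> 1 * \<kappa> 1 * \<kappa> 1) / ?d x"
          using d_pos[OF x] by (simp only: le_divide_eq) (auto intro: mult_left_le)
        then show ?thesis using \<delta> by (intro mult_left_mono) auto
      qed
      also have "\<dots> = \<delta> * (c / ?d x)" by (simp add: c_def add_divide_distrib)
      finally show ?thesis .
    qed
    have "window_C3 \<beta> ?e e1 e2 e3 (\<delta> * E) E"
    proof unfold_locales
      show "0 < \<beta>" "\<beta> < 3" by fact+
      show "continuous_on {0..1} ?e" unfolding e_def by (intro continuous_intros ql_cont)
      show "?e 0 = 0" "?e 1 = 0" by (simp_all add: e_def lam01 q0)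
      show "0 < ?e x" if "x \<in> Om" for x by (rule el(1)[OF that])
      show "?e x \<le> x" "?e x \<le> 1 - x" if "x \<in> Om" for x using el(3)[OF that] by auto
      have ch: "((\<lambda>x. q (lam x)) has_real_derivative q1 (lam x) * l1 x) (at x)"
        "((\<lambda>x. q1 (lam x)) has_real_derivative q2 (lam x) * l1 x) (at x)"
        "((\<lambda>x. q2 (lam x)) has_real_derivative q3 (lam x) * l1 x) (at x)" if "x \<in> Om" for x
        by (rule DERIV_chain2[OF q_der(1) l_der(1)] DERIV_chain2[OF q_der(2) l_der(1)] DERIV_chain2[OF q_der(3) l_der(1)];
            use that lam_pos in simp)+
      show "(?e has_real_derivative e1 x) (at x)" if "x \<in> Om" for x
        unfolding e_def e1_def using DERIV_cmult[OF ch(1)[OF that], of \<delta>] by (simp add: mult.assoc)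
      show "(e1 has_real_derivative e2 x) (at x)" if "x \<in> Om" for x
      proof -
        have "((\<lambda>x. \<delta> * (q1 (lam x) * l1 x)) has_real_derivative
            \<delta> * (q1 (lam x) * l2 x + q2 (lam x) * l1 x * l1 x)) (at x)"
          by (intro DERIV_cmult DERIV_mult' ch l_der that)
        then show ?thesis by (simp add: e1_def[abs_def] e2_def algebra_simps)
      qed
      show "(e2 has_real_derivative e3 x) (at x)" if "x \<in> Om" for x
      proof -
        have "((\<lambda>x. \<delta> * (q2 (lam x) * (l1 x * l1 x) + q1 (lam x) * l2 x)) has_real_derivative
            \<delta> * ((q2 (lam x) * (l1 x * l2 x + l2 x * l1 x) + q3 (lam x) * l1 x * (l1 x * l1 x))
              + (q1 (lam x) * l3 x + q2 (lam x) * l1 x * l2 x))) (at x)"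
          by (intro DERIV_cmult DERIV_add DERIV_mult' ch l_der that)
        moreover have "\<delta> * ((q2 (lam x) * (l1 x * l2 x + l2 x * l1 x) + q3 (lam x) * l1 x * (l1 x * l1 x))
              + (q1 (lam x) * l3 x + q2 (lam x) * l1 x * l2 x)) = e3 x"
          by (simp add: e3_def algebra_simps)
        ultimately show ?thesis by (simp only: e2_def[abs_def])
      qed
      have c: "continuous_on {0..1} (\<lambda>x. (\<delta> * q1 (lam x)) * l1 x)"
        by (rule continuous_vanishing_mult_bounded[where B = "\<kappa> 1", OF _ _ _ l_cont(1) l1_b])
           (auto intro!: continuous_intros ql_cont simp: lam01 q0)
      then show "continuous_on {0..1} e1" by (simp add: e1_def[abs_def])
      then show "continuous_on Om e1" by (rule continuous_on_subset) auto
      show "e1 0 = 0" "e1 1 = 0" by (simp_all add: e1_def lam01 q0)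
      show "continuous_on Om e3" unfolding e3_def[abs_def] by (intro continuous_intros qlO l_cont)
      show "\<bar>e1 x\<bar> \<le> 1 / 3" if "x \<in> Om" for x using e1b[OF that] \<delta>\<kappa> by simp
      show "\<bar>e1 x\<bar> \<le> \<delta> * E" if "x \<in> Om" for x
        using order_trans[OF e1b[OF that, unfolded mult_1_right] mult_left_mono[OF Eb(3)]] \<delta> by simp
      show "\<bar>e2 x\<bar> \<le> \<delta> * E" if "x \<in> Om" for x
        using order_trans[OF e2b[OF that, unfolded mult_1_left] mult_left_mono[OF Eb(4)]] \<delta> by simp
      show "\<bar>?e x\<bar> \<le> \<delta> * E" if x: "x \<in> Om" for x
      proof -
        have "\<kappa> 0 * ?d x \<le> \<kappa> 0 * 1" using k d_pos[OF x] by (intro mult_left_mono) auto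
        then have "\<delta> * (\<kappa> 0 * ?d x) \<le> \<delta> * E" using Eb(2) \<delta> by (intro mult_left_mono) auto
        then show ?thesis using el(1,2)[OF x] by simp
      qed
      show "\<bar>?e x * e3 x\<bar> \<le> \<delta> * E * (\<delta> * E)" if x: "x \<in> Om" for x
      proof -
        \<comment> \<open>The distance in the bound for the radius cancels the one in the bound for
          \<open>e3\<close>.\<close>
        have "\<bar>?e x * e3 x\<bar> \<le> (\<delta> * (\<kappa> 0 * ?d x)) * (\<delta> * (c / ?d x))"
          using el(1,2)[OF x] by (intro abs_mult_le e3b x) auto
        also have "\<dots> = \<delta> * \<delta> * (\<kappa> 0 * c)"
          using less_imp_neq[OF d_pos(1)[OF x]] by (simp del: min_less_iff_conj)
        also have "\<dots> \<le> \<delta> * \<delta> * (E * E)"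
        proof (rule mult_left_mono)
          have "1 * E \<le> E * E" using Eb(1) by (intro mult_right_mono) auto
          then show "\<kappa> 0 * c \<le> E * E" using Eb(5) by linarith
        qed simp
        finally show ?thesis by (simp add: ac_simps)
      qed
      show "\<delta> * E \<le> E" using \<delta>1 Eb(1) by simp
      show "1 \<le> E" by (rule Eb(1))
    qed
    then show "\<exists>e1 e2 e3. window_C3 \<beta> ?e e1 e2 e3 (\<delta> * E) E" by blast
  qed
qed

section \<open>The error estimate\<close>

context window
begin

lemma form_diff_diff_le:
  assumes u: "lip K u" and v: "lip L v"
  shows "form (\<lambda>x. u x - v x) (\<lambda>x. u x - v x) \<le> 2 * form u u + 2 * form v v"
proof -
  have "form (\<lambda>x. u x - v x) (\<lambda>x. u x - v x) = (\<integral>p. (dq u p - dq v p)\<^sup>2 \<partial>M)"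
    by (simp add: form_def dq_diff power2_eq_square)
  also have "\<dots> \<le> (\<integral>p. 2 * (dq u p * dq u p) + 2 * (dq v p * dq v p) \<partial>M)"
  proof (rule integral_mono)
    show "integrable M (\<lambda>p. (dq u p - dq v p)\<^sup>2)"
      using dq_integrable[OF lip_diff[OF u v] lip_diff[OF u v]] by (simp add: dq_diff power2_eq_square)
    show "integrable M (\<lambda>p. 2 * (dq u p * dq u p) + 2 * (dq v p * dq v p))"
      using dq_integrable[OF u u] dq_integrable[OF v v] by simp
    show "(dq u p - dq v p)\<^sup>2 \<le> 2 * (dq u p * dq u p) + 2 * (dq v p * dq v p)" for p
      using zero_le_power2[of "dq u p + dq v p"] by (simp add: power2_eq_square algebra_simps)
  qed
  also have "\<dots> = 2 * form u u + 2 * form v v"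
    using dq_integrable[OF u u] dq_integrable[OF v v] by (simp add: form_def)
  finally show ?thesis .
qed

end

lemma L2_norm_diff_square_le:
  assumes u: "u \<in> L2" and v: "v \<in> L2"
  shows "(L2_norm (\<lambda>x. u x - v x))\<^sup>2 \<le> 2 * (L2_norm u)\<^sup>2 + 2 * (L2_norm v)\<^sup>2"
proof -
  have "(L2_norm (\<lambda>x. u x - v x))\<^sup>2 \<le> (\<integral>x. 2 * (u x)\<^sup>2 + 2 * (v x)\<^sup>2 \<partial>leb)"
    unfolding L2_norm_square
  proof (rule integral_mono)
    show "integrable leb (\<lambda>x. (u x - v x)\<^sup>2)" using L2_diff[OF u v] by (simp add: L2_def)
    show "integrable leb (\<lambda>x. 2 * (u x)\<^sup>2 + 2 * (v x)\<^sup>2)" using u v by (simp add: L2_def)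
    show "(u x - v x)\<^sup>2 \<le> 2 * (u x)\<^sup>2 + 2 * (v x)\<^sup>2" for x
      using zero_le_power2[of "u x + v x"] by (simp add: power2_eq_square algebra_simps)
  qed
  also have "\<dots> = 2 * (L2_norm u)\<^sup>2 + 2 * (L2_norm v)\<^sup>2"
    using u v by (simp add: L2_def L2_norm_square)
  finally show ?thesis .
qed

lemma L2_norm_AE:
  assumes "AE x in leb. f x = g x" "f \<in> borel_measurable leb" "g \<in> borel_measurable leb"
  shows "L2_norm f = L2_norm g"
  unfolding L2_norm_eq using assms by (intro arg_cong[where f = sqrt] integral_cong_AE) auto

text \<open>The error is \<open>ec - w\<close>, where \<open>ec\<close> agrees on [0,1] with a
  member of \<open>V_h\<close> and can be used for testing, and \<open>w\<close> is the
  interpolation error. The energy of \<open>ec\<close> splits into the consistency error and a term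
  with \<open>w\<close>. The Poincare inequality replaces the L2 norm of \<open>ec\<close> in the
  consistency bound by its energy norm \<open>s\<close>, after which one factor \<open>s\<close>
  cancels.\<close>

lemma galerkin_error:
  assumes win: "window_C3 \<beta> (eta_delta q lam \<delta>) e1 e2 e3 (\<delta> * E) E"
    and \<delta>: "0 < \<delta>" and N: "1 \<le> N" and f: "f \<in> L2"
    and sol: "local_solution f u0" and u0: "u0 \<in> Hk 4" and dis: "discrete_solution \<beta> q lam \<delta> N f uh"
  shows "W_norm \<beta> q lam \<delta> (\<lambda>x. uh x - u0 x) \<le>
    (sqrt (2 + 40 * kernel_moment \<beta>) * (4000 * (E * E) * (E * E) * (sqrt (20 * kernel_moment \<beta>) + 1) + 2) + 4)
      * (1 / real N + \<delta>\<^sup>2) * Hk_norm 4 u0"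
    and "L2_norm (\<lambda>x. uh x - u0 x) \<le> W_norm \<beta> q lam \<delta> (\<lambda>x. uh x - u0 x)"
proof -
  let ?e = "eta_delta q lam \<delta>" and ?H = "Hk_norm 4 u0"
  interpret W: window_C3 \<beta> ?e e1 e2 e3 "\<delta> * E" E by (rule win)
  obtain U U1 U2 U3 g c0 c where U: "continuous_on {0..1} U" "continuous_on {0..1} U1" "continuous_on {0..1} U2" "continuous_on {0..1} U3"
    "\<And>x. x \<in> Om \<Longrightarrow> (U has_real_derivative U1 x) (at x)"
    "\<And>x. x \<in> Om \<Longrightarrow> (U1 has_real_derivative U2 x) (at x)"
    "\<And>x. x \<in> Om \<Longrightarrow> (U2 has_real_derivative U3 x) (at x)"
    and U_prim: "\<And>x. x \<in> {0..1} \<Longrightarrow> U x = c0 + prim U1 x"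
    and g: "g \<in> L2" "\<And>x. x \<in> {0..1} \<Longrightarrow> U3 x = c + prim g x"
    and ae: "AE x in leb. u0 x = U x" "AE x in leb. weak_deriv 2 u0 x = U2 x"
    and bnd: "\<And>x. x \<in> {0..1} \<Longrightarrow> \<bar>U1 x\<bar> \<le> 2 * ?H" "\<And>x. x \<in> {0..1} \<Longrightarrow> \<bar>U2 x\<bar> \<le> 2 * ?H"
      "\<And>x. x \<in> {0..1} \<Longrightarrow> \<bar>U3 x\<bar> \<le> 2 * ?H" "L2_norm g \<le> ?H"
    by (rule H4_representative[OF u0]) (rule that; assumption)
  have H0: "0 \<le> ?H" by simp
  have u0H: "u0 \<in> H10" and wk: "is_weak_deriv 2 u0 (\<lambda>x. - f x)" using sol by (auto simp: local_solution_def)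
  have U01: "U 0 = 0" "U 1 = 0"
    using H10_boundary[OF u0H ae(1) U_prim integrable_leb_continuous_Icc[OF U(2)]] by auto
  have mf: "(\<lambda>x. - f x) \<in> L2" using f by (simp add: L2_def)
  \<comment> \<open>Both \<open>- f\<close> and \<open>weak_deriv 2 u0\<close> are weak second
    derivatives of \<open>u0\<close>, hence equal almost everywhere.\<close>
  have fU2: "AE x in leb. f x = - U2 x"
    using weak_deriv_AE_unique[OF wk Hk_weak_deriv(2)[OF u0, of 2, simplified] mf Hk_weak_deriv(1)[OF u0, of 2, simplified]] ae(2)
    by eventually_elim simp
  define u where "u = clamp01 U"
  have u_eq: "u x = U x" if "x \<in> {0..1}" for x using that by (simp add: u_def)
  have U_lip: "(2 * ?H)-lipschitz_on {0..1} U"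
  \<comment> \<open>A single cell: the mean value theorem covers points above 0, and continuity
    supplies the left end point.\<close>
  proof (rule piecewise_lipschitz[of 1])
    fix i x y assume i: "i \<in> {1..1::nat}" "(real i - 1) / real 1 < x" "x < y" "y \<le> real i / real 1"
    then have xy: "0 < x" "x < y" "y \<le> 1" by auto
    have "\<exists>l z. x < z \<and> z < y \<and> DERIV U z :> l \<and> U y - U x = (y - x) * l"
    proof (rule MVT[OF xy(2)])
      show "continuous_on {x..y} U" using xy by (intro continuous_on_subset[OF U(1)]) auto
      show "U differentiable (at z)" if "x < z" "z < y" for z
        using U(5)[of z] that xy real_differentiable_def by force
    qed
    then obtain l z where z: "x < z" "z < y" "DERIV U z :> l" "U y - U x = (y - x) * l" by blast
    then have "l = U1 z" using U(5)[of z] xy DERIV_unique by force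
    then have "\<bar>l\<bar> \<le> 2 * ?H" using bnd(1)[of z] z xy by simp
    then have "\<bar>(y - x) * l\<bar> \<le> \<bar>y - x\<bar> * (2 * ?H)" by (intro abs_mult_le) auto
    then show "\<bar>U x - U y\<bar> \<le> 2 * ?H * \<bar>x - y\<bar>"
      using z(4) by (simp add: abs_minus_commute mult.commute)
  qed (use U(1) H0 in auto)
  have lu: "lip (2 * ?H) u" unfolding u_def by (rule lip_clamp01[OF U_lip])
  interpret C: consistency \<beta> ?e e1 e2 e3 "\<delta> * E" E u U1 U2 U3 g c "2 * ?H"
  proof unfold_locales
    show "(u has_real_derivative U1 x) (at x)" if x: "x \<in> Om" for x
    proof -
      have ev: "\<forall>\<^sub>F y in nhds x. u y = U y"
        using eventually_nhds_in_open[of Om x] x by (auto elim!: eventually_mono intro: u_eq)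
      show ?thesis using DERIV_cong_ev[OF refl ev refl] U(5)[OF x] by simp
    qed
    show "L2_norm g \<le> 2 * ?H" using bnd(4) H0 by linarith
  qed (use U g bnd in auto)
  have uhV: "uh \<in> V_h N" and weak: "\<And>v. v \<in> V_h N \<Longrightarrow> B_delta \<beta> q lam \<delta> uh v = L2_inner f v"
    using dis by (auto simp: discrete_solution_def)
  define eV where "eV x = uh x - interp N U x" for x
  have eVV: "eV \<in> V_h N" unfolding eV_def[abs_def] by (intro V_h_diff uhV interp_V_h N U01)
  obtain L1 where L1: "L1-lipschitz_on {0..1} uh" using V_h_lipschitz[OF uhV N] .
  obtain L2' where L2': "L2'-lipschitz_on {0..1} eV" using V_h_lipschitz[OF eVV N] .
  define vh where "vh = clamp01 uh"
  define ec where "ec = clamp01 eV"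
  define w where "w = clamp01 (\<lambda>x. U x - interp N U x)"
  let ?K = "2 * ?H / real N"
  have lvh: "lip L1 vh" and lec: "lip L2' ec" unfolding vh_def ec_def by (rule lip_clamp01[OF L1] lip_clamp01[OF L2'])+
  have lw: "lip ?K w" unfolding w_def
    by (rule lip_clamp01[OF interp_error_lipschitz[OF N U(1) U(5) U(6) bnd(2)]])
  \<comment> \<open>Written as a difference with \<open>- w\<close>, because linearity of the form
    is available for differences.\<close>
  have ec_eq: "ec = (\<lambda>x. (vh x - u x) - (\<lambda>x. - w x) x)"
    unfolding ec_def vh_def u_def w_def by (auto simp: clamp01_def eV_def)
  have K0: "0 \<le> ?K" using H0 by simp
  have err_eq: "vh x - u x = ec x - w x" for x unfolding ec_eq by simp
  have ec01: "ec 0 = 0" "ec 1 = 0" using eVV by (auto simp: ec_def V_h_def)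
  have w0: "w 0 = 0"
    using interp_V_h[OF N U01] by (simp add: w_def V_h_def U01)
  note cond = W.beta(1) W.beta(2)
  have rcond: "0 < ?e x \<and> ?e x \<le> x \<and> ?e x \<le> 1 - x" if "x \<in> Om" for x
    using W.e_pos[OF that] W.e_le[OF that] by blast
  have form_eq: "W.form a b = (\<integral>x. (\<integral>t. diff_quot ?e a x t * diff_quot ?e b x t \<partial>kernel_measure \<beta>) \<partial>leb)"
    if "lip Ka a" "lip Kb b" for a b Ka Kb
  proof -
    have "integrable (leb \<Otimes>\<^sub>M kernel_measure \<beta>) (\<lambda>(x, t). diff_quot ?e a x t * diff_quot ?e b x t)"
      using W.dq_integrable[OF that] by (simp add: W.dq_def case_prod_beta')
    from W.integral_fst[OF this] show ?thesis
      by (simp add: W.form_def W.dq_def case_prod_beta')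
  qed
  have B_eq: "B_delta \<beta> q lam \<delta> a b = W.form a' b'"
    if "a \<in> borel_measurable leb" "b \<in> borel_measurable leb" "AE x in leb. a x = a' x" "AE x in leb. b x = b' x"
      "lip Ka a'" "lip Kb b'" for a b a' b' Ka Kb
    using B_delta_eq[OF cond rcond W.e_meas that(1,2) W.lip_cont[OF that(5)] W.lip_cont[OF that(6)] that(3,4)]
      form_eq[OF that(5,6)] by simp
  have uhL2: "uh \<in> L2" and eVL2: "eV \<in> L2"
    using uhV eVV by (auto simp: V_h_def intro: L2_continuous)
  have u0L2: "u0 \<in> L2" using u0 by (simp add: Hk_def)
  have ae_vh: "AE x in leb. uh x = vh x" and ae_ec: "AE x in leb. eV x = ec x"
    by (auto simp: vh_def ec_def intro!: AE_I2)
  have ae_z: "AE x in leb. uh x - u0 x = vh x - u x"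
    using ae(1) AE_space by eventually_elim (auto simp: vh_def u_def)
  define s where "s = sqrt (W.form ec ec)"
  have s0: "0 \<le> s" unfolding s_def using W.form_nonneg by simp
  have s2: "s\<^sup>2 = W.form ec ec" unfolding s_def using W.form_nonneg by simp
  define p where "p = sqrt (20 * kernel_moment \<beta>)"
  have p0: "0 \<le> p" by (simp add: p_def)
  have poinc: "(L2_norm ec)\<^sup>2 \<le> 20 * kernel_moment \<beta> * s\<^sup>2"
    using W.poincare[OF lec ec01(1)] by (simp add: s2)
  have "(L2_norm ec)\<^sup>2 \<le> (p * s)\<^sup>2" using poinc by (simp add: p_def power_mult_distrib)
  then have poinc': "L2_norm ec \<le> p * s" by (rule power2_le_imp_le) (use p0 s0 in simp)
  have lw': "lip ?K (\<lambda>x. - w x)"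
    using lw unfolding lip_def by (auto intro: continuous_intros simp: abs_minus_commute)
  \<comment> \<open>The discrete equation tested with \<open>eV\<close>. Since f = -U2 almost
    everywhere, its right-hand side cancels the main term of the consistency estimate.\<close>
  have "W.form vh ec = L2_inner f eV"
    using B_eq[OF _ _ ae_vh ae_ec lvh lec] weak[OF eVV] uhL2 eVL2 by (simp add: L2_def)
  also have "\<dots> = (\<integral>x. - (U2 x * ec x) \<partial>leb)"
    unfolding L2_inner_def
  proof (rule integral_cong_AE)
    have [measurable]: "f \<in> borel_measurable leb" "eV \<in> borel_measurable leb" "U2 \<in> borel_measurable leb"
      "ec \<in> borel_measurable leb"
      using f eVL2 L2_continuous[OF U(3)] lip_L2[OF lec] by (auto simp: L2_def)
    show "(\<lambda>x. f x * eV x) \<in> borel_measurable leb" "(\<lambda>x. - (U2 x * ec x)) \<in> borel_measurable leb"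
      by measurable
    show "AE x in leb. f x * eV x = - (U2 x * ec x)"
      using fU2 ae_ec by eventually_elim simp
  qed
  finally have vh_ec: "W.form vh ec = - (\<integral>x. U2 x * ec x \<partial>leb)" by simp
  have split: "W.form ec ec = W.form vh ec - W.form u ec + W.form w ec"
  proof -
    have "W.form ec ec = W.form (\<lambda>x. vh x - u x) ec - W.form (\<lambda>x. - w x) ec"
      using W.form_diff_left[OF lip_diff[OF lvh lu] lw' lec] by (simp only: ec_eq[symmetric])
    moreover have "W.form (\<lambda>x. vh x - u x) ec = W.form vh ec - W.form u ec"
      by (rule W.form_diff_left[OF lvh lu lec])
    moreover have "W.form (\<lambda>x. - w x) ec = - W.form w ec"
    proof -
      have "W.dq (\<lambda>x. - w x) pt = - W.dq w pt" for pt
        unfolding W.dq_def diff_quot_def by (simp add: minus_divide_left)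
      then show ?thesis by (simp add: W.form_def)
    qed
    ultimately show ?thesis by simp
  qed
  have cons: "\<bar>W.form u ec + (\<integral>x. U2 x * ec x \<partial>leb)\<bar> \<le>
      2000 * (E * E) * (\<delta> * E * (\<delta> * E)) * (2 * ?H) * (L2_norm ec + s)"
    using C.consistency_estimate[OF lu lec ec01] by (simp only: s_def)
  define Q where "Q = 2000 * (E * E) * (\<delta> * E * (\<delta> * E)) * (2 * ?H)"
  have Q0: "0 \<le> Q" unfolding Q_def using less_imp_le[OF \<delta>] H0 by (intro mult_nonneg_nonneg) (auto intro: order_trans[OF zero_le_one W.E_1])
  have "Q * (L2_norm ec + s) \<le> Q * (p * s + s)" using poinc' Q0 by (intro mult_left_mono) auto
  then have cons': "\<bar>W.form u ec + (\<integral>x. U2 x * ec x \<partial>leb)\<bar> \<le> Q * (p * s + s)"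
    using cons unfolding Q_def by linarith
  have ww: "W.form w w \<le> ?K\<^sup>2" by (rule W.form_le[OF lw])
  then have "sqrt (W.form w w) \<le> sqrt (?K\<^sup>2)" by (rule real_sqrt_le_mono)
  then have "sqrt (W.form w w) \<le> ?K" using K0 by simp
  then have "sqrt (W.form w w) * s \<le> ?K * s" using s0 by (rule mult_right_mono)
  then have wec: "\<bar>W.form w ec\<bar> \<le> ?K * s" using W.form_CS[OF lw lec] unfolding s_def by linarith
  have "s * s \<le> Q * (p * s + s) + ?K * s"
    using split vh_ec cons' wec s2 unfolding power2_eq_square by linarith
  also have "\<dots> = (Q * (p + 1) + ?K) * s" by (simp add: algebra_simps)
  finally have "s * s \<le> (Q * (p + 1) + ?K) * s" .
  then have s_le: "s \<le> Q * (p + 1) + ?K"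
    using s0 Q0 p0 K0 by (cases "s = 0") (auto simp: mult_le_cancel_right)
  let ?T = "1 / real N + \<delta>\<^sup>2"
  have N0: "0 \<le> 1 / real N" by simp
  have T0: "0 \<le> ?T" by simp
  \<comment> \<open>4000 is 2000 times the 2 in the bound \<open>2 * ?H\<close> for the derivatives
    of \<open>U\<close>; the second \<open>E * E\<close> comes from
    \<open>\<delta> * E * (\<delta> * E)\<close>.\<close>
  define A where "A = 4000 * (E * E) * (E * E) * (p + 1)"
  have A0: "0 \<le> A" unfolding A_def using p0 by simp
  have "Q * (p + 1) = A * \<delta>\<^sup>2 * ?H" by (simp add: Q_def A_def power2_eq_square ac_simps)
  also have "\<dots> \<le> A * ?T * ?H" using A0 H0 N0 by (intro mult_right_mono mult_left_mono) auto
  finally have Qp: "Q * (p + 1) \<le> A * ?T * ?H" .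
  have "2 * (1 / real N) * ?H \<le> 2 * ?T * ?H" using H0 by (intro mult_right_mono) auto
  then have KT: "?K \<le> 2 * ?T * ?H" by simp
  have s_T: "s \<le> (A + 2) * ?T * ?H"
    using s_le Qp KT by (simp only: distrib_right)
  have w_sup: "L2_norm w \<le> ?K"
  proof (rule L2_norm_le_sup[OF lip_L2[OF lw] _ K0])
    show "\<bar>w x\<bar> \<le> ?K" if "x \<in> Om" for x using W.lip_sup[OF lw, of x] that w0 by simp
  qed
  then have w2: "(L2_norm w)\<^sup>2 \<le> ?K\<^sup>2" by (intro power_mono) auto
  have Lz: "L2_norm (\<lambda>x. uh x - u0 x) = L2_norm (\<lambda>x. ec x - w x)"
    using L2_diff[OF uhL2 u0L2] L2_diff[OF lip_L2[OF lec] lip_L2[OF lw]] ae_z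
    by (intro L2_norm_AE) (auto simp: L2_def err_eq)
  have Lz2: "(L2_norm (\<lambda>x. uh x - u0 x))\<^sup>2 \<le> 2 * (20 * kernel_moment \<beta> * s\<^sup>2) + 2 * ?K\<^sup>2"
    unfolding Lz using L2_norm_diff_square_le[OF lip_L2[OF lec] lip_L2[OF lw]] poinc w2 by linarith
  have Bz: "B_delta \<beta> q lam \<delta> (\<lambda>x. uh x - u0 x) (\<lambda>x. uh x - u0 x) = W.form (\<lambda>x. ec x - w x) (\<lambda>x. ec x - w x)"
    using B_eq[OF _ _ ae_z ae_z lip_diff[OF lvh lu] lip_diff[OF lvh lu]] L2_diff[OF uhL2 u0L2]
    by (simp add: L2_def err_eq)
  have Bz2: "B_delta \<beta> q lam \<delta> (\<lambda>x. uh x - u0 x) (\<lambda>x. uh x - u0 x) \<le> 2 * s\<^sup>2 + 2 * ?K\<^sup>2"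
    unfolding Bz using W.form_diff_diff_le[OF lec lw] ww s2 by linarith
  have Bz0: "0 \<le> B_delta \<beta> q lam \<delta> (\<lambda>x. uh x - u0 x) (\<lambda>x. uh x - u0 x)"
    unfolding Bz by (rule W.form_nonneg)
  show "L2_norm (\<lambda>x. uh x - u0 x) \<le> W_norm \<beta> q lam \<delta> (\<lambda>x. uh x - u0 x)"
    unfolding W_norm_def using Bz0 by (intro real_le_rsqrt) simp
  \<comment> \<open>The square of a difference costs a factor 2: the energy of \<open>ec\<close>
    contributes 2, and its L2 norm twice the Poincare constant 20. The interpolation error enters
    through both norms, which gives \<open>4 * ?K\<^sup>2\<close>.\<close>
  let ?m = "sqrt (2 + 40 * kernel_moment \<beta>)"
  have m0: "0 \<le> ?m" by simp
  have m2: "?m\<^sup>2 = 2 + 40 * kernel_moment \<beta>" by simp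
  have "(L2_norm (\<lambda>x. uh x - u0 x))\<^sup>2 + B_delta \<beta> q lam \<delta> (\<lambda>x. uh x - u0 x) (\<lambda>x. uh x - u0 x)
      \<le> (2 + 40 * kernel_moment \<beta>) * s\<^sup>2 + 4 * ?K\<^sup>2"
    using add_mono[OF Lz2 Bz2] by (simp add: algebra_simps)
  also have "\<dots> = (?m * s)\<^sup>2 + (2 * ?K)\<^sup>2" by (simp only: power_mult_distrib m2) simp
  also have "\<dots> \<le> (?m * s + 2 * ?K)\<^sup>2"
    using mult_nonneg_nonneg[OF mult_nonneg_nonneg[OF m0 s0] K0] by (simp only: power2_sum)
  finally have "W_norm \<beta> q lam \<delta> (\<lambda>x. uh x - u0 x) \<le> ?m * s + 2 * ?K"
    unfolding W_norm_def by (rule real_le_lsqrt[rotated -1]) (use m0 s0 K0 Bz0 in auto)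
  also have "\<dots> \<le> ?m * ((A + 2) * ?T * ?H) + 2 * (2 * ?T * ?H)"
    using mult_left_mono[OF s_T m0] KT by linarith
  also have "\<dots> = (?m * (A + 2) + 4) * ?T * ?H" by (simp only: ring_distribs mult.assoc)
  finally show "W_norm \<beta> q lam \<delta> (\<lambda>x. uh x - u0 x) \<le>
    (?m * (4000 * (E * E) * (E * E) * (sqrt (20 * kernel_moment \<beta>) + 1) + 2) + 4) * ?T * ?H"
    unfolding A_def p_def .
qed

theorem corollary4p10:
  fixes \<beta> Cq :: real and q lam :: "real \<Rightarrow> real" and \<kappa> :: "nat \<Rightarrow> real"
  assumes "0 < \<beta>" and "\<beta> < 3"
    and "smooth_localization_pair q lam Cq \<kappa>"
  shows "\<exists>C>0. \<forall>\<delta> N f u0 uh. \<forall>h.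
    0 < \<delta> \<and> \<delta> < delta_star Cq \<kappa> \<and> 1 \<le> N \<and> h = 1 / real N \<and>
    f \<in> L2 \<and> local_solution f u0 \<and> u0 \<in> Hk 4 \<inter> H10 \<and>
    discrete_solution \<beta> q lam \<delta> N f uh \<longrightarrow>
      W_norm \<beta> q lam \<delta> (\<lambda>x. uh x - u0 x) \<le> C * (h + \<delta>\<^sup>2) * Hk_norm 4 u0 \<and>
      L2_norm (\<lambda>x. uh x - u0 x) \<le> C * (h + \<delta>\<^sup>2) * Hk_norm 4 u0"
proof -
  obtain E where E: "\<And>\<delta>. 0 < \<delta> \<Longrightarrow> \<delta> < delta_star Cq \<kappa> \<Longrightarrow>
      \<exists>e1 e2 e3. window_C3 \<beta> (eta_delta q lam \<delta>) e1 e2 e3 (\<delta> * E) E"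
    using eta_delta_window[OF assms] by blast
  \<comment> \<open>It depends on \<beta> through \<open>kernel_moment\<close> and on the
    localization pair through \<open>E\<close>, which is fixed before \<open>\<delta>\<close>,
    \<open>N\<close> and \<open>f\<close>.\<close>
  let ?C = "sqrt (2 + 40 * kernel_moment \<beta>) * (4000 * (E * E) * (E * E) * (sqrt (20 * kernel_moment \<beta>) + 1) + 2) + 4"
  have "0 \<le> sqrt (2 + 40 * kernel_moment \<beta>) * (4000 * (E * E) * (E * E) * (sqrt (20 * kernel_moment \<beta>) + 1) + 2)"
    by (intro mult_nonneg_nonneg[of "sqrt _"] add_nonneg_nonneg mult_nonneg_nonneg[of "4000 * (E * E) * (E * E)"]) auto
  then have "0 < ?C" by linarith
  moreover have "W_norm \<beta> q lam \<delta> (\<lambda>x. uh x - u0 x) \<le> ?C * (h + \<delta>\<^sup>2) * Hk_norm 4 u0 \<and>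
      L2_norm (\<lambda>x. uh x - u0 x) \<le> ?C * (h + \<delta>\<^sup>2) * Hk_norm 4 u0"
    if a: "0 < \<delta> \<and> \<delta> < delta_star Cq \<kappa> \<and> 1 \<le> N \<and> h = 1 / real N \<and>
      f \<in> L2 \<and> local_solution f u0 \<and> u0 \<in> Hk 4 \<inter> H10 \<and> discrete_solution \<beta> q lam \<delta> N f uh" for \<delta> N f u0 uh h
  proof -
    obtain e1 e2 e3 where win: "window_C3 \<beta> (eta_delta q lam \<delta>) e1 e2 e3 (\<delta> * E) E"
      using E[of \<delta>] a by blast
    have a': "0 < \<delta>" "1 \<le> N" "f \<in> L2" "local_solution f u0" "u0 \<in> Hk 4" "discrete_solution \<beta> q lam \<delta> N f uh" and h: "h = 1 / real N"
      using a by auto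
    note ge = galerkin_error[OF win a']
    show ?thesis using ge(1) order_trans[OF ge(2) ge(1)] unfolding h by blast
  qed
  ultimately show ?thesis by blast
qed

end
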